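(* Let $2<p\le\infty$. Let $\mathcal{H}$ be a Hilbert space with norm $\mathcal{N}$, and let $C\subset\mathbb{R}^n$ be an open convex cone which is contained in or is any of the $2^n$ $n$-rants $C_v$. Let $\mathbf{f}:T^C\to\mathcal{H}$ be analytic on $T^C=\mathbb{R}^n+iC$. Assume that there are a nonnegative integer $R$ and an integer $k>1$ such that for every compact subcone $C'\subset C$ and every $r>0$ there is a constant $M(C',r)$ (depending on $C'$ and $r$, while $R$ and $k$ depend on neither) with $$\mathcal{N}(\mathbf{f}(x+iy))\le M(C',r)\,(1+|x|)^{R}\,|y|^{-k},\qquad x\in\mathbb{R}^n,\ y\in C'\setminus (C'\cap N(\overline{0},r)).$$ Assume that the boundary value of $\mathbf{f}$ in $\mathcal{S}'(\mathbb{R}^n,\mathcal{H})$ is a function $\mathbf{h}\in L^p(\mathbb{R}^n,\mathcal{H})$, i.e. $$\lim_{y\to\overline{0},\,y\in C}\mathcal{N}\Big(\int_{\mathbb{R}^n}\mathbf{f}(x+iy)\phi(x)\,dx-\int_{\mathbb{R}^n}\mathbf{h}(x)\phi(x)\,dx\Big)=0,\qquad \phi\in\mathcal{S}(\mathbb{R}^n).$$ Then $\mathbf{f}\in H^p(T^C,\mathcal{H})$ and $$\mathbf{f}(z)=\int_{\mathbb{R}^n}\mathbf{h}(t)\,Q(z;t)\,dt,\qquad z\in T^C.$$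
   Context: A set $C\subset\mathbb{R}^n$ is a cone (with vertex $\overline{0}=(0,\dots,0)$) if $y\in C$ implies $\lambda y\in C$ for all $\lambda>0$. Its projection $pr(C)$ is its intersection with the unit sphere $|y|=1$. A cone $C'\subset C$ is a compact subcone of $C$ if $pr(\overline{C'})\subset pr(C)$. The dual cone is $C^*=\{t\in\mathbb{R}^n:\langle t,y\rangle\ge 0\text{ for all }y\in C\}$. For $v=(v_1,\dots,v_n)\in\{0,1\}^n$, the $n$-rant is $C_v=\{y\in\mathbb{R}^n:(-1)^{v_j}y_j>0,\ j=1,\dots,n\}$. $N(\overline{0},r)$ is the closed ball of radius $r$ centered at $\overline{0}$. "$y\to\overline{0}$, $y\in C$" means $y\to\overline{0}$ with $y\in C'$, for every compact subcone $C'$ of $C$. $L^p(\mathbb{R}^n,\mathcal{H})$, $1\le p<\infty$, is the space of strongly measurable functions $\mathbf{f}:\mathbb{R}^n\to\mathcal{H}$ with $\int_{\mathbb{R}^n}(\mathcal{N}(\mathbf{f}(t)))^p\,dt<\infty$; for $p=\infty$ one requires $\mathcal{N}(\mathbf{f}(\cdot))$ to be essentially bounded. $\mathcal{S}(\mathbb{R}^n)$ is the Schwartz space of scalar rapidly decreasing functions and $\mathcal{S}'(\mathbb{R}^n,\mathcal{H})$ is the space of $\mathcal{H}$-valued tempered distributions (continuous linear maps $\mathcal{S}(\mathbb{R}^n)\to\mathcal{H}$); a function $\mathbf{f}$ acts by $\langle\mathbf{f},\phi\rangle=\int\mathbf{f}(t)\phi(t)\,dt$ (Bochner integral). The Hardy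 space $H^p(T^C,\mathcal{H})$, $1\le p<\infty$, consists of the analytic functions $\mathbf{f}:T^C\to\mathcal{H}$ for which there is a constant $A$ independent of $y\in C$ with $\int_{\mathbb{R}^n}(\mathcal{N}(\mathbf{f}(x+iy)))^p\,dx\le A$ for all $y\in C$; $H^\infty(T^C,\mathcal{H})$ consists of the analytic $\mathbf{f}$ with $\mathcal{N}(\mathbf{f}(z))$ bounded on $T^C$. The Cauchy kernel of $T^C$ is $K(z-t)=\int_{C^*}e^{2\pi i\langle z-t,\eta\rangle}\,d\eta$, i.e. $K(z)=\int_{C^*}e^{2\pi i\langle z,\eta\rangle}\,d\eta$ for $z\in T^C$, and the Poisson kernel of $T^C$ is $Q(z;t)=\dfrac{|K(z-t)|^2}{K(2iy)}$, for $t\in\mathbb{R}^n$, $z=x+iy\in T^C$. *)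

theory Defs
  imports "HOL-Analysis.Analysis"
begin

section \<open>Complex Hilbert spaces\<close>

text \<open>
  The distribution has only real inner product spaces. A complex Hilbert space is a (real)
  Banach space with a complex scalar multiplication extending the real one and a sesquilinear
  Hermitian form inducing the given norm; completeness comes from \<^class>\<open>banach\<close>.
\<close>

class complex_hilbert = banach +
  fixes scaleC :: "complex \<Rightarrow> 'a \<Rightarrow> 'a" (infixr \<open>*\<^sub>C\<close> 75)
    and cinner :: "'a \<Rightarrow> 'a \<Rightarrow> complex"
  assumes scaleC_add_right: "a *\<^sub>C (x + y) = a *\<^sub>C x + a *\<^sub>C y"
    and scaleC_add_left: "(a + b) *\<^sub>C x = a *\<^sub>C x + b *\<^sub>C x"
    and scaleC_scaleC: "a *\<^sub>C (b *\<^sub>C x) = (a * b) *\<^sub>C x"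
    and scaleC_of_real: "complex_of_real r *\<^sub>C x = r *\<^sub>R x"
    and cinner_commute: "cinner x y = cnj (cinner y x)"
    and cinner_add_left: "cinner (x + y) z = cinner x z + cinner y z"
    and cinner_scaleC_left: "cinner (a *\<^sub>C x) y = a * cinner x y"
    and cinner_self: "cinner x x = complex_of_real ((norm x)\<^sup>2)"

instantiation complex :: complex_hilbert
begin

definition scaleC_complex :: "complex \<Rightarrow> complex \<Rightarrow> complex" where
  "scaleC_complex a x = a * x"

definition cinner_complex :: "complex \<Rightarrow> complex \<Rightarrow> complex" where
  "cinner_complex x y = x * cnj y"

instance
  by standard
    (simp_all add: scaleC_complex_def cinner_complex_def algebra_simps scaleR_conv_of_real
      complex_norm_square del: of_real_power)

end


section \<open>Strong measurability, Bochner integral and Lebesgue spaces\<close>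

text \<open>
  The library's \<^const>\<open>has_bochner_integral\<close> requires a second countable codomain. The following
  definitions are the same ones for arbitrary, possibly nonseparable, normed spaces.
\<close>

definition strongly_measurable :: "'a measure \<Rightarrow> ('a \<Rightarrow> 'b::real_normed_vector) \<Rightarrow> bool" where
  "strongly_measurable M f \<longleftrightarrow>
     (\<exists>s. (\<forall>i::nat. simple_function M (s i)) \<and> (AE x in M. (\<lambda>i. s i x) \<longlonglongrightarrow> f x))"

definition has_vbochner_integral ::
    "'a measure \<Rightarrow> ('a \<Rightarrow> 'b::real_normed_vector) \<Rightarrow> 'b \<Rightarrow> bool" where
  "has_vbochner_integral M f v \<longleftrightarrow>
     strongly_measurable M f \<and>
     (\<exists>s. (\<forall>i::nat. Bochner_Integration.simple_bochner_integrable M (s i)) \<and>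
          (\<lambda>i. \<integral>\<^sup>+ x. ennreal (norm (f x - s i x)) \<partial>M) \<longlonglongrightarrow> 0 \<and>
          (\<lambda>i. Bochner_Integration.simple_bochner_integral M (s i)) \<longlonglongrightarrow> v)"

definition vbochner_integral :: "'a measure \<Rightarrow> ('a \<Rightarrow> 'b::real_normed_vector) \<Rightarrow> 'b" where
  "vbochner_integral M f =
     (if \<exists>v. has_vbochner_integral M f v then THE v. has_vbochner_integral M f v else 0)"

definition in_Lp :: "ennreal \<Rightarrow> (real^'n \<Rightarrow> 'h::real_normed_vector) \<Rightarrow> bool" where
  "in_Lp p f \<longleftrightarrow>
     strongly_measurable lebesgue f \<and>
     (if p = \<infinity> then \<exists>B. AE t in lebesgue. norm (f t) \<le> B
      else (\<integral>\<^sup>+ t. ennreal (norm (f t) powr enn2real p) \<partial>lebesgue) < \<infinity>)"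


section \<open>Cones and tubes\<close>

text \<open>
  The library's \<^const>\<open>cone\<close> also demands closure under multiplication by 0, which fails for the
  open cones considered here.
\<close>

definition is_cone :: "(real^'n) set \<Rightarrow> bool" where
  "is_cone C \<longleftrightarrow> (\<forall>y\<in>C. \<forall>l>0. l *\<^sub>R y \<in> C)"

definition pr_cone :: "(real^'n) set \<Rightarrow> (real^'n) set" where
  "pr_cone C = C \<inter> sphere 0 1"

definition compact_subcone :: "(real^'n) set \<Rightarrow> (real^'n) set \<Rightarrow> bool" where
  "compact_subcone C' C \<longleftrightarrow> is_cone C' \<and> C' \<subseteq> C \<and> pr_cone (closure C') \<subseteq> pr_cone C"

definition dual_cone :: "(real^'n) set \<Rightarrow> (real^'n) set" where
  "dual_cone C = {t. \<forall>y\<in>C. t \<bullet> y \<ge> 0}"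

definition n_rant :: "('n \<Rightarrow> nat) \<Rightarrow> (real^'n) set" where
  "n_rant v = {y. \<forall>j. (-1) ^ v j * y $ j > 0}"

definition cvec :: "real^'n \<Rightarrow> complex^'n" where
  "cvec x = (\<chi> j. complex_of_real (x $ j))"

definition Im_vec :: "complex^'n \<Rightarrow> real^'n" where
  "Im_vec z = (\<chi> j. Im (z $ j))"

definition tube_pt :: "real^'n \<Rightarrow> real^'n \<Rightarrow> complex^'n" where
  "tube_pt x y = cvec x + \<i> *s cvec y"

definition tube :: "(real^'n) set \<Rightarrow> (complex^'n) set" where
  "tube C = {tube_pt x y | x y. y \<in> C}"


section \<open>Analytic functions and Hardy spaces\<close>

text \<open>
  As for \<^const>\<open>holomorphic_on\<close> on open sets, analyticity is complex differentiability:
  a Frechet derivative exists and is complex linear. Only used for open \<open>U\<close>.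
\<close>

definition vanalytic_on ::
    "(complex^'n \<Rightarrow> 'h::complex_hilbert) \<Rightarrow> (complex^'n) set \<Rightarrow> bool" where
  "vanalytic_on f U \<longleftrightarrow>
     (\<forall>z\<in>U. \<exists>D. (f has_derivative D) (at z) \<and> (\<forall>c w. D (c *s w) = c *\<^sub>C D w))"

definition in_Hardy ::
    "ennreal \<Rightarrow> (real^'n) set \<Rightarrow> (complex^'n \<Rightarrow> 'h::complex_hilbert) \<Rightarrow> bool" where
  "in_Hardy p C f \<longleftrightarrow>
     vanalytic_on f (tube C) \<and>
     (if p = \<infinity> then \<exists>B. \<forall>z\<in>tube C. norm (f z) \<le> B
      else \<exists>A::real. \<forall>y\<in>C.
             (\<integral>\<^sup>+ x. ennreal (norm (f (tube_pt x y)) powr enn2real p) \<partial>lebesgue) \<le> ennreal A)"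


section \<open>Schwartz functions and boundary values\<close>

definition partial_deriv :: "'n \<Rightarrow> (real^'n \<Rightarrow> complex) \<Rightarrow> real^'n \<Rightarrow> complex" where
  "partial_deriv j \<phi> x = frechet_derivative \<phi> (at x) (axis j 1)"

text \<open>
  A list of coordinates plays the role of a multi-index. Requiring every iterated partial
  derivative to be differentiable says that the function is smooth.
\<close>

fun iter_partial :: "'n list \<Rightarrow> (real^'n \<Rightarrow> complex) \<Rightarrow> real^'n \<Rightarrow> complex" where
  "iter_partial [] \<phi> = \<phi>"
| "iter_partial (j # js) \<phi> = partial_deriv j (iter_partial js \<phi>)"

definition schwartz :: "(real^'n \<Rightarrow> complex) \<Rightarrow> bool" where
  "schwartz \<phi> \<longleftrightarrow>
     (\<forall>js. (\<forall>x. iter_partial js \<phi> differentiable (at x)) \<and>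
           (\<forall>m::nat. \<exists>B. \<forall>x. (1 + norm x) ^ m * norm (iter_partial js \<phi> x) \<le> B))"

text \<open>
  Convergence as \<open>y \<rightarrow> 0\<close>, \<open>y \<in> C\<close> means convergence within every compact subcone of \<open>C\<close>.
\<close>

definition has_boundary_value ::
    "(real^'n) set \<Rightarrow> (complex^'n \<Rightarrow> 'h::complex_hilbert) \<Rightarrow> (real^'n \<Rightarrow> 'h) \<Rightarrow> bool" where
  "has_boundary_value C f h \<longleftrightarrow>
     (\<forall>\<phi>. schwartz \<phi> \<longrightarrow>
       (\<forall>C'. compact_subcone C' C \<longrightarrow>
         ((\<lambda>y. norm (vbochner_integral lebesgue (\<lambda>x. \<phi> x *\<^sub>C f (tube_pt x y))
                    - vbochner_integral lebesgue (\<lambda>x. \<phi> x *\<^sub>C h x)))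
            \<longlongrightarrow> 0) (at 0 within C')))"


section \<open>Cauchy and Poisson kernels\<close>

definition cauchy_kernel :: "(real^'n) set \<Rightarrow> complex^'n \<Rightarrow> complex" where
  "cauchy_kernel C z =
     (LINT \<eta>:dual_cone C|lebesgue.
        exp (2 * complex_of_real pi * \<i> * (\<Sum>j\<in>UNIV. z $ j * complex_of_real (\<eta> $ j))))"

text \<open>
  The denominator is a positive real number for \<open>z\<close> in the tube, so \<open>Q\<close> is real valued there,
  though typed as complex.
\<close>

definition poisson_kernel :: "(real^'n) set \<Rightarrow> complex^'n \<Rightarrow> real^'n \<Rightarrow> complex" where
  "poisson_kernel C z t =
     complex_of_real ((cmod (cauchy_kernel C (z - cvec t)))\<^sup>2)
       / cauchy_kernel C ((2 * \<i>) *s cvec (Im_vec z))"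

end

theory Submission
  imports Defs "HOL-Probability.Probability" "HOL-Complex_Analysis.Complex_Analysis"
begin

text \<open>
  Pairing with a fixed vector reduces the representation to scalar \<open>f\<close>. Multiply \<open>f\<close> by a product of
  one-variable functions \<open>exp (1 - csqrt (1 - \<i> c z\<^sub>j))\<close>, which are bounded by 1 on the tube of the orthant
  containing \<open>C\<close>, decrease rapidly, and tend to 1 as \<open>c \<rightarrow> 0\<close>. Times \<open>exp (-2\<pi>\<i>\<langle>z,\<eta>\<rangle>)\<close> they are Schwartz
  functions on the real space, so the boundary value hypothesis and a contour shift along a single ray
  express the Fourier transform \<open>H\<close> of the regularised \<open>h\<close> through \<open>f(\<cdot> + \<i>y)\<close> for every \<open>y\<close> in \<open>C\<close>.
  Moving \<open>y\<close> to infinity shows that \<open>H\<close> vanishes off the dual cone, and Fourier inversion recovers \<open>f\<close> from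
  \<open>H\<close>. Since \<open>C\<^sup>* + C\<^sup>*\<close> lies in \<open>C\<^sup>*\<close>, integrating \<open>h\<close> against the squared modulus of the Cauchy kernel gives
  \<open>K(2\<i>y) f\<close>; then the regularisation is removed. The Hardy space bound follows because the Poisson
  kernel is a nonnegative convolution kernel of mass at most 1, by Bessel's inequality.
\<close>


section \<open>Hilbert space valued Bochner integrals\<close>

text \<open>The obstacle is that neither \<open>h\<close>, which lies only in some
  \<open>L^p\<close> with \<open>p > 2\<close>, nor \<open>f(x + iy)\<close> as a function of
  \<open>x\<close>, which may grow like \<open>(1 + |x|)^R\<close>, needs to have a Fourier
  transform that is a function. Multiplying both by one factor cures this if the factor is
  holomorphic slightly beyond the closed tube over the orthant, so that a contour can start at real
  points; decreases faster than any power of \<open>x\<close>, uniformly in \<open>y\<close> over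
  the orthant, so that \<open>y\<close> may go to infinity; and has modulus at most 1 at real
  points, so that dominated convergence removes it. A Gaussian fails the second demand because it
  grows in imaginary directions. The exponential of a square root meets all three. The orthant
  enters because the factor is built coordinate by coordinate and each coordinate needs a fixed
  sign. All exponents are treated together through a bound \<open>\<beta> + g\<close> of the norm of
  \<open>h\<close>, with \<open>g\<close> integrable: a constant for \<open>p = \<infinity>\<close>,
  and \<open>1 + |h|^p\<close> for finite \<open>p\<close>. The constant is paired with the
  integrability of the Poisson kernel, and \<open>g\<close> with its boundedness.\<close>

lemma cinner_add_right: "cinner x (y + z) = cinner x y + cinner (x::'h::complex_hilbert) z"
  by (metis cinner_add_left cinner_commute complex_cnj_add)

lemma cinner_scaleC_right: "cinner x (a *\<^sub>C y) = cnj a * cinner (x::'h::complex_hilbert) y"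
  by (metis cinner_commute cinner_scaleC_left complex_cnj_mult)

lemma cinner_scaleR_left: "cinner (r *\<^sub>R x) y = of_real r * cinner (x::'h::complex_hilbert) y"
  by (metis cinner_scaleC_left scaleC_of_real)

text \<open>The class ties the norm to real scalars only; for complex ones homogeneity is read off
  from the Hermitian form through \<open>cinner_self\<close>.\<close>

lemma norm_scaleC: "norm (a *\<^sub>C x) = cmod a * norm (x::'h::complex_hilbert)"
proof -
  have "of_real ((norm (a *\<^sub>C x))\<^sup>2) = (a * cnj a) * of_real ((norm x)\<^sup>2)"
    by (simp only: cinner_self[symmetric] cinner_scaleC_left cinner_scaleC_right mult_ac)
  also have "\<dots> = of_real ((cmod a * norm x)\<^sup>2)"
    by (simp add: complex_norm_square[symmetric] power_mult_distrib del: of_real_power)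
  finally have "(norm (a *\<^sub>C x))\<^sup>2 = (cmod a * norm x)\<^sup>2"
    using of_real_eq_iff by blast
  then show ?thesis by simp
qed

lemma cinner_Cauchy_Schwarz: "cmod (cinner x y) \<le> norm x * norm (y::'h::complex_hilbert)"
proof (cases "y = 0")
  case True
  have "cinner x (0 + 0) = cinner x 0 + cinner x (0::'h)" by (rule cinner_add_right)
  then show ?thesis using True by simp
next
  case False
  \<comment> \<open>\<open>c\<close> is the coefficient of the orthogonal projection of
    \<open>x\<close> onto \<open>y\<close>; the claim is that the remainder has nonnegative squared
    norm.\<close>
  define c where "c = cinner x y / of_real ((norm y)\<^sup>2)"
  have y: "(norm y)\<^sup>2 > 0" using False by simp
  have "cinner (x + (- c) *\<^sub>C y) (x + (- c) *\<^sub>C y)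
      = of_real ((norm x)\<^sup>2) - cnj c * cinner x y - c * cnj (cinner x y) + c * cnj c * of_real ((norm y)\<^sup>2)"
    by (simp add: cinner_add_left cinner_add_right cinner_scaleC_left cinner_scaleC_right cinner_self[of x] cinner_self[of y]
        cinner_commute[of y x] del: of_real_power) (simp add: algebra_simps del: of_real_power)
  also have "c * cnj c * of_real ((norm y)\<^sup>2) = c * cnj (cinner x y)"
    using False by (simp add: c_def power2_eq_square)
  also have "cnj c * cinner x y = of_real ((cmod (cinner x y))\<^sup>2 / (norm y)\<^sup>2)"
    by (simp add: c_def complex_norm_square mult.commute del: of_real_power)
  finally have "of_real ((norm (x + (- c) *\<^sub>C y))\<^sup>2)
      = complex_of_real ((norm x)\<^sup>2 - (cmod (cinner x y))\<^sup>2 / (norm y)\<^sup>2)"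
    by (simp add: cinner_self del: of_real_power)
  then have "(norm (x + (- c) *\<^sub>C y))\<^sup>2 = (norm x)\<^sup>2 - (cmod (cinner x y))\<^sup>2 / (norm y)\<^sup>2"
    using of_real_eq_iff by blast
  then have "(cmod (cinner x y))\<^sup>2 / (norm y)\<^sup>2 \<le> (norm x)\<^sup>2"
    by (metis diff_ge_0_iff_ge zero_le_power2)
  then have "(cmod (cinner x y))\<^sup>2 \<le> (norm x * norm y)\<^sup>2"
    using y by (simp add: divide_le_eq power_mult_distrib)
  then show ?thesis by (simp add: power2_le_iff_abs_le)
qed

lemma bounded_linear_cinner_left: "bounded_linear (\<lambda>x::'h::complex_hilbert. cinner x e)"
proof (rule bounded_linear_intro)
  show "norm (cinner x e) \<le> norm x * norm e" for x :: 'h by (rule cinner_Cauchy_Schwarz)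
qed (simp_all add: cinner_add_left cinner_scaleR_left scaleR_conv_of_real)


lemma cinner_diff_left: "cinner (x - y) e = cinner x e - cinner (y::'h::complex_hilbert) e"
  using linear_diff[OF bounded_linear.linear[OF bounded_linear_cinner_left]] .

lemma bounded_bilinear_scaleC: "bounded_bilinear (\<lambda>a (x::'h::complex_hilbert). a *\<^sub>C x)"
proof (rule bounded_bilinear.intro)
  show "\<exists>K. \<forall>a b. norm (a *\<^sub>C b) \<le> norm a * norm (b::'h) * K"
    by (intro exI[of _ 1]) (simp add: norm_scaleC)
  fix r :: real and a :: complex and b :: 'h
  have "r *\<^sub>R a = of_real r * a" by (simp add: scaleR_conv_of_real)
  then show "(r *\<^sub>R a) *\<^sub>C b = r *\<^sub>R (a *\<^sub>C b)"

    by (metis scaleC_of_real scaleC_scaleC)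
  show "a *\<^sub>C r *\<^sub>R b = r *\<^sub>R (a *\<^sub>C b)"
    by (metis scaleC_of_real scaleC_scaleC mult.commute)
qed (simp_all add: scaleC_add_left scaleC_add_right)

text \<open>The choice \<open>e = x - y\<close> leaves a vanishing squared norm. Identities between
  vector integrals are reduced to scalar ones in this way.\<close>

lemma cinner_eqI:
  fixes x y :: "'h::complex_hilbert"
  assumes "\<And>e. cinner x e = cinner y e"
  shows "x = y"
proof -
  have "cinner (x - y) (x - y) = 0" using assms by (simp add: cinner_diff_left)
  then show ?thesis by (simp add: cinner_self)
qed

section \<open>Strong measurability over completed measures\<close>

lemma strongly_measurable_compose:
  assumes "strongly_measurable M f" and g: "\<And>x. isCont g x"
  shows "strongly_measurable M (\<lambda>x. g (f x))"
proof -
  obtain s where s: "\<And>i::nat. simple_function M (s i)" "AE x in M. (\<lambda>i. s i x) \<longlonglongrightarrow> f x"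
    using assms unfolding strongly_measurable_def by blast
  show ?thesis unfolding strongly_measurable_def
  proof (intro exI[of _ "\<lambda>i x. g (s i x)"] conjI allI)
    fix i show "simple_function M (\<lambda>x. g (s i x))"
      using simple_function_compose1[OF s(1)] by blast
    show "AE x in M. (\<lambda>i. g (s i x)) \<longlonglongrightarrow> g (f x)"
      using s(2) by eventually_elim (rule isCont_tendsto_compose[OF g])
  qed
qed

text \<open>Preimages under \<open>f\<close> and \<open>g\<close> differ only inside a null set, and
  the completion contains all subsets of null sets.\<close>

lemma measurable_completion_AE_eq:
  fixes f g :: "'a \<Rightarrow> 'b::topological_space"
  assumes g: "g \<in> borel_measurable (completion M)" and eq: "AE x in completion M. g x = f x"
  shows "f \<in> borel_measurable (completion M)"
proof (rule measurableI)
  fix A :: "'b set" assume A: "A \<in> sets borel"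
  show "f -` A \<inter> space (completion M) \<in> sets (completion M)"
  proof (rule completion.in_sets_AE[OF _ measurable_sets[OF g A]])
    show "AE x in completion M.
        x \<in> g -` A \<inter> space (completion M) \<longleftrightarrow> x \<in> f -` A \<inter> space (completion M)"
      using eq by eventually_elim auto
  qed auto
qed simp

text \<open>The simple functions converge only almost everywhere, so the limit is first set to 0 on
  the exceptional null set \<open>N\<close>; completeness then carries measurability back to
  \<open>f\<close>.\<close>

lemma strongly_measurable_imp_borel_measurable:
  fixes f :: "'a \<Rightarrow> 'b::{real_normed_vector, second_countable_topology}"
  assumes "strongly_measurable (completion M) f"
  shows "f \<in> borel_measurable (completion M)"
proof -
  obtain s where s: "\<And>i::nat. simple_function (completion M) (s i)"
      "AE x in completion M. (\<lambda>i. s i x) \<longlonglongrightarrow> f x"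
    using assms unfolding strongly_measurable_def by blast
  have sm: "s i \<in> borel_measurable (completion M)" for i
    using borel_measurable_simple_function[OF s(1)] .
  obtain N where N: "\<And>x. x \<in> space (completion M) - N \<Longrightarrow> (\<lambda>i. s i x) \<longlonglongrightarrow> f x"
    "N \<in> null_sets (completion M)"
    using AE_E3[OF s(2)] by metis
  have Nm: "N \<in> sets (completion M)" using N by auto
  define g where "g x = (if x \<in> N then 0 else f x)" for x
  have "g \<in> borel_measurable (completion M)"
  proof (rule borel_measurable_LIMSEQ_metric)
    fix i show "(\<lambda>x. if x \<in> N then 0 else s i x) \<in> borel_measurable (completion M)"
      using Nm sm by measurable
  next
    fix x assume "x \<in> space (completion M)"
    then show "(\<lambda>i. if x \<in> N then 0 else s i x) \<longlonglongrightarrow> g x"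
      using N(1) by (auto simp: g_def)
  qed
  moreover have "AE x in completion M. g x = f x"
    by (rule AE_I'[OF N(2)]) (auto simp: g_def)
  ultimately show ?thesis
    by (rule measurable_completion_AE_eq)
qed

lemma borel_measurable_imp_strongly_measurable:
  fixes f :: "'a \<Rightarrow> 'b::{real_normed_vector, second_countable_topology}"
  assumes "f \<in> borel_measurable M"
  shows "strongly_measurable M f"
proof -
  obtain s where "\<And>i::nat. simple_function M (s i)" "\<And>x. x \<in> space M \<Longrightarrow> (\<lambda>i. s i x) \<longlonglongrightarrow> f x"
    using borel_measurable_implies_sequence_metric[OF assms, of 0] by blast
  then show ?thesis
    unfolding strongly_measurable_def by (intro exI[of _ s]) auto
qed


lemma strongly_measurable_scaleC:
  fixes f :: "'a \<Rightarrow> 'h::complex_hilbert"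
  assumes "strongly_measurable M a" "strongly_measurable M f"
  shows "strongly_measurable M (\<lambda>x. a x *\<^sub>C f x)"
proof -
  obtain s where s: "\<And>i::nat. simple_function M (s i)" "AE x in M. (\<lambda>i. s i x) \<longlonglongrightarrow> a x"
    using assms(1) unfolding strongly_measurable_def by blast
  obtain t where t: "\<And>i::nat. simple_function M (t i)" "AE x in M. (\<lambda>i. t i x) \<longlonglongrightarrow> f x"
    using assms(2) unfolding strongly_measurable_def by blast
  show ?thesis unfolding strongly_measurable_def
  proof (intro exI[of _ "\<lambda>i x. s i x *\<^sub>C t i x"] conjI allI)
    fix i show "simple_function M (\<lambda>x. s i x *\<^sub>C t i x)"
      by (rule simple_function_compose2[OF s(1) t(1)])
    show "AE x in M. (\<lambda>i. s i x *\<^sub>C t i x) \<longlonglongrightarrow> a x *\<^sub>C f x"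
      using s(2) t(2)
      by eventually_elim (rule bounded_bilinear.tendsto[OF bounded_bilinear_scaleC])
  qed
qed

lemma strongly_measurable_continuous:
  fixes g :: "real^'n \<Rightarrow> 'h::real_normed_vector"
  assumes "\<And>x. isCont g x"
  shows "strongly_measurable lebesgue g"
proof -
  have "(\<lambda>x::real^'n. x) \<in> borel_measurable lebesgue"
    by (rule measurable_completion) simp
  from strongly_measurable_compose[OF borel_measurable_imp_strongly_measurable[OF this] assms]
  show ?thesis by simp
qed

lemma borel_measurable_norm_strongly:
  assumes "strongly_measurable (completion M) F"
  shows "(\<lambda>x. norm (F x)) \<in> borel_measurable (completion M)"
  by (rule strongly_measurable_imp_borel_measurable, rule strongly_measurable_compose[OF assms])
    (intro continuous_intros)

lemma strongly_measurable_diff_simple: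
  assumes "strongly_measurable M F" "simple_function M s"
  shows "strongly_measurable M (\<lambda>x. F x - s x)"
proof -
  obtain t where t: "\<And>i::nat. simple_function M (t i)" "AE x in M. (\<lambda>i. t i x) \<longlonglongrightarrow> F x"
    using assms(1) unfolding strongly_measurable_def by blast
  show ?thesis unfolding strongly_measurable_def
    using t assms(2)
    by (intro exI[of _ "\<lambda>i x. t i x - s x"] conjI allI simple_function_diff)
      (auto intro: simple_function_compose2 elim: eventually_mono intro!: tendsto_intros)
qed

text \<open>As in the library's proof for separable codomains, the approximating simple functions are
  truncated to be dominated by \<open>2 * norm F\<close>.\<close>

lemma has_vbochner_integral_ex:
  fixes F :: "'a \<Rightarrow> 'h::banach"
  assumes F: "strongly_measurable (completion M) F"
    and fin: "(\<integral>\<^sup>+ x. ennreal (norm (F x)) \<partial>completion M) < \<infinity>"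
  shows "\<exists>v. has_vbochner_integral (completion M) F v"
proof -
  let ?M = "completion M"
  let ?S = "Bochner_Integration.simple_bochner_integral ?M :: (_ \<Rightarrow> 'h) \<Rightarrow> _"
  have nF[measurable]: "(\<lambda>x. norm (F x)) \<in> borel_measurable ?M"
    by (rule borel_measurable_norm_strongly[OF F])
  obtain s where s: "\<And>i::nat. simple_function ?M (s i)" "AE x in ?M. (\<lambda>i. s i x) \<longlonglongrightarrow> F x"
    using F unfolding strongly_measurable_def by blast
  define A where "A i = {x \<in> space ?M. norm (s i x) \<le> 2 * norm (F x)}" for i
  have A: "A i \<inter> space ?M \<in> sets ?M" for i
  proof -
    have "(\<lambda>x. norm (s i x)) \<in> borel_measurable ?M"
      by (intro borel_measurable_simple_function simple_function_compose1[OF s(1)])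
    then have "A i \<in> sets ?M" unfolding A_def by measurable
    then show ?thesis by (rule sets.Int) simp
  qed
  define t where "t i x = (if x \<in> A i then s i x else 0)" for i x
  have t: "simple_function ?M (t i)" for i
  proof -
    have "simple_function ?M (\<lambda>x. if x \<in> A i then s i x else 0)"
      by (rule simple_function_If_set[OF s(1) simple_function_const]) (rule A)

    then show ?thesis unfolding t_def .
  qed
  have tb: "norm (t i x) \<le> 2 * norm (F x)" if "x \<in> space ?M" for i x
    using that by (auto simp: t_def A_def)
  have fin2: "(\<integral>\<^sup>+ x. ennreal (c * norm (F x)) \<partial>?M) < \<infinity>" if "c \<ge> 0" for c
    using fin that by (simp add: ennreal_mult nn_integral_cmult ennreal_mult_less_top)
  have "(\<integral>\<^sup>+ x. ennreal (norm (t i x)) \<partial>?M) < \<infinity>" for i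
    by (rule le_less_trans[OF nn_integral_mono fin2[of 2]]) (auto intro!: ennreal_leI tb)
  then have tI: "Bochner_Integration.simple_bochner_integrable ?M (t i)" for i
    by (rule simple_bochner_integrableI_bounded[OF t])
  have tlim: "AE x in ?M. (\<lambda>i. t i x) \<longlonglongrightarrow> F x"
    using s(2) AE_space
  proof eventually_elim
    case (elim x)
    show ?case
    \<comment> \<open>At a zero of \<open>F\<close> the bound \<open>tb\<close> forces
      \<open>t i x = 0\<close>. Elsewhere the factor 2 leaves enough room for the truncation to
      become inactive eventually.\<close>
    proof (cases "F x = 0")
      case True
      have "t i x = 0" for i using tb[OF elim(2), of i] True by simp
      then show ?thesis using True by simp
    next
      case False
      have "(\<lambda>i. norm (s i x)) \<longlonglongrightarrow> norm (F x)" using elim(1) by (rule tendsto_norm)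
      then have "eventually (\<lambda>i. norm (s i x) < 2 * norm (F x)) sequentially"
        by (rule order_tendstoD) (use False in simp)
      then have "eventually (\<lambda>i. t i x = s i x) sequentially"
        by eventually_elim (use elim in \<open>auto simp: t_def A_def\<close>)
      then show ?thesis using elim(1) by (simp cong: tendsto_cong)
    qed
  qed
  have dm[measurable]: "(\<lambda>x. norm (F x - t i x)) \<in> borel_measurable ?M" for i
    by (rule borel_measurable_norm_strongly[OF strongly_measurable_diff_simple[OF F t]])
  have "(\<lambda>i. \<integral>\<^sup>+ x. ennreal (norm (F x - t i x)) \<partial>?M) \<longlonglongrightarrow> (\<integral>\<^sup>+ x. 0 \<partial>?M)"
  proof (rule nn_integral_dominated_convergence[where w = "\<lambda>x. ennreal (3 * norm (F x))"])
    show "AE x in ?M. ennreal (norm (F x - t i x)) \<le> ennreal (3 * norm (F x))" for i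
      using AE_space
    proof eventually_elim
      case (elim x)
      show ?case using tb[OF elim, of i] norm_triangle_ineq4[of "F x" "t i x"]
        by (intro ennreal_leI) linarith
    qed
    show "AE x in ?M. (\<lambda>i. ennreal (norm (F x - t i x))) \<longlonglongrightarrow> 0"
      using tlim
    proof eventually_elim
      case (elim x)
      have "(\<lambda>i. norm (F x - t i x)) \<longlonglongrightarrow> norm (F x - F x)" by (intro tendsto_intros elim)
      then show ?case using tendsto_ennrealI by fastforce
    qed
  qed (use fin2[of 3] in auto)
  then have lim0: "(\<lambda>i. \<integral>\<^sup>+ x. ennreal (norm (F x - t i x)) \<partial>?M) \<longlonglongrightarrow> 0" by simp
  have bd: "ennreal (norm (?S (t i) - ?S (t j)))
     \<le> (\<integral>\<^sup>+ x. ennreal (norm (F x - t i x)) \<partial>?M) + (\<integral>\<^sup>+ x. ennreal (norm (F x - t j x)) \<partial>?M)" for i j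
  proof -
    have ij: "Bochner_Integration.simple_bochner_integrable ?M (\<lambda>x. t i x - t j x)"
      by (rule simple_bochner_integrable_compose2[OF _ tI tI]) simp
    have "ennreal (norm (?S (t i) - ?S (t j)))
        = ennreal (norm (?S (\<lambda>x. t i x - t j x)))"
      using tI by (subst simple_bochner_integral_diff) auto
    also have "\<dots> \<le> Bochner_Integration.simple_bochner_integral ?M (\<lambda>x. norm (t i x - t j x))"
      using simple_bochner_integral_norm_bound[OF ij] by (rule ennreal_leI)
    also have "\<dots> = (\<integral>\<^sup>+x. norm (t i x - t j x) \<partial>?M)"
      using simple_bochner_integrable_compose2[of "\<lambda>x y. norm (x - y)", OF _ tI[of i] tI[of j]]
      by (intro simple_bochner_integral_eq_nn_integral) auto
    also have "\<dots> \<le> (\<integral>\<^sup>+x. ennreal (norm (F x - t i x)) + ennreal (norm (F x - t j x)) \<partial>?M)"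
    proof (rule nn_integral_mono)
      fix x
      have "norm (t i x - t j x) \<le> norm (F x - t i x) + norm (F x - t j x)"
        using norm_triangle_ineq4[of "F x - t j x" "F x - t i x"] by simp
      then show "ennreal (norm (t i x - t j x)) \<le> ennreal (norm (F x - t i x)) + ennreal (norm (F x - t j x))"
        by (simp add: ennreal_leI flip: ennreal_plus)
    qed
    also have "\<dots> = (\<integral>\<^sup>+ x. ennreal (norm (F x - t i x)) \<partial>?M) + (\<integral>\<^sup>+ x. ennreal (norm (F x - t j x)) \<partial>?M)"
      by (rule nn_integral_add) auto
    finally show ?thesis .
  qed
  have "Cauchy (\<lambda>i. ?S (t i))"
  proof (rule metric_CauchyI)
    fix e :: real assume e: "e > 0"
    then have "eventually (\<lambda>i. (\<integral>\<^sup>+ x. ennreal (norm (F x - t i x)) \<partial>?M) < ennreal (e/2)) sequentially"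
      by (intro order_tendstoD(2)[OF lim0]) simp
    then obtain K where K: "\<And>i. i \<ge> K \<Longrightarrow> (\<integral>\<^sup>+ x. ennreal (norm (F x - t i x)) \<partial>?M) < ennreal (e/2)"
      by (auto simp: eventually_sequentially)
    show "\<exists>K. \<forall>i\<ge>K. \<forall>j\<ge>K. dist (?S (t i)) (?S (t j)) < e"
    proof (intro exI[of _ K] allI impI)
      fix i j assume ij: "K \<le> i" "K \<le> j"
      have "ennreal (dist (?S (t i)) (?S (t j)))
          < ennreal (e/2) + ennreal (e/2)"
        unfolding dist_norm by (rule le_less_trans[OF bd add_strict_mono[OF K K]]) (use ij in auto)
      then show "dist (?S (t i)) (?S (t j)) < e"
        using e by (simp flip: ennreal_plus add: ennreal_less_iff)
    qed
  qed
  then obtain v where "(\<lambda>i. ?S (t i)) \<longlonglongrightarrow> v"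
    using Cauchy_convergent convergent_def by blast
  then show ?thesis
    unfolding has_vbochner_integral_def using F tI lim0 by blast
qed

text \<open>Pairing with \<open>e\<close> is bounded and real linear, so it maps approximating
  simple functions to approximating simple functions and enlarges the error by at most the factor
  \<open>norm e\<close>.\<close>

lemma has_vbochner_integral_cinner:
  fixes F :: "'a \<Rightarrow> 'h::complex_hilbert"
  assumes "has_vbochner_integral (completion M) F v"
  shows "has_bochner_integral (completion M) (\<lambda>x. cinner (F x) e) (cinner v e)"
proof -
  let ?M = "completion M"
  interpret L: bounded_linear "\<lambda>x::'h. cinner x e" by (rule bounded_linear_cinner_left)
  from assms obtain s where F: "strongly_measurable ?M F"
    and s: "\<And>i::nat. Bochner_Integration.simple_bochner_integrable ?M (s i)"
    and lim: "(\<lambda>i. \<integral>\<^sup>+ x. ennreal (norm (F x - s i x)) \<partial>?M) \<longlonglongrightarrow> 0"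
    and v: "(\<lambda>i. Bochner_Integration.simple_bochner_integral ?M (s i)) \<longlonglongrightarrow> v"
    unfolding has_vbochner_integral_def by (elim conjE exE) (rule that, simp_all)
  have sf: "simple_function ?M (s i)" for i using s by (auto elim: simple_bochner_integrable.cases)
  have dm[measurable]: "(\<lambda>x. norm (F x - s i x)) \<in> borel_measurable ?M" for i
    by (rule borel_measurable_norm_strongly[OF strongly_measurable_diff_simple[OF F sf]])
  show ?thesis
  proof (rule has_bochner_integral.intros[where s = "\<lambda>i x. cinner (s i x) e"])
    show "(\<lambda>x. cinner (F x) e) \<in> borel_measurable ?M"
      by (rule strongly_measurable_imp_borel_measurable, rule strongly_measurable_compose[OF F])
        (rule L.isCont[OF continuous_ident])
    show "Bochner_Integration.simple_bochner_integrable ?M (\<lambda>x. cinner (s i x) e)" for i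
      using simple_bochner_integrable_compose2[of "\<lambda>x y. cinner x e", OF _ s s] by (simp add: L.zero)
    show "(\<lambda>i. Bochner_Integration.simple_bochner_integral ?M (\<lambda>x. cinner (s i x) e)) \<longlonglongrightarrow> cinner v e"
      using L.tendsto[OF v] by (simp add: simple_bochner_integral_linear[OF L.linear_axioms s])
    have "(\<lambda>i. \<integral>\<^sup>+ x. ennreal (norm (cinner (F x) e - cinner (s i x) e)) \<partial>?M) \<longlonglongrightarrow> 0"
    proof (rule tendsto_sandwich[OF _ _ tendsto_const])
      have "(\<lambda>i. ennreal (norm e) * (\<integral>\<^sup>+ x. ennreal (norm (F x - s i x)) \<partial>?M)) \<longlonglongrightarrow> ennreal (norm e) * 0"
        by (rule ennreal_tendsto_cmult[OF ennreal_less_top lim])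
      then show "(\<lambda>i. ennreal (norm e) * (\<integral>\<^sup>+ x. ennreal (norm (F x - s i x)) \<partial>?M)) \<longlonglongrightarrow> 0"
        by simp
      show "eventually (\<lambda>i. (\<integral>\<^sup>+ x. ennreal (norm (cinner (F x) e - cinner (s i x) e)) \<partial>?M)
          \<le> ennreal (norm e) * (\<integral>\<^sup>+ x. ennreal (norm (F x - s i x)) \<partial>?M)) sequentially"
      proof (rule always_eventually, intro allI)
        fix i
        have "(\<integral>\<^sup>+ x. ennreal (norm (cinner (F x) e - cinner (s i x) e)) \<partial>?M)
            \<le> (\<integral>\<^sup>+ x. ennreal (norm e) * ennreal (norm (F x - s i x)) \<partial>?M)"
        proof (rule nn_integral_mono)
          fix x
          show "ennreal (norm (cinner (F x) e - cinner (s i x) e))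
              \<le> ennreal (norm e) * ennreal (norm (F x - s i x))"
            using cinner_Cauchy_Schwarz[of "F x - s i x" e]
            by (simp add: cinner_diff_left mult.commute ennreal_leI flip: ennreal_mult)
        qed
        also have "\<dots> = ennreal (norm e) * (\<integral>\<^sup>+ x. ennreal (norm (F x - s i x)) \<partial>?M)"
          by (rule nn_integral_cmult) auto
        finally show "(\<integral>\<^sup>+ x. ennreal (norm (cinner (F x) e - cinner (s i x) e)) \<partial>?M)
          \<le> ennreal (norm e) * (\<integral>\<^sup>+ x. ennreal (norm (F x - s i x)) \<partial>?M)" .
      qed
    qed auto
    then show "(\<lambda>i. \<integral>\<^sup>+ x. ennreal (norm (cinner (F x) e - cinner (s i x) e)) \<partial>?M) \<longlonglongrightarrow> 0" .
  qed
qed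

lemma has_vbochner_integral_unique:
  fixes F :: "'a \<Rightarrow> 'h::complex_hilbert"
  assumes "has_vbochner_integral (completion M) F v" "has_vbochner_integral (completion M) F w"
  shows "v = w"
  by (rule cinner_eqI)
    (rule has_bochner_integral_eq[OF assms[THEN has_vbochner_integral_cinner]])


lemma cinner_vbochner_integral:
  fixes F :: "'a \<Rightarrow> 'h::complex_hilbert"
  assumes F: "strongly_measurable (completion M) F"
    and fin: "(\<integral>\<^sup>+ x. ennreal (norm (F x)) \<partial>completion M) < \<infinity>"
  shows "cinner (vbochner_integral (completion M) F) e = (LINT x|completion M. cinner (F x) e)"
proof -
  obtain v where v: "has_vbochner_integral (completion M) F v"
    using has_vbochner_integral_ex[OF F fin] by blast
  \<comment> \<open>Uniqueness evaluates the \<open>THE\<close> in \<open>vbochner_integral\<close>,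
    and existence excludes its default value 0.\<close>
  have "(THE v. has_vbochner_integral (completion M) F v) = v"
    by (rule the_equality, rule v) (rule has_vbochner_integral_unique[OF _ v])
  then have "vbochner_integral (completion M) F = v"
    unfolding vbochner_integral_def using v by metis

  then show ?thesis
    using has_bochner_integral_integral_eq[OF has_vbochner_integral_cinner[OF v]] by simp
qed

text \<open>Norm integrability alone yields some integral \<open>w\<close>; the scalar identities
  are needed only to recognise it as \<open>v\<close>.\<close>

lemma has_vbochner_integralI_cinner:
  fixes F :: "'a \<Rightarrow> 'h::complex_hilbert"
  assumes F: "strongly_measurable (completion M) F"
    and fin: "(\<integral>\<^sup>+ x. ennreal (norm (F x)) \<partial>completion M) < \<infinity>"
    and eq: "\<And>e. (LINT x|completion M. cinner (F x) e) = cinner v e"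
  shows "has_vbochner_integral (completion M) F v"
proof -
  obtain w where w: "has_vbochner_integral (completion M) F w"
    using has_vbochner_integral_ex[OF F fin] by blast
  have "w = v"
    by (rule cinner_eqI)
      (simp add: eq flip: has_bochner_integral_integral_eq[OF has_vbochner_integral_cinner[OF w]])

  then show ?thesis using w by simp
qed


section \<open>The Fourier transform on Euclidean space\<close>

lemma
  fixes f :: "'a::euclidean_space \<Rightarrow> 'b::{banach, second_countable_topology}"
  assumes c: "c \<noteq> 0" and f[measurable]: "f \<in> borel_measurable borel"
  shows lborel_integrable_affine_iff:
      "integrable lborel (\<lambda>x. f (t + c *\<^sub>R x)) \<longleftrightarrow> integrable lborel f"
    and lborel_integral_affine:
      "(LINT x|lborel. f x) = \<bar>c\<bar> ^ DIM('a) *\<^sub>R (LINT x|lborel. f (t + c *\<^sub>R x))"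
proof -
  have *: "(\<lambda>_::'a. \<bar>c\<bar> ^ DIM('a)) \<in> borel_measurable lborel"
    "(\<lambda>_::'a. \<bar>c\<bar> ^ DIM('a)) \<in> borel_measurable (distr lborel borel (\<lambda>x. t + c *\<^sub>R x))"
    by auto
  have d: "lborel = density (distr lborel borel (\<lambda>x. t + c *\<^sub>R x)) (\<lambda>_. \<bar>c\<bar>^DIM('a))"
    using lborel_affine[OF c, of t] by (simp add: ennreal_power)
  have "integrable lborel f \<longleftrightarrow>
      integrable (density (distr lborel borel (\<lambda>x. t + c *\<^sub>R x)) (\<lambda>_. \<bar>c\<bar>^DIM('a))) f"
    using d by simp
  also have "\<dots> \<longleftrightarrow> integrable (distr lborel borel (\<lambda>x. t + c *\<^sub>R x)) (\<lambda>x. (\<bar>c\<bar>^DIM('a)) *\<^sub>R f x)"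
    by (rule integrable_density) auto
  also have "\<dots> \<longleftrightarrow> integrable lborel (\<lambda>x. (\<bar>c\<bar>^DIM('a)) *\<^sub>R f (t + c *\<^sub>R x))"
    by (rule integrable_distr_eq) auto
  finally show "integrable lborel (\<lambda>x. f (t + c *\<^sub>R x)) \<longleftrightarrow> integrable lborel f"
    using c integrable_scaleR_right[of "1 / \<bar>c\<bar> ^ DIM('a)" lborel "\<lambda>x. \<bar>c\<bar> ^ DIM('a) *\<^sub>R f (t + c *\<^sub>R x)"]
    by auto

  have "(LINT x|lborel. f x) =
      (LINT x|density (distr lborel borel (\<lambda>x. t + c *\<^sub>R x)) (\<lambda>_. \<bar>c\<bar>^DIM('a)). f x)"
    using d by simp
  also have "\<dots> = (LINT x|distr lborel borel (\<lambda>x. t + c *\<^sub>R x). (\<bar>c\<bar>^DIM('a)) *\<^sub>R f x)"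
    by (rule integral_density) auto
  also have "\<dots> = (LINT x|lborel. (\<bar>c\<bar>^DIM('a)) *\<^sub>R f (t + c *\<^sub>R x))"
    by (rule integral_distr) auto
  finally show "(LINT x|lborel. f x) = \<bar>c\<bar> ^ DIM('a) *\<^sub>R (LINT x|lborel. f (t + c *\<^sub>R x))"
    by simp
qed

lemma nn_integral_lborel_affine:
  fixes f :: "'a::euclidean_space \<Rightarrow> ennreal"
  assumes c: "c \<noteq> 0" and f[measurable]: "f \<in> borel_measurable borel"
  shows "(\<integral>\<^sup>+ x. f x \<partial>lborel) = ennreal (\<bar>c\<bar> ^ DIM('a)) * (\<integral>\<^sup>+ x. f (t + c *\<^sub>R x) \<partial>lborel)"
proof -
  have d: "lborel = density (distr lborel borel (\<lambda>x. t + c *\<^sub>R x)) (\<lambda>_. ennreal (\<bar>c\<bar>^DIM('a)))"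
    using lborel_affine[OF c, of t] by (simp add: ennreal_power)
  have "(\<integral>\<^sup>+ x. f x \<partial>lborel) =
      (\<integral>\<^sup>+ x. f x \<partial>density (distr lborel borel (\<lambda>x. t + c *\<^sub>R x)) (\<lambda>_. ennreal (\<bar>c\<bar>^DIM('a))))"
    using d by simp
  also have "\<dots> = (\<integral>\<^sup>+ x. ennreal (\<bar>c\<bar>^DIM('a)) * f x \<partial>distr lborel borel (\<lambda>x. t + c *\<^sub>R x))"
    by (rule nn_integral_density) auto
  also have "\<dots> = ennreal (\<bar>c\<bar> ^ DIM('a)) * (\<integral>\<^sup>+ x. f (t + c *\<^sub>R x) \<partial>lborel)"
    by (simp add: nn_integral_distr nn_integral_cmult)
  finally show ?thesis .
qed

lemma has_bochner_integral_prod_coordinates: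
  fixes f :: "'n::finite \<Rightarrow> real \<Rightarrow> 'b::{real_normed_field, banach, second_countable_topology}"
  assumes f: "\<And>j. integrable lborel (f j)"
  shows "has_bochner_integral lborel (\<lambda>x::real^'n. \<Prod>j\<in>UNIV. f j (x $ j)) (\<Prod>j\<in>UNIV. LINT t|lborel. f j t)"
proof -
  interpret product_sigma_finite "\<lambda>_::real^'n. lborel :: real measure" ..
  \<comment> \<open>\<open>lborel\<close> is an image of a product measure indexed by basis vectors,
    so the factors are reindexed along \<open>j\<close> to \<open>axis j 1\<close>.\<close>
  define g where "g b = f (THE j. b = axis j 1)" for b :: "real^'n"
  have g: "g (axis j 1) = f j" for j
    by (simp add: g_def axis_eq_axis)
  have inj: "inj (\<lambda>j. axis j (1::real) :: real^'n)"
    by (simp add: inj_def axis_eq_axis)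
  have B: "(Basis :: (real^'n) set) = range (\<lambda>j. axis j 1)"
    by (auto simp: Basis_vec_def)
  have gi: "integrable lborel (g b)" if "b \<in> Basis" for b
    using that f by (auto simp: B g)
  have [measurable]: "f j \<in> borel_measurable borel" for j
    using borel_measurable_integrable[OF f[of j]] by simp
  have pr: "(\<Prod>j\<in>UNIV. f j (x $ j)) = (\<Prod>b\<in>Basis. g b (x \<bullet> b))" for x :: "real^'n"
    unfolding B by (subst prod.reindex[OF inj]) (simp add: g inner_axis)
  have eq: "(\<Prod>j\<in>UNIV. f j ((\<Sum>b\<in>Basis. w b *\<^sub>R b) $ j)) = (\<Prod>b\<in>Basis. g b (w b))" for w :: "real^'n \<Rightarrow> real"
    unfolding pr by (intro prod.cong refl) (simp add: inner_sum_left inner_Basis if_distrib cong: if_cong)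
  have m: "(\<lambda>x::real^'n. \<Prod>j\<in>UNIV. f j (x $ j)) \<in> borel_measurable borel"
    by measurable
  have T: "(\<lambda>w. \<Sum>b\<in>Basis. w b *\<^sub>R b) \<in> (\<Pi>\<^sub>M b\<in>(Basis::(real^'n) set). lborel) \<rightarrow>\<^sub>M borel"
    by measurable
  show ?thesis
    unfolding has_bochner_integral_iff
  proof
    show "integrable lborel (\<lambda>x::real^'n. \<Prod>j\<in>UNIV. f j (x $ j))"
    proof (subst lborel_eq, subst integrable_distr_eq[OF T m], subst eq)
      show "integrable (\<Pi>\<^sub>M b\<in>Basis. lborel) (\<lambda>w::real^'n \<Rightarrow> real. \<Prod>b\<in>Basis. g b (w b))"
        by (rule product_integrable_prod) (auto intro: gi)
    qed
    have "(LINT x::real^'n|lborel. (\<Prod>j\<in>UNIV. f j (x $ j))) = (\<Prod>b\<in>Basis. LINT t|lborel. g b t)"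
    proof (subst lborel_eq, subst integral_distr[OF T m], subst eq)
      show "(LINT w|(\<Pi>\<^sub>M b\<in>(Basis::(real^'n) set). lborel). (\<Prod>b\<in>Basis. g b (w b))) = (\<Prod>b\<in>Basis. LINT t|lborel. g b t)"
        by (rule product_integral_prod) (auto intro: gi)
    qed
    also have "\<dots> = (\<Prod>j\<in>UNIV. LINT t|lborel. f j t)"
      unfolding B by (subst prod.reindex[OF inj]) (simp add: g)
    finally show "(LINT x::real^'n|lborel. (\<Prod>j\<in>UNIV. f j (x $ j))) = (\<Prod>j\<in>UNIV. LINT t|lborel. f j t)" .
  qed
qed

text \<open>With \<open>2 * pi\<close> in the exponent the inversion formula carries no constant,
  and the Cauchy kernel is a Fourier transform as it stands.\<close>

definition fourier :: "(real^'n \<Rightarrow> complex) \<Rightarrow> real^'n \<Rightarrow> complex" where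
  "fourier g \<eta> = (LINT x|lborel. cis (- (2 * pi * (x \<bullet> \<eta>))) * g x)"

lemma borel_measurable_cis[measurable]: "cis \<in> borel_measurable borel"
  by (intro borel_measurable_continuous_onI continuous_intros)

lemma integrable_cis_mult:
  assumes "integrable M g" and "\<theta> \<in> borel_measurable M"
  shows "integrable M (\<lambda>x. cis (\<theta> x) * g x)"
proof -
  have [measurable]: "g \<in> borel_measurable M" using assms(1) by auto
  note assms(2)[measurable]
  show ?thesis
    by (rule Bochner_Integration.integrable_bound[OF assms(1)]) (auto simp: norm_mult)
qed

lemma norm_fourier_le: "norm (fourier g \<eta>) \<le> (LINT x|lborel. norm (g x))"
  unfolding fourier_def by (rule order_trans[OF integral_norm_bound]) (simp add: norm_mult)

lemma borel_measurable_fourier[measurable]: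
  assumes [measurable]: "g \<in> borel_measurable borel"
  shows "fourier g \<in> borel_measurable borel"
  unfolding fourier_def by measurable

lemma fourier_modulation:
  "fourier (\<lambda>x. cis (2 * pi * (x \<bullet> \<xi>)) * g x) \<eta> = fourier g (\<eta> - \<xi>)"
proof -
  have "cis (- (2 * pi * (x \<bullet> \<eta>))) * (cis (2 * pi * (x \<bullet> \<xi>)) * g x) = cis (- (2 * pi * (x \<bullet> (\<eta> - \<xi>)))) * g x" for x
    unfolding mult.assoc[symmetric] cis_mult by (simp add: inner_diff_right right_diff_distrib)
  then show ?thesis unfolding fourier_def by presburger
qed



lemma integrable_prod_mult:
  fixes a :: "real^'n \<Rightarrow> complex" and m :: "real^'m \<Rightarrow> complex"
  assumes a: "integrable lborel a" and m: "integrable lborel m"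
  shows "integrable (lborel \<Otimes>\<^sub>M lborel) (\<lambda>(x, y). a x * m y)"
proof (rule lborel_pair.Fubini_integrable)
  have [measurable]: "a \<in> borel_measurable borel" "m \<in> borel_measurable borel"
    using borel_measurable_integrable[OF a] borel_measurable_integrable[OF m] by simp_all
  show "(\<lambda>(x, y). a x * m y) \<in> borel_measurable (lborel \<Otimes>\<^sub>M lborel)" by measurable
  show "integrable lborel (\<lambda>x. LINT y|lborel. norm (case (x, y) of (x, y) \<Rightarrow> a x * m y))"
    using a by (simp add: norm_mult)
  show "AE x in lborel. integrable lborel (\<lambda>y. case (x, y) of (x, y) \<Rightarrow> a x * m y)"
    using m by simp
qed

text \<open>Fubini, the exponential being symmetric in both variables. Inversion, Bessel's
  inequality and the computation with the Poisson kernel all start from this transfer.\<close>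

lemma fourier_multiplication:
  assumes a: "integrable lborel a" and m: "integrable lborel m"
  shows "(LINT x|lborel. fourier a x * m x) = (LINT \<eta>|lborel. a \<eta> * fourier m \<eta>)"
proof -
  have [measurable]: "a \<in> borel_measurable borel" "m \<in> borel_measurable borel"
    using borel_measurable_integrable[OF a] borel_measurable_integrable[OF m] by simp_all
  have int: "integrable (lborel \<Otimes>\<^sub>M lborel) (\<lambda>(\<eta>, x). cis (- (2 * pi * (x \<bullet> \<eta>))) * (a \<eta> * m x))"
    using integrable_cis_mult[OF integrable_prod_mult[OF a m], of "\<lambda>(\<eta>, x). - (2 * pi * (x \<bullet> \<eta>))"]
    by (simp add: case_prod_unfold)
  have "(LINT x|lborel. fourier a x * m x)
      = (LINT x|lborel. LINT \<eta>|lborel. cis (- (2 * pi * (x \<bullet> \<eta>))) * (a \<eta> * m x))"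
    unfolding fourier_def
    by (rule Bochner_Integration.integral_cong)
      (simp_all add: inner_commute mult.assoc flip: integral_mult_left_zero)
  also have "\<dots> = (LINT \<eta>|lborel. LINT x|lborel. cis (- (2 * pi * (x \<bullet> \<eta>))) * (a \<eta> * m x))"
    by (rule lborel_pair.Fubini_integral) (use int in simp)
  also have "\<dots> = (LINT \<eta>|lborel. a \<eta> * fourier m \<eta>)"
    unfolding fourier_def
    by (rule Bochner_Integration.integral_cong)
      (simp_all add: mult.left_commute flip: integral_mult_right_zero)
  finally show ?thesis .
qed

text \<open>Normalised so that \<open>gauss 1\<close> is its own Fourier transform, while
  \<open>k\<close> acts as a dilation.\<close>

definition gauss :: "real \<Rightarrow> real^'n \<Rightarrow> real" where
  "gauss k x = exp (- (pi * k\<^sup>2 * (norm x)\<^sup>2))"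

lemma gauss_pos: "0 < gauss k x" and gauss_le_1: "gauss k x \<le> 1"
  by (auto simp: gauss_def)

lemma borel_measurable_gauss[measurable]: "gauss k \<in> borel_measurable borel"
  unfolding gauss_def by measurable

text \<open>This is the characteristic function of the standard normal distribution after a
  rescaling of the variable.\<close>

lemma has_bochner_integral_gauss_1d:
  assumes k: "k > 0"
  shows "has_bochner_integral lborel (\<lambda>t. cis (- (2 * pi * (t * s))) * of_real (exp (- (pi * k\<^sup>2 * t\<^sup>2))))
     (of_real (exp (- (pi * (s / k)\<^sup>2)) / k))"
proof -
  \<comment> \<open>The substitution of \<open>c * t\<close> turns the normal density into the
    Gaussian, up to the factor \<open>1 / sqrt (2 * pi)\<close>, and \<open>\<tau>\<close> is the
    frequency for which \<open>\<tau> * (c * t) = - (2 * pi * (t * s))\<close>.\<close>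
  define \<tau> where "\<tau> = - (sqrt (2 * pi) * s / k)"
  define c where "c = sqrt (2 * pi) * k"
  have c: "c > 0" using k by (simp add: c_def)
  let ?F = "\<lambda>x. std_normal_density x *\<^sub>R iexp (\<tau> * x)"
  have n: "integrable lborel std_normal_density" by simp
  have i: "integrable lborel ?F"
    by (rule Bochner_Integration.integrable_bound[OF n]) (auto simp: normal_density_nonneg)
  have "char std_normal_distribution \<tau> = (LINT x|lborel. ?F x)"
    unfolding char_def by (rule integral_density) (auto simp: normal_density_nonneg)
  then have v: "(LINT x|lborel. ?F x) = of_real (exp (- (\<tau>\<^sup>2) / 2))"
    by (simp add: char_std_normal_distribution)
  have e: "?F (0 + c * t) = of_real (1 / sqrt (2 * pi)) *
      (cis (- (2 * pi * (t * s))) * of_real (exp (- (pi * k\<^sup>2 * t\<^sup>2))))" for t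
  proof -
    have 1: "std_normal_density (c * t) = 1 / sqrt (2 * pi) * exp (- (pi * k\<^sup>2 * t\<^sup>2))"
      by (simp add: std_normal_density_def c_def power_mult_distrib)
    have "\<tau> * (c * t) = - (sqrt (2 * pi) * sqrt (2 * pi) * (t * s))"
      using k by (simp add: \<tau>_def c_def field_simps)
    also have "\<dots> = - (2 * pi * (t * s))" by simp
    finally have 2: "iexp (\<tau> * (c * t)) = cis (- (2 * pi * (t * s)))"
      by (simp only: cis_conv_exp)
    show ?thesis
      unfolding add_0 1 2 by (simp add: scaleR_conv_of_real)
  qed
  let ?G = "\<lambda>t. cis (- (2 * pi * (t * s))) * of_real (exp (- (pi * k\<^sup>2 * t\<^sup>2)))"
  have "integrable lborel (\<lambda>t. ?F (0 + c * t))"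
    using lborel_integrable_real_affine[OF i, of c 0] c by simp
  then have "integrable lborel (\<lambda>t. of_real (1 / sqrt (2 * pi)) * ?G t)" unfolding e .
  then have I: "integrable lborel ?G"
    using integrable_mult_right[of "of_real (sqrt (2 * pi))" lborel "\<lambda>t. of_real (1 / sqrt (2 * pi)) * ?G t"]
    by simp
  have "(LINT x|lborel. ?F x) = c *\<^sub>R (LINT t|lborel. ?F (0 + c * t))"
    using lborel_integral_real_affine[of c ?F 0] c by simp
  also have "\<dots> = k * (LINT t|lborel. ?G t)"
    unfolding e by (subst integral_mult_right_zero) (simp add: c_def scaleR_conv_of_real)
  finally have "k * (LINT t|lborel. ?G t) = of_real (exp (- (\<tau>\<^sup>2) / 2))"
    unfolding v by simp
  moreover have "- (\<tau>\<^sup>2) / 2 = - (pi * (s / k)\<^sup>2)"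
    by (simp add: \<tau>_def power_mult_distrib power_divide)
  ultimately have "(LINT t|lborel. ?G t) = of_real (exp (- (pi * (s / k)\<^sup>2)) / k)"
    using k by (simp add: field_simps)
  then show ?thesis using I by (simp add: has_bochner_integral_iff)
qed

lemma
  fixes \<eta> :: "real^'n"
  assumes k: "k > 0"
  shows integrable_gauss: "integrable lborel (gauss k :: real^'n \<Rightarrow> real)"
    and fourier_gauss: "fourier (\<lambda>x. of_real (gauss k x)) \<eta> = of_real (gauss (1 / k) \<eta> / k ^ CARD('n))"
proof -
  let ?f = "\<lambda>(\<eta>::real^'n) j t. cis (- (2 * pi * (t * (\<eta> $ j)))) * complex_of_real (exp (- (pi * k\<^sup>2 * t\<^sup>2)))"
  have n2: "(norm x)\<^sup>2 = (\<Sum>j\<in>UNIV. (x $ j)\<^sup>2)" for x :: "real^'n"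
    unfolding power2_norm_eq_inner inner_vec_def by (simp add: power2_eq_square)
  have eq: "(\<Prod>j\<in>UNIV. ?f \<eta> j (x $ j)) = cis (- (2 * pi * (x \<bullet> \<eta>))) * of_real (gauss k x)"
    for x \<eta> :: "real^'n"
  proof -
    have "(\<Prod>j\<in>UNIV. cis (- (2 * pi * (x $ j * \<eta> $ j)))) = cis (\<Sum>j\<in>UNIV. - (2 * pi * (x $ j * \<eta> $ j)))"
      by (induction rule: finite_induct[OF finite_class.finite_UNIV]) (auto simp: cis_mult)
    also have "(\<Sum>j\<in>UNIV. - (2 * pi * (x $ j * \<eta> $ j))) = - (2 * pi * (x \<bullet> \<eta>))"
      by (simp add: inner_vec_def sum_negf flip: sum_distrib_left)
    finally have "(\<Prod>j\<in>UNIV. cis (- (2 * pi * (x $ j * \<eta> $ j)))) = cis (- (2 * pi * (x \<bullet> \<eta>)))" .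
    moreover have "(\<Prod>j\<in>UNIV. complex_of_real (exp (- (pi * k\<^sup>2 * (x $ j)\<^sup>2)))) = of_real (gauss k x)"
      by (simp add: gauss_def n2 sum_distrib_left flip: exp_sum of_real_prod sum_negf)
    ultimately show ?thesis by (simp add: prod.distrib)
  qed
  have B: "has_bochner_integral lborel (\<lambda>x::real^'n. cis (- (2 * pi * (x \<bullet> \<eta>))) * complex_of_real (gauss k x))
      (\<Prod>j\<in>UNIV. of_real (exp (- (pi * (\<eta> $ j / k)\<^sup>2)) / k))" for \<eta> :: "real^'n"
    using has_bochner_integral_prod_coordinates[of "?f \<eta>"]
      has_bochner_integral_gauss_1d[OF k]
    unfolding eq has_bochner_integral_iff by simp
  have "(\<Prod>j\<in>UNIV. of_real (exp (- (pi * (\<eta> $ j / k)\<^sup>2)) / k)) = complex_of_real (gauss (1 / k) \<eta> / k ^ CARD('n))"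
    by (simp add: gauss_def n2 prod_dividef sum_distrib_left power_divide
        flip: exp_sum of_real_prod sum_negf)
  then show "fourier (\<lambda>x. of_real (gauss k x)) \<eta> = of_real (gauss (1 / k) \<eta> / k ^ CARD('n))"
    using B[of \<eta>] unfolding fourier_def has_bochner_integral_iff by simp
  have "integrable lborel (\<lambda>x::real^'n. norm (complex_of_real (gauss k x)))"
    using B[of 0] unfolding has_bochner_integral_iff by (intro integrable_norm) simp
  then show "integrable lborel (gauss k :: real^'n \<Rightarrow> real)"
    by (simp add: abs_of_pos[OF gauss_pos])
qed

lemma integral_gauss:
  assumes k: "k > 0"
  shows "(LINT x::real^'n|lborel. gauss k x) = 1 / k ^ CARD('n)"
proof -
  have "of_real (LINT x::real^'n|lborel. gauss k x) = fourier (\<lambda>x::real^'n. of_real (gauss k x)) 0"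
    unfolding fourier_def by simp
  also have "\<dots> = of_real (1 / k ^ CARD('n))"
    unfolding fourier_gauss[OF k] by (simp add: gauss_def)
  finally show ?thesis using of_real_eq_iff by blast
qed

lemma gauss_tendsto_1: "(\<lambda>i. gauss (1 / real (Suc i)) x) \<longlonglongrightarrow> 1"
proof -
  have "(\<lambda>i. exp (- (pi * (1 / real (Suc i))\<^sup>2 * (norm x)\<^sup>2))) \<longlonglongrightarrow> exp (- (pi * 0\<^sup>2 * (norm x)\<^sup>2))"
    by (intro tendsto_intros LIMSEQ_Suc[OF lim_1_over_n])
  then show ?thesis by (simp add: gauss_def)
qed

text \<open>Gaussian summation: damping the inversion integral by \<open>gauss (k i)\<close> turns
  it, by \<open>fourier_multiplication\<close>, into a Gaussian mean of \<open>g\<close> around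
  \<open>u\<close>. As the damping disappears, integrability of \<open>fourier g\<close> controls
  one side, boundedness and continuity of \<open>g\<close> the other.\<close>

theorem fourier_inversion:
  fixes g :: "real^'n \<Rightarrow> complex"
  assumes g: "integrable lborel g" and cont: "continuous_on UNIV g" and bd: "\<And>x. norm (g x) \<le> B"
    and gh: "integrable lborel (fourier g)"
  shows "(LINT \<eta>|lborel. cis (2 * pi * (u \<bullet> \<eta>)) * fourier g \<eta>) = g u"
proof (rule LIMSEQ_unique)
  have [measurable]: "g \<in> borel_measurable borel" using borel_measurable_integrable[OF g] by simp
  define k where "k i = 1 / real (Suc i)" for i
  have k: "k i > 0" for i by (simp add: k_def)
  have I1: "integrable lborel (\<lambda>x. complex_of_real (gauss (k i) x))" for i
    using integrable_gauss[OF k] by (rule integrable_of_real)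
  let ?m = "\<lambda>i x. cis (2 * pi * (x \<bullet> u)) * complex_of_real (gauss (k i) x)"
  have I2: "integrable lborel (?m i)" for i
    by (rule integrable_cis_mult[OF I1]) measurable
  show "(\<lambda>i. LINT \<eta>|lborel. fourier g \<eta> * ?m i \<eta>)
      \<longlonglongrightarrow> (LINT \<eta>|lborel. cis (2 * pi * (u \<bullet> \<eta>)) * fourier g \<eta>)"
  proof (rule integral_dominated_convergence[where w = "\<lambda>\<eta>. norm (fourier g \<eta>)"])
    show "integrable lborel (\<lambda>\<eta>. norm (fourier g \<eta>))" using gh by (rule integrable_norm)
    show "AE \<eta> in lborel. (\<lambda>i. fourier g \<eta> * ?m i \<eta>) \<longlonglongrightarrow> cis (2 * pi * (u \<bullet> \<eta>)) * fourier g \<eta>"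
    proof (rule AE_I2)
      fix \<eta>
      have "(\<lambda>i. fourier g \<eta> * (cis (2 * pi * (\<eta> \<bullet> u)) * of_real (gauss (k i) \<eta>)))
          \<longlonglongrightarrow> fourier g \<eta> * (cis (2 * pi * (\<eta> \<bullet> u)) * of_real 1)"
        unfolding k_def by (intro tendsto_intros gauss_tendsto_1)
      then show "(\<lambda>i. fourier g \<eta> * ?m i \<eta>) \<longlonglongrightarrow> cis (2 * pi * (u \<bullet> \<eta>)) * fourier g \<eta>"
        by (simp add: inner_commute mult.commute)
    qed
    show "AE \<eta> in lborel. norm (fourier g \<eta> * ?m i \<eta>) \<le> norm (fourier g \<eta>)" for i
      by (rule AE_I2) (simp add: norm_mult abs_of_pos[OF gauss_pos] gauss_le_1 mult_left_le)
  qed measurable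
  have eq: "(LINT \<eta>|lborel. fourier g \<eta> * ?m i \<eta>) = (LINT x|lborel. g (u + k i *\<^sub>R x) * of_real (gauss 1 x))" for i
  proof -
    have "(LINT \<eta>|lborel. fourier g \<eta> * ?m i \<eta>) = (LINT x|lborel. g x * fourier (?m i) x)"
      by (rule fourier_multiplication[OF g I2])
    also have "\<dots> = (LINT x|lborel. g x * of_real (gauss (1 / k i) (x - u) / k i ^ CARD('n)))"
      unfolding fourier_modulation fourier_gauss[OF k] ..
    \<comment> \<open>Centring at \<open>u\<close> and scaling by \<open>k i\<close> makes the
      Gaussian independent of \<open>i\<close>; the Jacobian cancels the factor from
      \<open>fourier_gauss\<close>.\<close>
    also have "\<dots> = \<bar>k i\<bar> ^ DIM(real^'n) *\<^sub>R (LINT x|lborel. g (u + k i *\<^sub>R x) *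
        of_real (gauss (1 / k i) ((u + k i *\<^sub>R x) - u) / k i ^ CARD('n)))"
      by (rule lborel_integral_affine) (use k[of i] in auto)
    also have "\<dots> = (LINT x|lborel. g (u + k i *\<^sub>R x) * of_real (gauss 1 x))"
    proof -
      have 1: "gauss (1 / k i) ((u + k i *\<^sub>R x) - u) = gauss 1 x" for x
        using k[of i] by (simp add: gauss_def power_mult_distrib power_divide)
      have 2: "g (u + k i *\<^sub>R x) * of_real (gauss (1 / k i) ((u + k i *\<^sub>R x) - u) / k i ^ CARD('n))
          = (1 / k i ^ CARD('n)) *\<^sub>R (g (u + k i *\<^sub>R x) * of_real (gauss 1 x))" for x
        unfolding 1 by (simp add: scaleR_conv_of_real)
      show ?thesis
        unfolding 2 integral_scaleR_right using k[of i] by simp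
    qed
    finally show ?thesis .
  qed
  have I3: "integrable lborel (\<lambda>x::real^'n. B * gauss 1 x)"
    using integrable_gauss[of 1, where 'n = 'n] by simp
  have "(\<lambda>i. LINT x|lborel. g (u + k i *\<^sub>R x) * of_real (gauss 1 x)) \<longlonglongrightarrow> (LINT x|lborel. g u * of_real (gauss 1 (x::real^'n)))"
  proof (rule integral_dominated_convergence[OF _ _ I3])
    show "AE x in lborel. (\<lambda>i. g (u + k i *\<^sub>R x) * of_real (gauss 1 x)) \<longlonglongrightarrow> g u * of_real (gauss 1 x)"
    proof (rule AE_I2)
      fix x :: "real^'n"
      have "(\<lambda>i. u + k i *\<^sub>R x) \<longlonglongrightarrow> u + 0 *\<^sub>R x"
        unfolding k_def by (intro tendsto_intros LIMSEQ_Suc[OF lim_1_over_n])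
      then have "(\<lambda>i. g (u + k i *\<^sub>R x)) \<longlonglongrightarrow> g u"
        using cont by (intro isCont_tendsto_compose[of _ g]) (auto simp: continuous_on_eq_continuous_at)
      then show "(\<lambda>i. g (u + k i *\<^sub>R x) * of_real (gauss 1 x)) \<longlonglongrightarrow> g u * of_real (gauss 1 x)"
        by (intro tendsto_intros)
    qed
    show "AE x in lborel. norm (g (u + k i *\<^sub>R x) * of_real (gauss 1 x)) \<le> B * gauss 1 x" for i
      by (rule AE_I2) (simp add: norm_mult abs_of_pos[OF gauss_pos] bd mult_right_mono less_imp_le[OF gauss_pos])

  qed measurable
  also have "(LINT x|lborel. g u * of_real (gauss 1 (x::real^'n))) = g u"
    using integral_gauss[of 1, where 'n = 'n] by simp
  finally show "(\<lambda>i. LINT \<eta>|lborel. fourier g \<eta> * ?m i \<eta>) \<longlonglongrightarrow> g u"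
    unfolding eq .
qed

section \<open>Conjugation, convolution and Bessel's inequality\<close>

lemma integrable_reflect:
  fixes f :: "real^'n \<Rightarrow> 'b::{banach, second_countable_topology}"
  assumes "integrable lborel f"
  shows "integrable lborel (\<lambda>x. f (t - x))"
  using lborel_integrable_affine_iff[of "-1" f t] borel_measurable_integrable[OF assms] assms by simp

lemma integral_reflect:
  fixes f :: "real^'n \<Rightarrow> 'b::{banach, second_countable_topology}"
  assumes "f \<in> borel_measurable borel"
  shows "(LINT x|lborel. f (t - x)) = (LINT x|lborel. f x)"
  using lborel_integral_affine[of "-1" f t] assms by simp

text \<open>Conjugation reverses the sign in the exponential, which a reflection of \<open>a\<close>
  undoes. A squared modulus thus becomes a product of two transforms.\<close>

lemma cnj_fourier:
  assumes a: "a \<in> borel_measurable borel"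
  shows "cnj (fourier a x) = fourier (\<lambda>\<eta>. cnj (a (- \<eta>))) x"
proof -
  have "cnj (fourier a x) = (LINT \<eta>|lborel. cnj (cis (- (2 * pi * (\<eta> \<bullet> x))) * a \<eta>))"
    unfolding fourier_def by (subst Bochner_Integration.integral_cnj) rule

  also have "\<dots> = (LINT \<eta>|lborel. cnj (cis (- (2 * pi * ((0 - \<eta>) \<bullet> x))) * a (0 - \<eta>)))"
  proof (rule integral_reflect[symmetric])
    note a[measurable]
    have "(\<lambda>\<eta>. cis (- (2 * pi * (\<eta> \<bullet> x))) * a \<eta>) \<in> borel_measurable borel"
      by measurable
    then show "(\<lambda>\<eta>. cnj (cis (- (2 * pi * (\<eta> \<bullet> x))) * a \<eta>)) \<in> borel_measurable borel"
      by (rule borel_measurable_continuous_onI[THEN measurable_compose[rotated], OF continuous_on_cnj[OF continuous_on_id]])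
  qed

  also have "\<dots> = fourier (\<lambda>\<eta>. cnj (a (- \<eta>))) x"
    unfolding fourier_def by (simp add: cis_cnj)
  finally show ?thesis .
qed

text \<open>Products become convolutions under the transform; as one factor is itself a transform,
  what is convolved is the reflection of \<open>a\<close>. The frequency \<open>\<eta>\<close> is
  hidden in \<open>m\<close> as a modulation, so the multiplication formula applies.\<close>

lemma fourier_fourier_mult:
  assumes a: "integrable lborel a" and m: "integrable lborel m"
  shows "fourier (\<lambda>x. fourier a x * m x) \<eta> = (LINT \<xi>|lborel. a (- \<xi>) * fourier m (\<eta> - \<xi>))"
proof -
  have m': "integrable lborel (\<lambda>x. cis (2 * pi * (x \<bullet> (- \<eta>))) * m x)"
    using m by (rule integrable_cis_mult) measurable
  have [measurable]: "a \<in> borel_measurable borel" "m \<in> borel_measurable borel"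
    using borel_measurable_integrable[OF a] borel_measurable_integrable[OF m] by simp_all
  have "fourier (\<lambda>x. fourier a x * m x) \<eta> = (LINT x|lborel. fourier a x * (cis (2 * pi * (x \<bullet> (- \<eta>))) * m x))"
    unfolding fourier_def[of "\<lambda>x. fourier a x * m x"] by (simp add: mult_ac)
  also have "\<dots> = (LINT \<xi>|lborel. a \<xi> * fourier m (\<xi> - (- \<eta>)))"
    unfolding fourier_multiplication[OF a m'] fourier_modulation ..
  also have "\<dots> = (LINT \<xi>|lborel. a (0 - \<xi>) * fourier m ((0 - \<xi>) - (- \<eta>)))"
    by (rule integral_reflect[symmetric]) measurable
  finally show ?thesis by simp
qed

text \<open>Writing the Gaussian mean of the square of the modulus as a double integral against a Gaussian
  of total mass 1, the claim follows from \<open>2 a b \<le> a\<^sup>2 + b\<^sup>2\<close> and Fatou's lemma.\<close>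

lemma fourier_Bessel:
  fixes a :: "real^'n \<Rightarrow> real"
  assumes a: "integrable lborel a" and nn: "\<And>x. a x \<ge> 0" and a2: "integrable lborel (\<lambda>x. (a x)\<^sup>2)"
  shows "(\<integral>\<^sup>+ x. ennreal ((cmod (fourier (\<lambda>x. of_real (a x)) x))\<^sup>2) \<partial>lborel) \<le> ennreal (LINT x|lborel. (a x)\<^sup>2)"
proof -
  let ?a = "\<lambda>x. complex_of_real (a x)"
  let ?E = "\<lambda>x. (cmod (fourier ?a x))\<^sup>2"
  have [measurable]: "a \<in> borel_measurable borel"
    using borel_measurable_integrable[OF a] by simp
  have ac: "integrable lborel ?a" using a by (rule integrable_of_real)
  have acm: "integrable lborel (\<lambda>x. ?a (- x))" using integrable_reflect[OF ac, of 0] by simp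
  define k where "k i = 1 / real (Suc i)" for i
  have k: "k i > 0" for i by (simp add: k_def)
  \<comment> \<open>\<open>G i\<close> is the Fourier transform of \<open>gauss (k i)\<close>: a
    density of mass 1 concentrating at 0.\<close>
  define G where "G i x = gauss (1 / k i) x / k i ^ CARD('n)" for i and x :: "real^'n"
  have [measurable]: "G i \<in> borel_measurable borel" for i unfolding G_def by measurable
  have Gnn: "G i x \<ge> 0" for i x using k[of i] gauss_pos[of "1 / k i" x] by (simp add: G_def)
  have Gi: "integrable lborel (G i)" for i
    unfolding G_def using k[of i] by (intro integrable_divide integrable_gauss) simp
  have G1: "(LINT x|lborel. G i x) = 1" for i
    unfolding G_def using k[of i] by (simp add: integral_gauss power_one_over)
  have GN: "(\<integral>\<^sup>+ \<xi>. ennreal (G i (\<eta> - \<xi>)) \<partial>lborel) = 1" "(\<integral>\<^sup>+ \<xi>. ennreal (G i (\<xi> - \<eta>)) \<partial>lborel) = 1" for i \<eta>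
  proof -
    have 1: "(\<integral>\<^sup>+ \<xi>. ennreal (G i \<xi>) \<partial>lborel) = 1"
      by (subst nn_integral_eq_integral[OF Gi]) (auto simp: Gnn G1)
    show "(\<integral>\<^sup>+ \<xi>. ennreal (G i (\<eta> - \<xi>)) \<partial>lborel) = 1"
      using 1 nn_integral_lborel_affine[of "-1" "\<lambda>x. ennreal (G i x)" \<eta>] by simp
    show "(\<integral>\<^sup>+ \<xi>. ennreal (G i (\<xi> - \<eta>)) \<partial>lborel) = 1"
      using 1 nn_integral_lborel_affine[of 1 "\<lambda>x. ennreal (G i x)" "- \<eta>"] by simp
  qed
  have bound: "(\<integral>\<^sup>+ x. ennreal (?E x * gauss (k i) x) \<partial>lborel)
      \<le> ennreal (LINT x|lborel. (a x)\<^sup>2)" for i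
  proof -
    let ?W = "\<lambda>\<eta> \<xi>. ennreal ((a \<eta>)\<^sup>2 / 2) * ennreal (G i (\<eta> - \<xi>)) + ennreal ((a \<xi>)\<^sup>2 / 2) * ennreal (G i (\<eta> - \<xi>))"
    have gi: "integrable lborel (\<lambda>x. complex_of_real (gauss (k i) x))"
      using integrable_gauss[OF k] by (rule integrable_of_real)
    have fb: "cmod (fourier ?a x) \<le> (LINT x|lborel. a x)" for x
      using norm_fourier_le[of ?a x] nn by simp
    have cn: "cnj (fourier ?a x) = fourier (\<lambda>x. ?a (- x)) x" for x
      using cnj_fourier[of ?a x] by simp
    \<comment> \<open>With this \<open>m\<close>, the product \<open>fourier ?a x * m x\<close> is
      the squared modulus damped by the Gaussian, and \<open>fourier m\<close> is the convolution of
      \<open>a\<close> with \<open>G i\<close>.\<close>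
    define m where "m x = fourier (\<lambda>x. ?a (- x)) x * of_real (gauss (k i) x)" for x
    have mi: "integrable lborel m"
      unfolding m_def
    proof (rule Bochner_Integration.integrable_bound)
      show "integrable lborel (\<lambda>x::real^'n. (LINT x|lborel. a x) * gauss (k i) x)"
        using integrable_gauss[OF k[of i], where 'n = 'n] by simp
      have "cmod (fourier (\<lambda>x. ?a (- x)) x) \<le> (LINT x|lborel. a x)" for x
        using fb[of x] by (simp flip: cn)
      then show "AE x in lborel. norm (fourier (\<lambda>x. ?a (- x)) x * of_real (gauss (k i) x))
          \<le> norm ((LINT x|lborel. a x) * gauss (k i) x)"
        by (intro AE_I2) (auto simp: norm_mult abs_of_pos[OF gauss_pos] nn
          intro!: mult_right_mono less_imp_le[OF gauss_pos] order_trans[OF _ abs_ge_self])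
    qed measurable
    have sq
: "complex_of_real (?E x * gauss (k i) x) = fourier ?a x * m x" for x
      by (simp add: m_def cn[symmetric] complex_norm_square del: of_real_power)
    have int: "integrable lborel (\<lambda>x. ?E x * gauss (k i) x)"
    proof (rule Bochner_Integration.integrable_bound)
      show "integrable lborel (\<lambda>x::real^'n. (LINT x|lborel. a x)\<^sup>2 * gauss (k i) x)"
        using integrable_gauss[OF k[of i], where 'n = 'n] by simp
      show "AE x in lborel. norm (?E x * gauss (k i) x)
          \<le> norm ((LINT x|lborel. a x)\<^sup>2 * gauss (k i) x)"
        by (intro AE_I2) (auto simp: abs_mult abs_of_pos[OF gauss_pos]
            intro!: mult_right_mono less_imp_le[OF gauss_pos] power_mono fb)
    qed measurable
    have mh: "fourier m \<eta> = (LINT \<xi>|lborel. of_real (a \<xi> * G i (\<eta> - \<xi>)))" for \<eta>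
      unfolding m_def fourier_fourier_mult[OF acm gi] fourier_gauss[OF k] by (simp add: G_def)
    have "ennreal (LINT x|lborel. ?E x * gauss (k i) x)
        = ennreal (norm (LINT x|lborel. complex_of_real (?E x * gauss (k i) x)))"
      by (simp add: abs_of_nonneg gauss_pos less_imp_le integral_nonneg del: of_real_mult of_real_power)
    also have "\<dots> = ennreal (norm (LINT \<eta>|lborel. ?a \<eta> * fourier m \<eta>))"
      unfolding sq fourier_multiplication[OF ac mi] ..
    also have "\<dots> \<le> (\<integral>\<^sup>+ \<eta>. ennreal (norm (?a \<eta> * fourier m \<eta>)) \<partial>lborel)"
    proof (rule integral_norm_bound_ennreal)
      have [measurable]: "m \<in> borel_measurable borel" using borel_measurable_integrable[OF mi] by simp
      show "integrable lborel (\<lambda>\<eta>. ?a \<eta> * fourier m \<eta>)"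
      proof (rule Bochner_Integration.integrable_bound)
        show "integrable lborel (\<lambda>\<eta>. a \<eta> * (LINT x|lborel. norm (m x)))" using a by simp
        show "AE x in lborel. norm (?a x * fourier m x) \<le> norm (a x * (LINT x|lborel. norm (m x)))"
          by (rule AE_I2) (auto simp: norm_mult abs_mult intro!: mult_left_mono norm_fourier_le)

      qed measurable
    qed
    also have "\<dots> \<le> (\<integral>\<^sup>+ \<eta>. \<integral>\<^sup>+ \<xi>. ?W \<eta> \<xi> \<partial>lborel \<partial>lborel)"
    proof (rule nn_integral_mono)
      fix \<eta>
      have "ennreal (norm (fourier m \<eta>)) \<le> (\<integral>\<^sup>+ \<xi>. ennreal (norm (complex_of_real (a \<xi> * G i (\<eta> - \<xi>)))) \<partial>lborel)"
        unfolding mh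
      \<comment> \<open>If the integrand fails to be integrable, the integral has the default value
        0 and the bound is trivial.\<close>
      proof (cases "integrable lborel (\<lambda>\<xi>. complex_of_real (a \<xi> * G i (\<eta> - \<xi>)))")
        case True
        then show "ennreal (norm (LINT \<xi>|lborel. complex_of_real (a \<xi> * G i (\<eta> - \<xi>))))
          \<le> (\<integral>\<^sup>+ \<xi>. ennreal (norm (complex_of_real (a \<xi> * G i (\<eta> - \<xi>)))) \<partial>lborel)"
          by (rule integral_norm_bound_ennreal)
      qed (simp add: not_integrable_integral_eq)
      also have "\<dots> = (\<integral>\<^sup>+ \<xi>. ennreal (a \<xi> * G i (\<eta> - \<xi>)) \<partial>lborel)"
        by (simp add: norm_mult Gnn nn abs_of_nonneg)
      finally have "ennreal (norm (?a \<eta> * fourier m \<eta>)) \<le> ennreal (a \<eta>) * (\<integral>\<^sup>+ \<xi>. ennreal (a \<xi> * G i (\<eta> - \<xi>)) \<partial>lborel)"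
        by (simp add: norm_mult nn ennreal_mult mult_left_mono)
      also have "\<dots> = (\<integral>\<^sup>+ \<xi>. ennreal (a \<eta>) * ennreal (a \<xi> * G i (\<eta> - \<xi>)) \<partial>lborel)"
        by (rule nn_integral_cmult[symmetric]) measurable
      also have "\<dots> \<le> (\<integral>\<^sup>+ \<xi>. ?W \<eta> \<xi> \<partial>lborel)"
      proof (rule nn_integral_mono)
        fix \<xi>
        have "a \<eta> * a \<xi> \<le> (a \<eta>)\<^sup>2 / 2 + (a \<xi>)\<^sup>2 / 2"
          using sum_squares_bound[of "a \<eta>" "a \<xi>"] by simp
        then have "a \<eta> * a \<xi> * G i (\<eta> - \<xi>) \<le> ((a \<eta>)\<^sup>2 / 2 + (a \<xi>)\<^sup>2 / 2) * G i (\<eta> - \<xi>)"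
          by (rule mult_right_mono) (rule Gnn)
        then show "ennreal (a \<eta>) * ennreal (a \<xi> * G i (\<eta> - \<xi>))
          \<le> ?W \<eta> \<xi>"
          by (simp add: nn Gnn ennreal_leI algebra_simps flip: ennreal_mult ennreal_plus)
      qed
      finally show "ennreal (norm (?a \<eta> * fourier m \<eta>))
        \<le> (\<integral>\<^sup>+ \<xi>. ?W \<eta> \<xi> \<partial>lborel)" .
    qed
    also have "\<dots> = (\<integral>\<^sup>+ \<eta>. ennreal ((a \<eta>)\<^sup>2 / 2) \<partial>lborel)
        + (\<integral>\<^sup>+ \<eta>. \<integral>\<^sup>+ \<xi>. ennreal ((a \<xi>)\<^sup>2 / 2) * ennreal (G i (\<eta> - \<xi>)) \<partial>lborel \<partial>lborel)"
      by (subst nn_integral_add, measurable, subst nn_integral_cmult, measurable)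
        (simp add: GN, rule nn_integral_add, measurable)
    also have "(\<integral>\<^sup>+ \<eta>. \<integral>\<^sup>+ \<xi>. ennreal ((a \<xi>)\<^sup>2 / 2) * ennreal (G i (\<eta> - \<xi>)) \<partial>lborel \<partial>lborel)
        = (\<integral>\<^sup>+ \<xi>. \<integral>\<^sup>+ \<eta>. ennreal ((a \<xi>)\<^sup>2 / 2) * ennreal (G i (\<eta> - \<xi>)) \<partial>lborel \<partial>lborel)"
      by (rule lborel_pair.Fubini') measurable
    also have "\<dots> = (\<integral>\<^sup>+ \<xi>. ennreal ((a \<xi>)\<^sup>2 / 2) \<partial>lborel)"
      by (subst nn_integral_cmult, measurable) (simp add: GN)
    also have "(\<integral>\<^sup>+ \<eta>. ennreal ((a \<eta>)\<^sup>2 / 2) \<partial>lborel) + (\<integral>\<^sup>+ \<xi>. ennreal ((a \<xi>)\<^sup>2 / 2) \<partial>lborel)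
        = ennreal (LINT x|lborel. (a x)\<^sup>2)"
      using a2 by (subst (1 2) nn_integral_eq_integral) (auto simp: integral_nonneg simp flip: ennreal_plus)
    finally show ?thesis
      by (subst nn_integral_eq_integral[OF int]) (auto intro!: mult_nonneg_nonneg less_imp_le[OF gauss_pos])
  qed
  have "(\<integral>\<^sup>+ x. ennreal (?E x) \<partial>lborel)
      = (\<integral>\<^sup>+ x. liminf (\<lambda>i. ennreal (?E x * gauss (k i) x)) \<partial>lborel)"
  proof (rule nn_integral_cong)
    fix x
    have "(\<lambda>i. ennreal (?E x * gauss (k i) x)) \<longlonglongrightarrow> ennreal (?E x * 1)"
      unfolding k_def by (intro tendsto_ennrealI tendsto_intros gauss_tendsto_1)
    from lim_imp_Liminf[OF _ this]
    show "ennreal (?E x) = liminf (\<lambda>i. ennreal (?E x * gauss (k i) x))"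
      by simp
  qed
  also have "\<dots> \<le> liminf (\<lambda>i. \<integral>\<^sup>+ x. ennreal (?E x * gauss (k i) x) \<partial>lborel)"
    by (rule nn_integral_liminf) measurable
  also have "\<dots> \<le> ennreal (LINT x|lborel. (a x)\<^sup>2)"
    using bound by (intro Liminf_le) (auto simp: always_eventually)
  finally show ?thesis .
qed


section \<open>Shifting the base of a tube\<close>

lemma tube_pt_nth: "tube_pt x y $ j = of_real (x $ j) + \<i> * of_real (y $ j)"
  by (simp add: tube_pt_def cvec_def)

lemma cvec_nth: "cvec x $ j = of_real (x $ j)"
  by (simp add: cvec_def)

text \<open>A complex line with real direction \<open>y\<close> in a cone meets the tube at every
  parameter in the upper half plane. All holomorphy is used on such slices.\<close>

lemma slice_eq_tube_pt: "cvec x + \<zeta> *s cvec y = tube_pt (x + Re \<zeta> *\<^sub>R y) (Im \<zeta> *\<^sub>R y)"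
  by (simp add: vec_eq_iff tube_pt_nth cvec_nth complex_eq_iff)

lemma continuous_on_tube_pt[continuous_intros]:
  assumes "continuous_on S f" "continuous_on S g"
  shows "continuous_on S (\<lambda>x. tube_pt (f x) (g x))"
  using assms unfolding tube_pt_def cvec_def vector_scalar_mult_def
  by (intro continuous_intros) auto

text \<open>The uniform bound \<open>N\<close> over an interval of finite length provides the
  absolute integrability for Fubini.\<close>

lemma Fubini_strip:
  fixes k :: "real \<Rightarrow> real^'n \<Rightarrow> complex" and B :: "real^'n \<Rightarrow> real"
  assumes k: "continuous_on UNIV (\<lambda>(q, x). k q x)"
    and ki: "\<And>q. q \<in> {c..d} \<Longrightarrow> integrable lborel (k q)"
    and bd: "\<And>q. q \<in> {c..d} \<Longrightarrow> (LINT x|lborel. norm (k q x)) \<le> N"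
  shows "(LINT x|lborel. LINT q|lborel. indicator {c..d} q *\<^sub>R k q x)
      = (LINT q|lborel. indicator {c..d} q *\<^sub>R (LINT x|lborel. k q x))"
    and "integrable lborel (\<lambda>x. LINT q|lborel. indicator {c..d} q *\<^sub>R k q x)"
proof -
  have [measurable]: "(\<lambda>(q, x). k q x) \<in> borel_measurable (borel \<Otimes>\<^sub>M borel)"
    unfolding borel_prod by (rule borel_measurable_continuous_onI[OF k])
  have I: "integrable (lborel \<Otimes>\<^sub>M lborel) (\<lambda>(q, x). indicator {c..d} q *\<^sub>R k q x)"
  proof (rule lborel_pair.Fubini_integrable)
    show "(\<lambda>(q, x). indicator {c..d} q *\<^sub>R k q x) \<in> borel_measurable (lborel \<Otimes>\<^sub>M lborel)"
      by measurable
    show "AE q in lborel. integrable lborel (\<lambda>x. case (q, x) of (q, x) \<Rightarrow> indicator {c..d} q *\<^sub>R k q x)"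
      using ki by (auto simp: indicator_def)
    have "integrable lborel (\<lambda>q::real. indicator {c..d} q *\<^sub>R N)"
      by (intro integrable_scaleR_left integrable_real_indicator) (auto simp: emeasure_lborel_Icc_eq)
    then show "integrable lborel (\<lambda>q. LINT x|lborel. norm (case (q, x) of (q, x) \<Rightarrow> indicator {c..d} q *\<^sub>R k q x))"
    proof (rule Bochner_Integration.integrable_bound)
      show "AE q in lborel. norm (LINT x|lborel. norm (case (q, x) of (q, x) \<Rightarrow> indicator {c..d} q *\<^sub>R k q x))
          \<le> norm (indicator {c..d} q *\<^sub>R N)"
        using bd by (intro AE_I2) (auto simp: indicator_def integral_nonneg intro: order_trans[OF _ abs_ge_self])
    qed measurable
  qed
  show "(LINT x|lborel. LINT q|lborel. indicator {c..d} q *\<^sub>R k q x)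
      = (LINT q|lborel. indicator {c..d} q *\<^sub>R (LINT x|lborel. k q x))"
    using lborel_pair.Fubini_integral[OF I] by simp
  show "integrable lborel (\<lambda>x. LINT q|lborel. indicator {c..d} q *\<^sub>R k q x)"
    using lborel_pair.integrable_snd[OF I] by simp
qed

text \<open>Averaging over the translates \<open>x + \<tau> y\<close>, \<open>0 \<le> \<tau> \<le> 1\<close>, turns the difference of the two
  integrals into integrals over horizontal sides of rectangles in the slices; by Cauchy's theorem
  these are the integrals over the vertical sides, which cancel by translation invariance.\<close>

lemma integral_tube_shift:
  fixes G :: "complex^'n \<Rightarrow> complex" and y :: "real^'n"
  assumes hol: "\<And>x. (\<lambda>\<zeta>. G (cvec x + \<zeta> *s cvec y)) holomorphic_on {\<zeta>. a < Im \<zeta> \<and> Im \<zeta> < b}"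
    and cont: "\<And>x s. a < s \<Longrightarrow> s < b \<Longrightarrow> isCont G (tube_pt x (s *\<^sub>R y))"
    and bound: "\<And>x s. a < s \<Longrightarrow> s < b \<Longrightarrow> norm (G (tube_pt x (s *\<^sub>R y))) \<le> B x"
    and B: "integrable lborel B"
    and s: "a < s0" "s0 \<le> s1" "s1 < b"
  shows "(LINT x|lborel. G (tube_pt x (s0 *\<^sub>R y))) = (LINT x|lborel. G (tube_pt x (s1 *\<^sub>R y)))"
proof -
  \<comment> \<open>Clamping the height to \<open>[s0, s1]\<close> makes the integrand continuous
    and dominated for all real heights, so that the measurability and Fubini arguments can run over
    the whole line.\<close>
  define cl where "cl s = max s0 (min s1 s)" for s
  have cl: "a < cl s" "cl s < b" for s using s by (auto simp: cl_def)
  have cl_eq: "cl s = s" if "s \<in> {s0..s1}" for s using that by (auto simp: cl_def)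
  have contcl: "continuous_on S (\<lambda>p. cl (h p))" if "continuous_on S h" for S and h :: "'z::topological_space \<Rightarrow> real"
    unfolding cl_def using that by (intro continuous_intros)
  define H where "H s x = G (tube_pt x (cl s *\<^sub>R y))" for s x
  have contH: "continuous_on UNIV (\<lambda>p. H (h p) (w p))"
    if "continuous_on UNIV h" "continuous_on UNIV w" for h and w :: "'z::topological_space \<Rightarrow> real^'n"
    unfolding H_def
  proof (rule continuous_on_compose2[of "{tube_pt x (s *\<^sub>R y) |x s. a < s \<and> s < b}" G])
    show "continuous_on {tube_pt x (s *\<^sub>R y) |x s. a < s \<and> s < b} G"
      using cont by (intro continuous_at_imp_continuous_on) auto
    show "continuous_on UNIV (\<lambda>p. tube_pt (w p) (cl (h p) *\<^sub>R y))"
      using that by (intro continuous_intros contcl)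
  qed (use cl in auto)
  have mH: "(\<lambda>x. H s (c + x)) \<in> borel_measurable borel" for s c
    by (intro borel_measurable_continuous_onI contH continuous_intros)
  have mH0: "H s \<in> borel_measurable borel" for s
    using mH[of s 0] by simp
  have bdH: "norm (H s x) \<le> B x" for s x unfolding H_def using cl by (intro bound)
  have iH0: "integrable lborel (H s)" for s
  proof (rule Bochner_Integration.integrable_bound[OF B])
    show "AE x in lborel. norm (H s x) \<le> norm (B x)"
      by (intro AE_I2 order_trans[OF bdH]) auto
  qed (use mH0 in simp)
  have iH: "integrable lborel (\<lambda>x. H s (c + x))" for s c
    using lborel_integrable_affine_iff[of 1 "H s" c] mH0 iH0 by simp
  have tH: "(LINT x|lborel. H s (c + x)) = (LINT x|lborel. H s x)" for s c
    using lborel_integral_affine[of 1 "H s" c] mH0 by simp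
  have tHn: "(LINT x|lborel. norm (H s (c + x))) \<le> (LINT x|lborel. B x)" for s c
  proof -
    have "(LINT x|lborel. norm (H s (c + x))) = (LINT x|lborel. norm (H s x))"
      using lborel_integral_affine[of 1 "\<lambda>x. norm (H s x)" c] mH0 by simp
    also have "\<dots> \<le> (LINT x|lborel. B x)"
      by (rule integral_mono[OF integrable_norm[OF iH0] B]) (rule bdH)
    finally show ?thesis .
  qed
  define A where "A s x = (LINT \<tau>|lborel. indicator {0..1} \<tau> *\<^sub>R H s (\<tau> *\<^sub>R y + x))" for s x
  define V where "V c x = (LINT q|lborel. indicator {s0..s1} q *\<^sub>R H q (c *\<^sub>R y + x))" for c x
  have A: "(LINT x|lborel. A s x) = (LINT x|lborel. H s x)" "integrable lborel (A s)" for s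
  proof -
    have c: "continuous_on UNIV (\<lambda>(\<tau>, x). H s (\<tau> *\<^sub>R y + x))"
      unfolding case_prod_unfold by (intro contH continuous_intros)
    have "(LINT x|lborel. A s x) = (LINT \<tau>|lborel. indicator {0..1::real} \<tau> *\<^sub>R (LINT x|lborel. H s (\<tau> *\<^sub>R y + x)))"
      unfolding A_def by (rule Fubini_strip(1)[OF c iH tHn])
    also have "\<dots> = (LINT x|lborel. H s x)"
      unfolding tH by simp
    finally show "(LINT x|lborel. A s x) = (LINT x|lborel. H s x)" .
    show "integrable lborel (A s)"
      unfolding A_def by (rule Fubini_strip(2)[OF c iH tHn])
  qed
  have V: "(LINT x|lborel. V c x) = (LINT q|lborel. indicator {s0..s1} q *\<^sub>R (LINT x|lborel. H q x))"
    "integrable lborel (V c)" for c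
  proof -
    have c: "continuous_on UNIV (\<lambda>(q, x). H q (c *\<^sub>R y + x))"
      unfolding case_prod_unfold by (intro contH continuous_intros)
    show "(LINT x|lborel. V c x) = (LINT q|lborel. indicator {s0..s1} q *\<^sub>R (LINT x|lborel. H q x))"
      unfolding V_def Fubini_strip(1)[OF c iH tHn] tH ..
    show "integrable lborel (V c)"
      unfolding V_def by (rule Fubini_strip(2)[OF c iH tHn])
  qed
  have rect: "A s0 x - A s1 x = \<i> * (V 0 x - V 1 x)" for x
  proof -
    define S where "S = {\<zeta>. a < Im \<zeta> \<and> Im \<zeta> < b}"
    have S_eq: "S = {\<zeta>. Im \<zeta> > a} \<inter> {\<zeta>. Im \<zeta> < b}" by (auto simp: S_def)
    have "open S" unfolding S_eq by (intro open_Int open_halfspace_Im_gt open_halfspace_Im_lt)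
    have "convex S" unfolding S_eq by (intro convex_Int convex_halfspace_Im_gt convex_halfspace_Im_lt)
    \<comment> \<open>A primitive on the convex strip evaluates each side of the rectangle with
      heights \<open>s0\<close>, \<open>s1\<close> as a difference of corner values; this is
      Cauchy's theorem for that rectangle.\<close>
    obtain P where P: "\<And>\<zeta>. \<zeta> \<in> S \<Longrightarrow> (P has_field_derivative G (cvec x + \<zeta> *s cvec y)) (at \<zeta> within S)"
      using holomorphic_convex_primitive'[OF \<open>convex S\<close> \<open>open S\<close> hol[of x, folded S_def]] by blast
    have P': "(P has_field_derivative H q (\<tau> *\<^sub>R y + x)) (at (Complex \<tau> q))" if "q \<in> {s0..s1}" for \<tau> q
    proof -
      have "Complex \<tau> q \<in> S" using that s by (auto simp: S_def)
      from P[OF this] have "(P has_field_derivative G (cvec x + Complex \<tau> q *s cvec y)) (at (Complex \<tau> q))"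
        using at_within_open[OF \<open>Complex \<tau> q \<in> S\<close> \<open>open S\<close>] by simp
      then show ?thesis using that by (simp add: H_def cl_eq slice_eq_tube_pt add.commute)
    qed
    have Aeq: "A q x = P (Complex 1 q) - P (Complex 0 q)" if q: "q \<in> {s0..s1}" for q
      unfolding A_def
    proof (rule integral_FTC_atLeastAtMost)
      fix \<tau> :: real
      have "((\<lambda>\<tau>. Complex \<tau> q) has_vector_derivative 1) (at \<tau> within {0..1})"
        unfolding Complex_eq by (auto intro!: derivative_eq_intros)
      from field_vector_diff_chain_within[OF this has_field_derivative_at_within[OF P'[OF q]]]
      show "((\<lambda>\<tau>. P (Complex \<tau> q)) has_vector_derivative H q (\<tau> *\<^sub>R y + x)) (at \<tau> within {0..1})"
        by (simp add: o_def)
      show "continuous_on {0..1} (\<lambda>\<tau>. H q (\<tau> *\<^sub>R y + x))"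
        by (rule continuous_on_subset[OF contH]) (auto intro!: continuous_intros)
    qed simp
    have Veq: "\<i> * V c x = P (Complex c s1) - P (Complex c s0)" for c
    proof -
      have "(LINT q|lborel. indicator {s0..s1} q *\<^sub>R (\<i> * H q (c *\<^sub>R y + x))) = P (Complex c s1) - P (Complex c s0)"
      proof (rule integral_FTC_atLeastAtMost)
        fix q :: real assume "s0 \<le> q" "q \<le> s1"
        then have q: "q \<in> {s0..s1}" by simp
        have "((\<lambda>q. Complex c q) has_vector_derivative \<i>) (at q within {s0..s1})"
          unfolding Complex_eq by (auto intro!: derivative_eq_intros)
        from field_vector_diff_chain_within[OF this has_field_derivative_at_within[OF P'[OF q]]]
        show "((\<lambda>q. P (Complex c q)) has_vector_derivative \<i> * H q (c *\<^sub>R y + x)) (at q within {s0..s1})"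
          by (simp add: o_def)
      next
        show "continuous_on {s0..s1} (\<lambda>q. \<i> * H q (c *\<^sub>R y + x))"
          by (rule continuous_on_mult_left, rule continuous_on_subset[OF contH]) (auto intro!: continuous_intros)
      qed (use s in simp)
      moreover have "(LINT q|lborel. indicator {s0..s1} q *\<^sub>R (\<i> * H q (c *\<^sub>R y + x))) = \<i> * V c x"
        unfolding V_def by (simp flip: integral_mult_right_zero)
      ultimately show ?thesis by simp
    qed
    show ?thesis
      using Aeq[of s0] Aeq[of s1] Veq[of 0] Veq[of 1] s by (simp add: right_diff_distrib)
  qed
  have "(LINT x|lborel. H s0 x) - (LINT x|lborel. H s1 x) = (LINT x|lborel. A s0 x - A s1 x)"
    using A by simp
  also have "\<dots> = \<i> * (LINT x|lborel. V 0 x - V 1 x)"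
    unfolding rect by simp
  also have "(LINT x|lborel. V 0 x - V 1 x) = 0"
    using V by simp
  finally show ?thesis
    using s by (simp add: H_def cl_eq)
qed

lemma boundary_value_shift:
  fixes F \<phi> :: "complex^'n \<Rightarrow> complex" and y :: "real^'n"
  assumes F_hol: "\<And>x. (\<lambda>\<zeta>. F (cvec x + \<zeta> *s cvec y)) holomorphic_on {\<zeta>. 0 < Im \<zeta>}"
    and F_cont: "\<And>x s. 0 < s \<Longrightarrow> isCont F (tube_pt x (s *\<^sub>R y))"
    and F_bound: "\<And>r. r > 0 \<Longrightarrow> \<exists>M. \<forall>x s. s \<ge> r \<longrightarrow> norm (F (tube_pt x (s *\<^sub>R y))) \<le> M * (1 + norm x) ^ R"
    and a: "a > 0"
    and \<phi>_hol: "\<And>x. (\<lambda>\<zeta>. \<phi> (cvec x + \<zeta> *s cvec y)) holomorphic_on {\<zeta>. - a < Im \<zeta>}"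
    and \<phi>_cont: "\<And>x s. - a < s \<Longrightarrow> isCont \<phi> (tube_pt x (s *\<^sub>R y))"
    and \<phi>_bound: "\<And>x s. - a < s \<Longrightarrow> s < 2 \<Longrightarrow> (1 + norm x) ^ R * norm (\<phi> (tube_pt x (s *\<^sub>R y))) \<le> B x"
    and B: "integrable lborel B"
    and lim: "((\<lambda>\<epsilon>. LINT x|lborel. F (tube_pt x (\<epsilon> *\<^sub>R y)) * \<phi> (cvec x)) \<longlongrightarrow> L) (at_right 0)"
  shows "L = (LINT x|lborel. F (tube_pt x y) * \<phi> (tube_pt x y))"
proof -
  define \<epsilon> where "\<epsilon> i = 1 / real (Suc i)" for i
  have \<epsilon>: "\<epsilon> i > 0" for i by (simp add: \<epsilon>_def)
  have \<epsilon>0: "\<epsilon> \<longlonglongrightarrow> 0" unfolding \<epsilon>_def by (rule LIMSEQ_Suc[OF lim_1_over_n])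
  have tp: "tube_pt x y + (\<i> * of_real e) *s cvec w = tube_pt x (y + e *\<^sub>R w)" for x y w :: "real^'n" and e
    by (simp add: vec_eq_iff tube_pt_nth cvec_nth algebra_simps)
  have tp2: "tube_pt x (s *\<^sub>R y) + (\<i> * of_real e) *s cvec y = tube_pt x ((s + e) *\<^sub>R y)" for x s e
    by (simp add: tp scaleR_add_left)
  have eq: "(LINT x|lborel. F (tube_pt x (\<epsilon> i *\<^sub>R y)) * \<phi> (cvec x))
      = (LINT x|lborel. F (tube_pt x ((1 + \<epsilon> i) *\<^sub>R y)) * \<phi> (tube_pt x y))" for i
  proof -
    \<comment> \<open>Above height \<open>- a'\<close> the function \<open>\<phi>\<close> is still
      holomorphic and the translated \<open>F\<close> is evaluated at heights of at least
      \<open>\<epsilon> i / 2\<close>.\<close>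
    define a' where "a' = min a (\<epsilon> i / 2)"
    have a': "a' > 0" "a' \<le> a" "a' \<le> \<epsilon> i / 2" using a \<epsilon>[of i] by (auto simp: a'_def)
    obtain M where M: "\<And>x s. s \<ge> \<epsilon> i / 2 \<Longrightarrow> norm (F (tube_pt x (s *\<^sub>R y))) \<le> M * (1 + norm x) ^ R"
      using F_bound[of "\<epsilon> i / 2"] \<epsilon>[of i] by auto
    let ?G = "\<lambda>z. F (z + (\<i> * of_real (\<epsilon> i)) *s cvec y) * \<phi> z"
    have "(LINT x|lborel. ?G (tube_pt x (0 *\<^sub>R y))) = (LINT x|lborel. ?G (tube_pt x (1 *\<^sub>R y)))"
    \<comment> \<open>The open strip from \<open>- a'\<close> to 2 contains both heights 0 and
      1.\<close>
    proof (rule integral_tube_shift[where a = "- a'" and b = 2 and B = "\<lambda>x. \<bar>M\<bar> * B x"])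
      fix x
      have "(\<lambda>\<zeta>. F (cvec x + (\<zeta> + \<i> * of_real (\<epsilon> i)) *s cvec y)) holomorphic_on {\<zeta>. - a' < Im \<zeta> \<and> Im \<zeta> < 2}"
        by (rule holomorphic_on_compose_gen[OF _ F_hol[of x], unfolded o_def])
          (use a' \<epsilon>[of i] in \<open>auto intro!: holomorphic_intros\<close>)
      then have 1: "(\<lambda>\<zeta>. F (cvec x + \<zeta> *s cvec y + (\<i> * of_real (\<epsilon> i)) *s cvec y)) holomorphic_on {\<zeta>. - a' < Im \<zeta> \<and> Im \<zeta> < 2}"
        by (simp add: vector_sadd_rdistrib add.assoc)
      have 2: "(\<lambda>\<zeta>. \<phi> (cvec x + \<zeta> *s cvec y)) holomorphic_on {\<zeta>. - a' < Im \<zeta> \<and> Im \<zeta> < 2}"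
        by (rule holomorphic_on_subset[OF \<phi>_hol]) (use a' in auto)
      show "(\<lambda>\<zeta>. ?G (cvec x + \<zeta> *s cvec y)) holomorphic_on {\<zeta>. - a' < Im \<zeta> \<and> Im \<zeta> < 2}"
        using 1 2 by (rule holomorphic_on_mult)
      fix s assume s: "- a' < s" "s < 2"
      have sp: "s + \<epsilon> i > 0" "s + \<epsilon> i \<ge> \<epsilon> i / 2" using s a' \<epsilon>[of i] by auto
      have "isCont (\<lambda>z. F (z + (\<i> * of_real (\<epsilon> i)) *s cvec y)) (tube_pt x (s *\<^sub>R y))"
        by (rule isCont_o2[where g = F]) (use F_cont[OF sp(1)] in \<open>auto simp: tp2 intro!: continuous_intros\<close>)
      then show "isCont ?G (tube_pt x (s *\<^sub>R y))"
        using \<phi>_cont[of s x] s a' by (intro continuous_mult) auto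
      have "norm (?G (tube_pt x (s *\<^sub>R y))) \<le> M * (1 + norm x) ^ R * norm (\<phi> (tube_pt x (s *\<^sub>R y)))"
        unfolding norm_mult tp2 by (intro mult_right_mono M sp) auto
      also have "\<dots> \<le> \<bar>M\<bar> * ((1 + norm x) ^ R * norm (\<phi> (tube_pt x (s *\<^sub>R y))))"
        unfolding mult.assoc by (intro mult_right_mono) auto
      also have "\<dots> \<le> \<bar>M\<bar> * B x"
        using s a' by (intro mult_left_mono \<phi>_bound) auto
      finally show "norm (?G (tube_pt x (s *\<^sub>R y))) \<le> \<bar>M\<bar> * B x" .
    qed (use a' B in auto)
    moreover have "tube_pt x (0 *\<^sub>R y) = cvec x" for x by (simp add: vec_eq_iff tube_pt_nth cvec_nth)

    ultimately show ?thesis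
      using tp2[of _ 0 "\<epsilon> i"] tp2[of _ 1 "\<epsilon> i"] by simp
  qed
  have "filterlim \<epsilon> (at_right 0) sequentially"
    using \<epsilon>0 \<epsilon> less_imp_neq[OF \<epsilon>, symmetric] by (simp add: filterlim_at always_eventually)


  then have l1: "(\<lambda>i. LINT x|lborel. F (tube_pt x ((1 + \<epsilon> i) *\<^sub>R y)) * \<phi> (tube_pt x y)) \<longlonglongrightarrow> L"
    using filterlim_compose[OF lim] unfolding eq[symmetric] by blast
  obtain M where M: "\<And>x s. s \<ge> 1 \<Longrightarrow> norm (F (tube_pt x (s *\<^sub>R y))) \<le> M * (1 + norm x) ^ R"
    using F_bound[of 1] by auto
  have mt: "(\<lambda>x. g (tube_pt x (s *\<^sub>R y))) \<in> borel_measurable borel"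
    if "\<And>x. isCont g (tube_pt x (s *\<^sub>R y))" for g :: "complex^'n \<Rightarrow> complex" and s
  proof (rule borel_measurable_continuous_onI, rule continuous_on_compose2[of "range (\<lambda>x. tube_pt x (s *\<^sub>R y))" g])
    show "continuous_on (range (\<lambda>x. tube_pt x (s *\<^sub>R y))) g"
      using that by (intro continuous_at_imp_continuous_on) auto
    show "continuous_on UNIV (\<lambda>x. tube_pt x (s *\<^sub>R y))" by (intro continuous_intros)
  qed auto
  have "(\<lambda>i. LINT x|lborel. F (tube_pt x ((1 + \<epsilon> i) *\<^sub>R y)) * \<phi> (tube_pt x y))
      \<longlonglongrightarrow> (LINT x|lborel. F (tube_pt x y) * \<phi> (tube_pt x y))"
  proof (rule integral_dominated_convergence[where w = "\<lambda>x. \<bar>M\<bar> * B x"])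
    have [measurable]: "(\<lambda>x. \<phi> (tube_pt x y)) \<in> borel_measurable borel"
      using mt[of 1 \<phi>] \<phi>_cont[of 1] a by simp
    have [measurable]: "(\<lambda>x. F (tube_pt x ((1 + \<epsilon> i) *\<^sub>R y))) \<in> borel_measurable borel" for i
      using mt[of "1 + \<epsilon> i" F] F_cont[of "1 + \<epsilon> i"] \<epsilon>[of i] by simp
    show "(\<lambda>x. F (tube_pt x ((1 + \<epsilon> i) *\<^sub>R y)) * \<phi> (tube_pt x y)) \<in> borel_measurable lborel" for i
      by measurable

    have [measurable]: "(\<lambda>x. F (tube_pt x y)) \<in> borel_measurable borel"
      using mt[of 1 F] F_cont[of 1] by simp
    show "(\<lambda>x. F (tube_pt x y) * \<phi> (tube_pt x y)) \<in> borel_measurable lborel"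
      by measurable
    show "integrable lborel (\<lambda>x. \<bar>M\<bar> * B x)" using B by simp
    show "AE x in lborel. (\<lambda>i. F (tube_pt x ((1 + \<epsilon> i) *\<^sub>R y)) * \<phi> (tube_pt x y)) \<longlonglongrightarrow> F (tube_pt x y) * \<phi> (tube_pt x y)"
    proof (rule AE_I2)
      fix x
      have "(\<lambda>i. tube_pt x (1 *\<^sub>R y) + (\<i> * of_real (\<epsilon> i)) *s cvec y) \<longlonglongrightarrow> tube_pt x (1 *\<^sub>R y) + (\<i> * of_real 0) *s cvec y"
        unfolding vector_scalar_mult_def by (intro tendsto_intros \<epsilon>0 tendsto_vec_lambda)
      then have "(\<lambda>i. tube_pt x ((1 + \<epsilon> i) *\<^sub>R y)) \<longlonglongrightarrow> tube_pt x y"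
        unfolding tp2 by simp
      then have "(\<lambda>i. F (tube_pt x ((1 + \<epsilon> i) *\<^sub>R y))) \<longlonglongrightarrow> F (tube_pt x y)"
        using F_cont[of 1 x] by (intro isCont_tendsto_compose[of _ F]) auto
      then show "(\<lambda>i. F (tube_pt x ((1 + \<epsilon> i) *\<^sub>R y)) * \<phi> (tube_pt x y)) \<longlonglongrightarrow> F (tube_pt x y) * \<phi> (tube_pt x y)"
        by (intro tendsto_intros)
    qed
    show "AE x in lborel. norm (F (tube_pt x ((1 + \<epsilon> i) *\<^sub>R y)) * \<phi> (tube_pt x y)) \<le> \<bar>M\<bar> * B x" for i
    proof (rule AE_I2)
      fix x
      have "norm (F (tube_pt x ((1 + \<epsilon> i) *\<^sub>R y)) * \<phi> (tube_pt x y)) \<le> M * (1 + norm x) ^ R * norm (\<phi> (tube_pt x y))"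
        unfolding norm_mult using \<epsilon>[of i] by (intro mult_right_mono M) auto
      also have "\<dots> \<le> \<bar>M\<bar> * ((1 + norm x) ^ R * norm (\<phi> (tube_pt x y)))"
        unfolding mult.assoc by (intro mult_right_mono) auto
      also have "\<dots> \<le> \<bar>M\<bar> * B x"
        using \<phi>_bound[of 1 x] a by (intro mult_left_mono) auto
      finally show "norm (F (tube_pt x ((1 + \<epsilon> i) *\<^sub>R y)) * \<phi> (tube_pt x y)) \<le> \<bar>M\<bar> * B x" .
    qed
  qed
  with l1 show ?thesis by (rule LIMSEQ_unique)
qed


section \<open>Rapidly decreasing regularisers\<close>

text \<open>The radicand has real part \<open>1 + c * Im z\<close>, so it stays off the cut of the
  square root wherever this is positive. Its modulus grows linearly in \<open>Re z\<close>, hence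
  the real part of the root grows like a square root and the exponential beats every power. The 1 in
  the exponent makes the limit for \<open>c\<close> tending to 0 equal to 1.\<close>

definition damp :: "real \<Rightarrow> complex \<Rightarrow> complex" where
  "damp c z = exp (1 - csqrt (1 - \<i> * of_real c * z))"

lemma damp_holomorphic: "damp c holomorphic_on {z. 0 < 1 + c * Im z}"
  unfolding damp_def by (intro holomorphic_intros) (auto simp: complex_nonpos_Reals_iff)

lemma open_damp_domain: "open {z. 0 < 1 + c * Im z}"
  by (intro open_Collect_less continuous_intros)

lemma isCont_damp: "0 < 1 + c * Im z \<Longrightarrow> isCont (damp c) z"
  using holomorphic_on_imp_continuous_on[OF damp_holomorphic[of c]] open_damp_domain[of c]
  by (auto simp: continuous_on_eq_continuous_at)

lemma norm_damp: "norm (damp c z) = exp (1 - Re (csqrt (1 - \<i> * of_real c * z)))"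
  by (simp add: damp_def)

lemma Re_csqrt_square: "(Re (csqrt w))\<^sup>2 = (cmod w + Re w) / 2"
proof -
  have "cmod w + Re w \<ge> 0" using abs_Re_le_cmod[of w] by linarith
  then show ?thesis by simp
qed

text \<open>If the radicand has real part at least 1, so does its root, and the exponent has
  nonpositive real part.\<close>

lemma norm_damp_le_1:
  assumes "c * Im z \<ge> 0"
  shows "norm (damp c z) \<le> 1"
proof -
  define w where "w = 1 - \<i> * of_real c * z"
  have "Re w \<ge> 1" using assms by (simp add: w_def)
  then have "1\<^sup>2 \<le> (Re (csqrt w))\<^sup>2"
    unfolding Re_csqrt_square using complex_Re_le_cmod[of w] by simp
  then have "1 \<le> Re (csqrt w)"
    using Re_csqrt[of w] by (rule power2_le_imp_le)
  then show ?thesis by (simp add: norm_damp w_def)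
qed

lemma power_div_fact_le_exp: "0 \<le> (x::real) \<Longrightarrow> x ^ n / fact n \<le> exp x"
  using sum_le_suminf[OF sums_summable[OF exp_converges[of x]], of "{n}"] sums_unique[OF exp_converges[of x]]
  by (simp add: divide_inverse mult.commute)

text \<open>For the real part \<open>r\<close> of the root, \<open>1 + \<bar>Re z\<bar>\<close> is
  at most a multiple of \<open>r^2\<close>, while \<open>damp\<close> has modulus
  \<open>exp (1 - r)\<close>. The region reaches beyond the real axis, which leaves room for
  Cauchy's inequality and for the contour shift.\<close>

lemma damp_rapid:
  assumes c: "c \<noteq> 0"
  shows "\<exists>K. \<forall>z. 1 / 2 \<le> 1 + c * Im z \<longrightarrow> (1 + \<bar>Re z\<bar>) ^ m * norm (damp c z) \<le> K"
proof (intro exI allI impI)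
  fix z assume z: "1 / 2 \<le> 1 + c * Im z"
  define w where "w = 1 - \<i> * of_real c * z"
  define r where
 "r = Re (csqrt w)"
  have r: "r \<ge> 0" unfolding r_def by (rule Re_csqrt)
  have Rew: "Re w \<ge> 1 / 2" "Im w = - (c * Re z)" using z by (simp_all add: w_def)
  have r2: "r\<^sup>2 = (cmod w + Re w) / 2" unfolding r_def by (rule Re_csqrt_square)
  have "\<bar>c\<bar> * \<bar>Re z\<bar> \<le> cmod w"
    using abs_Im_le_cmod[of w] by (simp add: Rew(2) abs_mult)
  then have 1: "\<bar>c\<bar> * \<bar>Re z\<bar> \<le> 2 * r\<^sup>2" using Rew(1) r2 by simp
  \<comment> \<open>The margin \<open>1 / 2\<close> in the hypothesis is used here: it lets
    \<open>2 * r^2\<close> absorb the summand 1 of \<open>1 + \<bar>Re z\<bar>\<close>.\<close>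
  have 2: "1 \<le> 2 * r\<^sup>2" using Rew(1) r2 complex_Re_le_cmod[of w] by simp

  have "\<bar>Re z\<bar> \<le> 2 * r\<^sup>2 / \<bar>c\<bar>" using 1 c by (simp add: field_simps)
  then have "1 + \<bar>Re z\<bar> \<le> (2 + 2 / \<bar>c\<bar>) * r\<^sup>2" using 2 by (simp add: algebra_simps)
  then have "(1 + \<bar>Re z\<bar>) ^ m \<le> ((2 + 2 / \<bar>c\<bar>) * r\<^sup>2) ^ m"
    by (intro power_mono) auto
  also have "\<dots> = (2 + 2 / \<bar>c\<bar>) ^ m * r ^ (2 * m)"
    by (simp add: power_mult_distrib power_mult)
  also have "\<dots> \<le> (2 + 2 / \<bar>c\<bar>) ^ m * (fact (2 * m) * exp r)"
  proof (rule mult_left_mono)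
    have "r ^ (2 * m) / fact (2 * m) \<le> exp r"
      using r by (rule power_div_fact_le_exp
)
    then show "r ^ (2 * m) \<le> fact (2 * m) * exp r" by (simp add: field_simps)
  qed auto
  finally have "(1 + \<bar>Re z\<bar>) ^ m * norm (damp c z)
      \<le> (2 + 2 / \<bar>c\<bar>) ^ m * (fact (2 * m) * exp r) * norm (damp c z)"
    by (rule mult_right_mono) simp
  also have "\<dots> = (2 + 2 / \<bar>c\<bar>) ^ m * fact (2 * m) * exp 1"
    by (simp add: norm_damp r_def w_def exp_diff)
  finally show "(1 + \<bar>Re z\<bar>) ^ m * norm (damp c z) \<le> (2 + 2 / \<bar>c\<bar>) ^ m * fact (2 * m) * exp 1" .
qed

lemma damp_tendsto_1:
  assumes "c \<longlonglongrightarrow> 0"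
  shows "(\<lambda>i. damp (c i) z) \<longlonglongrightarrow> 1"
proof -
  have "(\<lambda>i. csqrt (1 - \<i> * of_real (c i) * z)) \<longlonglongrightarrow> csqrt (1 - \<i> * of_real 0 * z)"
  proof (rule isCont_tendsto_compose[OF continuous_at_csqrt])
    show "(\<lambda>i. 1 - \<i> * of_real (c i) * z) \<longlonglongrightarrow> 1 - \<i> * of_real 0 * z"
      by (intro tendsto_intros assms)
  qed simp
  then have "(\<lambda>i. damp (c i) z) \<longlonglongrightarrow> exp (1 - csqrt (1 - \<i> * of_real 0 * z))"
    unfolding damp_def by (intro tendsto_intros)
  then show ?thesis by simp
qed

text \<open>Holomorphy in a strip gives control of all derivatives by Cauchy's inequality.\<close>

definition strip_rapid :: "(complex \<Rightarrow> complex) \<Rightarrow> bool" where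
  "strip_rapid u \<longleftrightarrow> (\<exists>\<rho>>0. u holomorphic_on {z. \<bar>Im z\<bar> < \<rho>} \<and>
     (\<forall>m::nat. \<exists>B. \<forall>z. \<bar>Im z\<bar> < \<rho> \<longrightarrow> (1 + \<bar>Re z\<bar>) ^ m * norm (u z) \<le> B))"

lemma strip_eq: "{z. \<bar>Im z\<bar> < \<rho>} = {z. - \<rho> < Im z} \<inter> {z. Im z < \<rho>}"
  by auto

lemma open_strip: "open {z. \<bar>Im z\<bar> < \<rho>}"
  unfolding strip_eq by (intro open_Int open_halfspace_Im_gt open_halfspace_Im_lt)

lemma strip_rapid_deriv:
  assumes "strip_rapid u"
  shows "strip_rapid (deriv u)"
proof -
  obtain \<rho> where \<rho>: "\<rho> > 0" and hol: "u holomorphic_on {z. \<bar>Im z\<bar> < \<rho>}"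
    and bd: "\<And>m::nat. \<exists>B. \<forall>z. \<bar>Im z\<bar> < \<rho> \<longrightarrow> (1 + \<bar>Re z\<bar>) ^ m * norm (u z) \<le> B"
    using assms unfolding strip_rapid_def by blast
  define r where "r = \<rho> / 2"
  have r: "r > 0" using \<rho> by (simp add: r_def)
  show ?thesis unfolding strip_rapid_def
  proof (rule exI[of _ "\<rho> / 2"], intro conjI allI)
    show "\<rho> / 2 > 0" using \<rho> by simp
    show "deriv u holomorphic_on {z. \<bar>Im z\<bar> < \<rho> / 2}"
      by (rule holomorphic_on_subset[OF holomorphic_deriv[OF hol open_strip]]) (use \<rho> in auto)
    fix m :: nat
    obtain B where B: "\<And>z. \<bar>Im z\<bar> < \<rho> \<Longrightarrow> (1 + \<bar>Re z\<bar>) ^ m * norm (u z) \<le> B"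
      using bd[of m] by blast
    show "\<exists>B. \<forall>z. \<bar>Im z\<bar> < \<rho> / 2 \<longrightarrow> (1 + \<bar>Re z\<bar>) ^ m * norm (deriv u z) \<le> B"
    proof (intro exI allI impI)
      fix z assume z: "\<bar>Im z\<bar> < \<rho> / 2"
      have near: "\<bar>Im w\<bar> < \<rho> \<and> \<bar>Re z\<bar> \<le> r + \<bar>Re w\<bar>" if "norm (z - w) \<le> r" for w
        using abs_Im_le_cmod[of "z - w"] abs_Re_le_cmod[of "z - w"] that z by (auto simp: r_def abs_if split: if_splits)
      have sub: "cball z r \<subseteq> {z. \<bar>Im z\<bar> < \<rho>}" using near by (auto simp: dist_norm)
      \<comment> \<open>A bound for \<open>u\<close> on the circle of radius \<open>r\<close> around
        \<open>z\<close>; replacing \<open>Re w\<close> by \<open>Re z\<close> in the weight costs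
        the factor \<open>(1 + r) ^ m\<close>.\<close>
      define S where "S = (1 + r) ^ m * B / (1 + \<bar>Re z\<bar>) ^ m"
      have "norm ((deriv ^^ 1) u z) \<le> fact 1 * S / r ^ 1"
      proof (rule Cauchy_inequality[OF _ _ r])
        show "u holomorphic_on ball z r"
          by (rule holomorphic_on_subset[OF hol]) (use sub in \<open>auto simp: subset_eq\<close>)
        show "continuous_on (cball z r) u"
          by (rule continuous_on_subset[OF holomorphic_on_imp_continuous_on[OF hol] sub])
      next
        fix w assume "norm (z - w) = r"
        then have w: "\<bar>Im w\<bar> < \<rho>" "\<bar>Re z\<bar> \<le> r + \<bar>Re w\<bar>" using near[of w] by auto
        have "1 + \<bar>Re z\<bar> \<le> (1 + r) * (1 + \<bar>Re w\<bar>)"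
        proof -
          have "0 \<le> r * \<bar>Re w\<bar>" using r by simp
          then show ?thesis using w(2) by (simp add: algebra_simps)
        qed
        then have "(1 + \<bar>Re z\<bar>) ^ m \<le> ((1 + r) * (1 + \<bar>Re w\<bar>)) ^ m"
          by (intro power_mono) auto
        then have "(1 + \<bar>Re z\<bar>) ^ m * norm (u w) \<le> ((1 + r) * (1 + \<bar>Re w\<bar>)) ^ m * norm (u w)"
          by (rule mult_right_mono) simp
        also have "\<dots> = (1 + r) ^ m * ((1 + \<bar>Re w\<bar>) ^ m * norm (u w))"
          by (simp add: power_mult_distrib)
        also have "\<dots> \<le> (1 + r) ^ m * B"
          using r by (intro mult_left_mono B w) auto
        finally show "norm (u w) \<le> S" by (simp add: S_def field_simps)
      qed

      then have "(1 + \<bar>Re z\<bar>) ^ m * norm (deriv u z) \<le> (1 + \<bar>Re z\<bar>) ^ m * (S / r)"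
        by (intro mult_left_mono) auto
      also have "\<dots> = (1 + r) ^ m * B / r"
      proof -
        have "(1 + \<bar>Re z\<bar>) ^ m \<noteq> 0" by (simp add: add_nonneg_eq_0_iff)
        then show ?thesis by (simp add: S_def)
      qed
      finally show "(1 + \<bar>Re z\<bar>) ^ m * norm (deriv u z) \<le> (1 + r) ^ m * B / r" .
    qed
  qed
qed

lemma strip_rapid_has_derivative:
  assumes "strip_rapid u"
  shows "(u has_field_derivative deriv u (of_real t)) (at (of_real t))"
  using assms open_strip unfolding strip_rapid_def
  by (elim exE conjE) (rule holomorphic_derivI, auto)

text \<open>Only the constant and linear terms of the expanded product are kept; they give 1 plus
  the \<open>l1\<close> norm. Weights in \<open>norm x\<close> thus split over the
  coordinates.\<close>

lemma one_plus_norm_le_prod: "1 + norm (x::real^'n) \<le> (\<Prod>j\<in>UNIV. 1 + \<bar>x $ j\<bar>)"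
proof -
  have "1 + (\<Sum>j\<in>A. \<bar>x $ j\<bar>) \<le> (\<Prod>j\<in>A. 1 + \<bar>x $ j\<bar>)" if "finite A" for A
    using that
  proof induction
    case (insert a A)
    have "0 \<le> \<bar>x $ a\<bar> * (\<Sum>j\<in>A. \<bar>x $ j\<bar>)" by (simp add: sum_nonneg)
    then have "1 + (\<Sum>j\<in>insert a A. \<bar>x $ j\<bar>) \<le> (1 + \<bar>x $ a\<bar>) * (1 + (\<Sum>j\<in>A. \<bar>x $ j\<bar>))"
      using insert by (simp add: algebra_simps)
    also have "\<dots> \<le> (1 + \<bar>x $ a\<bar>) * (\<Prod>j\<in>A. 1 + \<bar>x $ j\<bar>)"
      using insert.IH by (intro mult_left_mono) auto
    finally show ?case using insert by simp
  qed simp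
  from this[of UNIV] show ?thesis using norm_le_l1_cart[of x] by simp
qed

lemma power_one_plus_norm_prod_le:
  fixes x :: "real^'n"
  assumes "\<And>j. (1 + \<bar>x $ j\<bar>) ^ m * norm (v j) \<le> K j"
  shows "(1 + norm x) ^ m * norm (\<Prod>j\<in>UNIV. v j :: complex) \<le> (\<Prod>j\<in>UNIV. K j)"
proof -
  have "(1 + norm x) ^ m * norm (\<Prod>j\<in>UNIV. v j) \<le> (\<Prod>j\<in>UNIV. 1 + \<bar>x $ j\<bar>) ^ m * norm (\<Prod>j\<in>UNIV. v j)"
    by (intro mult_right_mono power_mono one_plus_norm_le_prod) auto
  also have "\<dots> = (\<Prod>j\<in>UNIV. (1 + \<bar>x $ j\<bar>) ^ m * norm (v j))"
    by (simp add: prod.distrib prod_norm prod_power_distrib)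
  also have "\<dots> \<le> (\<Prod>j\<in>UNIV. K j)"
    using assms by (intro prod_mono) auto
  finally show ?thesis .
qed

section \<open>Products of one-variable functions as Schwartz functions\<close>

lemma has_derivative_prod_coordinates:
  fixes v :: "'n::finite \<Rightarrow> complex \<Rightarrow> complex"
  assumes v: "\<And>j. strip_rapid (v j)"
  shows "((\<lambda>x::real^'n. \<Prod>j\<in>UNIV. v j (of_real (x $ j))) has_derivative
     (\<lambda>w. \<Sum>i\<in>UNIV. (deriv (v i) (of_real (x $ i)) * of_real (w $ i)) * (\<Prod>j\<in>UNIV - {i}. v j (of_real (x $ j))))) (at x)"
proof (rule has_derivative_prod)
  fix i
  have "((\<lambda>x::real^'n. complex_of_real (x $ i)) has_derivative (\<lambda>w. of_real (w $ i))) (at x)"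
    by (intro bounded_linear_imp_has_derivative bounded_linear_compose[OF bounded_linear_of_real bounded_linear_vec_nth])
  from has_derivative_compose[OF this strip_rapid_has_derivative[OF v[of i], unfolded has_field_derivative_def]]
  show "((\<lambda>x. v i (of_real (x $ i))) has_derivative (\<lambda>w. deriv (v i) (of_real (x $ i)) * of_real (w $ i))) (at x)"
    by simp
qed

lemma partial_deriv_prod_coordinates:
  fixes v :: "'n::finite \<Rightarrow> complex \<Rightarrow> complex"
  assumes v: "\<And>j. strip_rapid (v j)"
  shows "partial_deriv k (\<lambda>x::real^'n. \<Prod>j\<in>UNIV. v j (of_real (x $ j)))
    = (\<lambda>x. \<Prod>j\<in>UNIV. (if j = k then deriv (v j) else v j) (of_real (x $ j)))"
proof
  fix x :: "real^'n"
  have "partial_deriv k (\<lambda>x::real^'n. \<Prod>j\<in>UNIV. v j (of_real (x $ j))) x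
      = (\<Sum>i\<in>UNIV. (deriv (v i) (of_real (x $ i)) * of_real (axis k 1 $ i)) * (\<Prod>j\<in>UNIV - {i}. v j (of_real (x $ j))))"
    unfolding partial_deriv_def frechet_derivative_at[OF has_derivative_prod_coordinates[OF v], symmetric] ..
  also have "\<dots> = deriv (v k) (of_real (x $ k)) * (\<Prod>j\<in>UNIV - {k}. v j (of_real (x $ j)))"
    by (subst sum.remove[of _ k]) (auto simp: axis_def)
  also have "\<dots> = (\<Prod>j\<in>UNIV. (if j = k then deriv (v j) else v j) (of_real (x $ j)))"
    by (subst prod.remove[of _ k]) auto
  finally show "partial_deriv k (\<lambda>x::real^'n. \<Prod>j\<in>UNIV. v j (of_real (x $ j))) x
    = (\<Prod>j\<in>UNIV. (if j = k then deriv (v j) else v j) (of_real (x $ j)))" .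
qed

text \<open>Products of \<open>strip_rapid\<close> factors are closed under partial derivatives, so
  one induction gives all iterated derivatives the same form and the decay estimate is needed only
  once.\<close>

lemma schwartz_prod_coordinates:
  fixes u :: "'n::finite \<Rightarrow> complex \<Rightarrow> complex"
  assumes u: "\<And>j. strip_rapid (u j)"
  shows "schwartz (\<lambda>x::real^'n. \<Prod>j\<in>UNIV. u j (of_real (x $ j)))"
proof -
  have it: "\<exists>v. (\<forall>j. strip_rapid (v j)) \<and>
      iter_partial js (\<lambda>x::real^'n. \<Prod>j\<in>UNIV. u j (of_real (x $ j))) = (\<lambda>x. \<Prod>j\<in>UNIV. v j (of_real (x $ j)))" for js
  proof (induction js)
    case Nil
    then show ?case using u by auto
  next
    case (Cons k js)
    then obtain v where v: "\<And>j. strip_rapid (v j)"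
      "iter_partial js (\<lambda>x::real^'n. \<Prod>j\<in>UNIV. u j (of_real (x $ j))) = (\<lambda>x. \<Prod>j\<in>UNIV. v j (of_real (x $ j)))"
      by blast
    then show ?case
      by (intro exI[of _ "\<lambda>j. if j = k then deriv (v j) else v j"])
        (auto simp: partial_deriv_prod_coordinates strip_rapid_deriv)
  qed
  show ?thesis unfolding schwartz_def
  proof (intro allI conjI)
    fix js :: "'n list" and x :: "real^'n"
    obtain v where v: "\<And>j. strip_rapid (v j)"
      "iter_partial js (\<lambda>x::real^'n. \<Prod>j\<in>UNIV. u j (of_real (x $ j))) = (\<lambda>x. \<Prod>j\<in>UNIV. v j (of_real (x $ j)))"
      using it by blast
    show "iter_partial js (\<lambda>x. \<Prod>j\<in>UNIV. u j (of_real (x $ j))) differentiable at x"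
      unfolding v(2) differentiable_def using has_derivative_prod_coordinates[of v, OF v(1)] by blast
    fix m :: nat
    have "\<exists>B. \<forall>t::real. (1 + \<bar>t\<bar>) ^ m * norm (v j (of_real t)) \<le> B" for j
    proof -
      obtain \<rho> where \<rho>: "\<rho> > 0" "\<exists>B. \<forall>z. \<bar>Im z\<bar> < \<rho> \<longrightarrow> (1 + \<bar>Re z\<bar>) ^ m * norm (v j z) \<le> B"
        using v(1)[of j] unfolding strip_rapid_def by blast
      then obtain B where B: "\<And>z. \<bar>Im z\<bar> < \<rho> \<Longrightarrow> (1 + \<bar>Re z\<bar>) ^ m * norm (v j z) \<le> B" by blast
      show ?thesis using B[of "of_real _"] \<rho>(1) by auto
    qed
    then obtain K where "\<And>j (t::real). (1 + \<bar>t\<bar>) ^ m * norm (v j (of_real t)) \<le> K j" by metis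
    then show "\<exists>B. \<forall>x. (1 + norm x) ^ m * norm (iter_partial js (\<lambda>x. \<Prod>j\<in>UNIV. u j (of_real (x $ j))) x) \<le> B"
      unfolding v(2) by (intro exI[of _ "\<Prod>j\<in>UNIV. K j"] allI power_one_plus_norm_prod_le)
  qed
qed

text \<open>The common integrable majorant, chosen as a product so that its integrability is
  one-dimensional.\<close>

definition decay :: "real^'n \<Rightarrow> real" where
  "decay x = (\<Prod>j\<in>UNIV. inverse (1 + (x $ j)\<^sup>2))"

lemma decay_pos: "0 < decay x"
  unfolding decay_def by (intro prod_pos) (auto simp: add_pos_nonneg)

lemma decay_le_1: "decay x \<le> 1"
  unfolding decay_def by (intro prod_le_1) (auto simp: field_simps add_pos_nonneg)

lemma integrable_decay: "integrable lborel (decay :: real^'n \<Rightarrow> real)"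
proof -
  have "integrable lborel (\<lambda>t::real. inverse (1 + t\<^sup>2))"
    using integrable_inverse_1_plus_square by (simp add: set_integrable_def einterval_def)
  from has_bochner_integral_prod_coordinates[of "\<lambda>_ t. inverse (1 + t\<^sup>2)", OF this]
  show ?thesis by (auto simp: has_bochner_integral_iff decay_def[abs_def])
qed

text \<open>The two extra powers in each coordinate pay for the factor of
  \<open>decay\<close>.\<close>

lemma power_norm_prod_le_decay:
  fixes x :: "real^'n"
  assumes K: "\<And>j. (1 + \<bar>x $ j\<bar>) ^ (m + 2) * norm (v j) \<le> K j"
  shows "(1 + norm x) ^ m * norm (\<Prod>j\<in>UNIV. v j :: complex) \<le> (\<Prod>j\<in>UNIV. K j) * decay x"
proof -
  have "(1 + \<bar>x $ j\<bar>) ^ m * norm (v j) \<le> K j * inverse (1 + (x $ j)\<^sup>2)" for j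
  proof -
    have "1 + (x $ j)\<^sup>2 \<le> (1 + \<bar>x $ j\<bar>)\<^sup>2" by (simp add: power2_sum)
    then have "(1 + \<bar>x $ j\<bar>) ^ m * norm (v j) * (1 + (x $ j)\<^sup>2) \<le> (1 + \<bar>x $ j\<bar>) ^ m * norm (v j) * (1 + \<bar>x $ j\<bar>)\<^sup>2"
      by (intro mult_left_mono) auto
    also have "\<dots> \<le> K j" using K[of j] by (simp add: power_add power2_eq_square mult_ac)
    finally show ?thesis by (simp add: field_simps add_pos_nonneg)
  qed
  from power_one_plus_norm_prod_le[OF this] show ?thesis
    by (simp add: decay_def prod.distrib)
qed


section \<open>The Poisson kernel of a cone\<close>

lemma closed_dual_cone: "closed (dual_cone C)"
proof -
  have "dual_cone C = (\<Inter>y\<in>C. {t. t \<bullet> y \<ge> 0})" by (auto simp: dual_cone_def)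
  moreover have "closed {t. t \<bullet> y \<ge> 0}" for y :: "real^'n"
    by (intro closed_Collect_le continuous_intros)
  ultimately show ?thesis by auto
qed

lemma dual_cone_add: "s \<in> dual_cone C \<Longrightarrow> t \<in> dual_cone C \<Longrightarrow> s + t \<in> dual_cone C"
  by (simp add: dual_cone_def inner_add_left)

text \<open>As \<open>y\<close> is interior, it stays in \<open>C\<close> when moved slightly
  against the signs of \<open>\<eta>\<close>; pairing \<open>\<eta>\<close> with the moved point
  gives the coercive bound.\<close>

lemma open_inner_dual_cone_ge:
  fixes C :: "(real^'n) set"
  assumes "open C" "y \<in> C"
  shows "\<exists>c>0. \<forall>\<eta>\<in>dual_cone C. c * (\<Sum>j\<in>UNIV. \<bar>\<eta> $ j\<bar>) \<le> y \<bullet> \<eta>"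
proof -
  obtain e where e: "e > 0" "ball y e \<subseteq> C" using assms by (auto simp: open_contains_ball)
  \<comment> \<open>The sign vector \<open>w\<close> has norm at most \<open>CARD('n)\<close>, so
    \<open>c *\<^sub>R w\<close> is shorter than \<open>e\<close>.\<close>
  define c where "c = e / (2 * real CARD('n))"
  have c: "c > 0" using e by (simp add: c_def)
  show ?thesis
  proof (intro exI[of _ c] conjI ballI c)
    fix \<eta> :: "real^'n" assume \<eta>: "\<eta> \<in> dual_cone C"
    define w where "w = (\<chi> j. sgn (\<eta> $ j))"
    have "norm w \<le> (\<Sum>j\<in>UNIV. \<bar>w $ j\<bar>)" by (rule norm_le_l1_cart)
    also have "\<dots> \<le> (\<Sum>j\<in>(UNIV::'n set). 1)" by (intro sum_mono) (auto simp: w_def abs_sgn_eq)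
    finally have "norm w \<le> real CARD('n)" by simp
    then have "c * norm w \<le> c * real CARD('n)" using c by (intro mult_left_mono) auto
    also have "\<dots> < e" using e by (simp add: c_def)
    finally have "y - c *\<^sub>R w \<in> ball y e" using c by (simp add: dist_norm)
    then have "y - c *\<^sub>R w \<in> C" using e by blast
    then have "0 \<le> \<eta> \<bullet> (y - c *\<^sub>R w)" using \<eta> by (simp add: dual_cone_def)

    moreover have "\<eta> \<bullet> w = (\<Sum>j\<in>UNIV. \<bar>\<eta> $ j\<bar>)"
      unfolding inner_vec_def w_def by (intro sum.cong) (auto simp: abs_sgn)
    ultimately show "c * (\<Sum>j\<in>UNIV. \<bar>\<eta> $ j\<bar>) \<le> y \<bullet> \<eta>"
      by (simp add: inner_diff_right inner_commute)
  qed
qed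

text \<open>The modulus of the integrand of the Cauchy kernel at a point with imaginary part
  \<open>y\<close>, extended by 0 off the dual cone. Its Fourier transform at \<open>- x\<close> is
  the kernel at \<open>x + iy\<close>.\<close>

definition cone_exp :: "(real^'n) set \<Rightarrow> real^'n \<Rightarrow> real^'n \<Rightarrow> real" where
  "cone_exp C y \<eta> = indicator (dual_cone C) \<eta> * exp (- (2 * pi * (y \<bullet> \<eta>)))"

lemma cone_exp_nonneg: "0 \<le> cone_exp C y \<eta>"
  by (simp add: cone_exp_def)

lemma borel_measurable_cone_exp[measurable]: "cone_exp C y \<in> borel_measurable borel"
proof -
  have [measurable]: "dual_cone C \<in> sets borel" using closed_dual_cone by (rule borel_closed)
  show ?thesis unfolding cone_exp_def by measurable
qed

lemma cone_exp_power2: "(cone_exp C y \<eta>)\<^sup>2 = cone_exp C (2 *\<^sub>R y) \<eta>"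
  by (simp add: cone_exp_def power_mult_distrib indicator_def flip: exp_double)

lemma cone_exp_le_decay:
  fixes C :: "(real^'n) set"
  assumes "open C" "y \<in> C"
  shows "\<exists>K. \<forall>\<eta>. cone_exp C y \<eta> \<le> K * decay \<eta>"
proof -
  obtain c where c: "c > 0" "\<And>\<eta>. \<eta> \<in> dual_cone C \<Longrightarrow> c * (\<Sum>j\<in>UNIV. \<bar>\<eta> $ j\<bar>) \<le> y \<bullet> \<eta>"
    using open_inner_dual_cone_ge[OF assms] by blast
  define \<kappa> where "\<kappa> = 2 * pi * c"
  have \<kappa>: "\<kappa> > 0" using c by (simp add: \<kappa>_def)
  \<comment> \<open>The constant comes from the quadratic term of the exponential series,
    \<open>s^2 / 2 \<le> exp s\<close> at \<open>s = \<kappa> * \<bar>t\<bar>\<close>.\<close>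
  have one: "exp (- (\<kappa> * \<bar>t\<bar>)) \<le> (1 + 2 / \<kappa>\<^sup>2) * inverse (1 + t\<^sup>2)" for t
  proof -
    have "t\<^sup>2 \<le> 2 / \<kappa>\<^sup>2 * exp (\<kappa> * \<bar>t\<bar>)"
      using power_div_fact_le_exp[of "\<kappa> * \<bar>t\<bar>" 2] \<kappa> by (simp add: field_simps power_mult_distrib)
    moreover have "1 \<le> exp (\<kappa> * \<bar>t\<bar>)" using \<kappa> by simp
    ultimately have "1 + t\<^sup>2 \<le> (1 + 2 / \<kappa>\<^sup>2) * exp (\<kappa> * \<bar>t\<bar>)"
      unfolding distrib_right by linarith
    then have "(1 + t\<^sup>2) * exp (- (\<kappa> * \<bar>t\<bar>)) \<le> (1 + 2 / \<kappa>\<^sup>2) * exp (\<kappa> * \<bar>t\<bar>) * exp (- (\<kappa> * \<bar>t\<bar>))"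
      by (rule mult_right_mono) simp
    also have "\<dots> = 1 + 2 / \<kappa>\<^sup>2" by (simp add: mult.assoc flip: exp_add)
    finally have "(1 + t\<^sup>2) * exp (- (\<kappa> * \<bar>t\<bar>)) \<le> 1 + 2 / \<kappa>\<^sup>2" .
    moreover have "1 + t\<^sup>2 > 0" by (simp add: add_pos_nonneg)
    ultimately show ?thesis
      unfolding divide_inverse[symmetric] by (subst pos_le_divide_eq) (simp_all add: mult.commute)

  qed
  show ?thesis
  proof (intro exI[of _ "(1 + 2 / \<kappa>\<^sup>2) ^ CARD('n)"] allI)
    fix \<eta> :: "real^'n"
    show "cone_exp C y \<eta> \<le> (1 + 2 / \<kappa>\<^sup>2) ^ CARD('n) * decay \<eta>"
    proof (cases "\<eta> \<in> dual_cone C")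
      case True
      have "2 * pi * (c * (\<Sum>j\<in>UNIV. \<bar>\<eta> $ j\<bar>)) \<le> 2 * pi * (y \<bullet> \<eta>)"
        using c(2)[OF True] by (intro mult_left_mono) auto
      then have "cone_exp C y \<eta> \<le> exp (- (2 * pi * (c * (\<Sum>j\<in>UNIV. \<bar>\<eta> $ j\<bar>))))"
        using True by (simp add: cone_exp_def)
      also have "\<dots> = (\<Prod>j\<in>UNIV. exp (- (\<kappa> * \<bar>\<eta> $ j\<bar>)))"
        by (simp add: \<kappa>_def sum_distrib_left sum_negf mult.assoc flip: exp_sum)
      also have "\<dots> \<le> (\<Prod>j\<in>UNIV. (1 + 2 / \<kappa>\<^sup>2) * inverse (1 + (\<eta> $ j)\<^sup>2))"
        by (intro prod_mono conjI one) auto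
      also have "\<dots> = (1 + 2 / \<kappa>\<^sup>2) ^ CARD('n) * decay \<eta>"
        by (simp add: prod.distrib decay_def)
      finally show ?thesis .
    qed (simp add: cone_exp_def decay_pos less_imp_le)
  qed
qed

lemma integrable_cone_exp:
  assumes "open C" "y \<in> C"
  shows "integrable lborel (cone_exp C y)"
proof -
  obtain K where K: "\<And>\<eta>. cone_exp C y \<eta> \<le> K * decay \<eta>"
    using cone_exp_le_decay[OF assms] by blast
  have I: "integrable lborel (\<lambda>\<eta>::real^'a. K * decay \<eta>)"
    by (rule integrable_mult_right) (rule integrable_decay)
  show ?thesis
    by (rule Bochner_Integration.integrable_bound[OF I])
      (use K in \<open>auto simp: cone_exp_nonneg intro: order_trans[OF _ abs_ge_self]\<close>)
qed

section \<open>The Cauchy and Poisson kernels as Fourier transforms\<close>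

lemma exp_tube_pt:
  "exp (2 * complex_of_real pi * \<i> * (\<Sum>j\<in>UNIV. tube_pt x y $ j * complex_of_real (\<eta> $ j)))
    = cis (2 * pi * (x \<bullet> \<eta>)) * of_real (exp (- (2 * pi * (y \<bullet> \<eta>))))"
proof -
  have "(\<Sum>j\<in>UNIV. tube_pt x y $ j * complex_of_real (\<eta> $ j)) = of_real (x \<bullet> \<eta>) + \<i> * of_real (y \<bullet> \<eta>)"
    unfolding inner_vec_def
    by (simp add: tube_pt_nth distrib_right sum.distrib sum_distrib_left mult.assoc)
  then have "2 * complex_of_real pi * \<i> * (\<Sum>j\<in>UNIV. tube_pt x y $ j * complex_of_real (\<eta> $ j))
      = \<i> * of_real (2 * pi * (x \<bullet> \<eta>)) + of_real (- (2 * pi * (y \<bullet> \<eta>)))"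
    by (simp add: distrib_left mult_ac)
  then show ?thesis
    by (simp only: exp_add cis_conv_exp exp_of_real)
qed

lemma cauchy_kernel_tube_pt:
  "cauchy_kernel C (tube_pt x y) = fourier (\<lambda>\<eta>. of_real (cone_exp C y \<eta>)) (- x)"
proof -
  have eq: "indicator (dual_cone C) \<eta> *\<^sub>R exp (2 * complex_of_real pi * \<i> * (\<Sum>j\<in>UNIV. tube_pt x y $ j * complex_of_real (\<eta> $ j)))
      = cis (- (2 * pi * (\<eta> \<bullet> - x))) * of_real (cone_exp C y \<eta>)" for \<eta>
    unfolding exp_tube_pt by (simp add: cone_exp_def scaleR_conv_of_real inner_commute mult_ac)
  show ?thesis
    unfolding cauchy_kernel_def set_lebesgue_integral_def eq fourier_def
    by (rule integral_completion) measurable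
qed

text \<open>This is \<open>K(2iy)\<close>, because squaring the exponential doubles
  \<open>y\<close>. As a squared \<open>L2\<close> norm it is the right-hand side of Bessel's
  inequality.\<close>

definition cone_mass :: "(real^'n) set \<Rightarrow> real^'n \<Rightarrow> real" where
  "cone_mass C y = (LINT \<eta>|lborel. (cone_exp C y \<eta>)\<^sup>2)"

text \<open>The Poisson kernel as a real convolution kernel: \<open>u\<close> stands for
  \<open>x - t\<close>.\<close>

definition poisson :: "(real^'n) set \<Rightarrow> real^'n \<Rightarrow> real^'n \<Rightarrow> real" where
  "poisson C y u = (cmod (fourier (\<lambda>\<eta>. of_real (cone_exp C y \<eta>)) (- u)))\<^sup>2 / cone_mass C y"

lemma tube_pt_diff_cvec: "tube_pt x y - cvec t = tube_pt (x - t) y"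
  by (simp add: vec_eq_iff tube_pt_nth cvec_nth)

lemma Im_vec_tube_pt: "Im_vec (tube_pt x y) = y"
  by (simp add: Im_vec_def vec_eq_iff tube_pt_nth)

lemma poisson_kernel_tube_pt:
  "poisson_kernel C (tube_pt x y) t = of_real (poisson C y (x - t))"
proof -
  have "(2 * \<i>) *s cvec y = tube_pt 0 (2 *\<^sub>R y)"
    by (simp add: vec_eq_iff tube_pt_nth cvec_nth)
  then have "cauchy_kernel C ((2 * \<i>) *s cvec y) = fourier (\<lambda>\<eta>. of_real (cone_exp C (2 *\<^sub>R y) \<eta>)) 0"
    by (simp add: cauchy_kernel_tube_pt)
  also have "\<dots> = of_real (cone_mass C y)"
    by (simp add: fourier_def cone_mass_def cone_exp_power2)
  finally show ?thesis
    by (simp add: poisson_kernel_def tube_pt_diff_cvec Im_vec_tube_pt cauchy_kernel_tube_pt poisson_def)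
qed

lemma borel_measurable_poisson[measurable]: "poisson C y \<in> borel_measurable borel"
  unfolding poisson_def by measurable

text \<open>The signs \<open>sg\<close> record an orthant containing \<open>C\<close>; they tell
  \<open>damp\<close> on which side of each coordinate it has to be bounded.\<close>

locale orthant_cone =
  fixes C :: "(real^'n) set" and sg :: "'n \<Rightarrow> real"
  assumes open_C: "open C" and cone_C: "is_cone C"
    and sg: "\<And>j. \<bar>sg j\<bar> = 1"
    and C_sg: "\<And>y j. y \<in> C \<Longrightarrow> 0 < sg j * y $ j"
begin

lemma scaleR_C: "y \<in> C \<Longrightarrow> 0 < s \<Longrightarrow> s *\<^sub>R y \<in> C"
  using cone_C by (auto simp: is_cone_def)

lemma integrable_cone_exp_power2:
  assumes y: "y \<in> C"
  shows "integrable lborel (\<lambda>\<eta>. (cone_exp C y \<eta>)\<^sup>2)"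
  unfolding cone_exp_power2 by (rule integrable_cone_exp[OF open_C]) (rule scaleR_C[OF y], simp)

text \<open>The dual cone contains the open orthant, so it is not a null set.\<close>

lemma cone_mass_pos:
  assumes y: "y \<in> C"
  shows "0 < cone_mass C y"
proof -
  define U where "U = {\<eta>::real^'n. \<forall>j. 0 < sg j * \<eta> $ j}"
  have U: "U \<subseteq> dual_cone C"
  proof
    fix \<eta> assume \<eta>: "\<eta> \<in> U"
    have "0 \<le> \<eta> $ j * w $ j" if "w \<in> C" for w j
    proof -
      have "0 < (sg j * \<eta> $ j) * (sg j * w $ j)"
        using \<eta> C_sg[OF that, of j] unfolding U_def by (intro mult_pos_pos[of "sg j * \<eta> $ j"]) auto

      also have "\<dots> = (sg j)\<^sup>2 * (\<eta> $ j * w $ j)" by (simp add: power2_eq_square)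
      also have "(sg j)\<^sup>2 = 1" using sg[of j] by (metis power2_abs one_power2)
      finally show ?thesis by simp
    qed
    then show "\<eta> \<in> dual_cone C" by (simp add: dual_cone_def inner_vec_def sum_nonneg)
  qed
  have "open U"
  proof -
    have "U = (\<Inter>j\<in>UNIV. {\<eta>. 0 < sg j * \<eta> $ j})" by (auto simp: U_def)
    moreover have "open {\<eta>::real^'n. 0 < sg j * \<eta> $ j}" for j
      by (intro open_Collect_less continuous_intros)
    ultimately show ?thesis by (auto intro: open_INT)
  qed
  moreover have "(\<chi> j. sg j) \<in> U"
    using sg by (auto simp: U_def zero_less_mult_iff) (metis abs_zero linorder_neqE_linordered_idom zero_neq_one)
  ultimately have "\<not> negligible U" using open_not_negligible by blast
  have nonneg: "0 \<le> cone_mass C y" unfolding cone_mass_def by (rule Bochner_Integration.integral_nonneg) simp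

  have "cone_mass C y \<noteq> 0"
  proof
    assume "cone_mass C y = 0"
    then have "AE \<eta> in lborel. (cone_exp C y \<eta>)\<^sup>2 = 0"
      unfolding cone_mass_def using integrable_cone_exp_power2[OF y]
      by (subst (asm) integral_nonneg_eq_0_iff_AE) auto
    then have "AE \<eta> in lborel. \<eta> \<notin> U"
      using U by (auto simp: cone_exp_def elim!: eventually_mono)
    then have "U \<in> null_sets lebesgue"
      using \<open>open U\<close> by (subst null_sets_completion_iff) (auto simp: AE_iff_null_sets)
    then show False using \<open>\<not> negligible U\<close> negligible_iff_null_sets by blast
  qed
  with nonneg show ?thesis by simp
qed

lemma poisson_nonneg: "y \<in> C \<Longrightarrow> 0 \<le> poisson C y u"
  using cone_mass_pos by (simp add: poisson_def less_imp_le)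

text \<open>A Fourier transform is bounded by the \<open>L1\<close> norm. This allows integrable
  functions to be paired with the kernel, bounded ones being covered by
  \<open>integrable_poisson\<close>.\<close>

lemma poisson_le:
  assumes y: "y \<in> C"
  shows "poisson C y u \<le> (LINT \<eta>|lborel. cone_exp C y \<eta>)\<^sup>2 / cone_mass C y"
  unfolding poisson_def
proof (rule divide_right_mono[OF power_mono])
  show "cmod (fourier (\<lambda>\<eta>. of_real (cone_exp C y \<eta>)) (- u)) \<le> (LINT \<eta>|lborel. cone_exp C y \<eta>)"
    using norm_fourier_le[of "\<lambda>\<eta>. of_real (cone_exp C y \<eta>)" "- u"] by (simp add: cone_exp_nonneg)
qed (use cone_mass_pos[OF y] in auto)

text \<open>The numerator of the kernel is the squared transform of \<open>cone_exp C y\<close>, the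
  denominator the squared \<open>L2\<close> norm of the same function.\<close>

lemma nn_integral_poisson_le:
  assumes y: "y \<in> C"
  shows "(\<integral>\<^sup>+ u. ennreal (poisson C y (x - u)) \<partial>lborel) \<le> 1"
proof -
  let ?k = "\<lambda>u. (cmod (fourier (\<lambda>\<eta>. of_real (cone_exp C y \<eta>)) u))\<^sup>2"
  have m: "0 < cone_mass C y" by (rule cone_mass_pos[OF y])
  have "(\<integral>\<^sup>+ u. ennreal (poisson C y (x - u)) \<partial>lborel) = (\<integral>\<^sup>+ u. ennreal (1 / cone_mass C y) * ennreal (?k (- x + 1 *\<^sub>R u)) \<partial>lborel)"
    using m by (intro nn_integral_cong) (simp add: poisson_def flip: ennreal_mult)
  also have "\<dots> = ennreal (1 / cone_mass C y) * (\<integral>\<^sup>+ u. ennreal (?k (- x + 1 *\<^sub>R u)) \<partial>lborel)"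
    by (rule nn_integral_cmult) measurable
  also have "(\<integral>\<^sup>+ u. ennreal (?k (- x + 1 *\<^sub>R u)) \<partial>lborel) = (\<integral>\<^sup>+ u. ennreal (?k u) \<partial>lborel)"
    using nn_integral_lborel_affine[of 1 "\<lambda>u. ennreal (?k u)" "- x"] by simp
  also have "\<dots> \<le> ennreal (cone_mass C y)"
    unfolding cone_mass_def
    by (rule fourier_Bessel[OF integrable_cone_exp[OF open_C y] cone_exp_nonneg integrable_cone_exp_power2[OF y]])
  finally have "(\<integral>\<^sup>+ u. ennreal (poisson C y (x - u)) \<partial>lborel) \<le> ennreal (1 / cone_mass C y) * ennreal (cone_mass C y)"
    by (simp add: mult_left_mono)
  also have "\<dots> = 1" using m by (simp flip: ennreal_mult)
  finally show ?thesis .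
qed

lemma
  assumes y: "y \<in> C"
  shows integrable_poisson: "integrable lborel (\<lambda>u. poisson C y (x - u))"
    and integral_poisson_le_1: "(LINT u|lborel. poisson C y (x - u)) \<le> 1"
proof -
  show I: "integrable lborel (\<lambda>u. poisson C y (x - u))"
  proof (rule integrableI_nonneg)
    show "(\<integral>\<^sup>+ u. ennreal (poisson C y (x - u)) \<partial>lborel) < \<infinity>"
      using nn_integral_poisson_le[OF y, of x] by (rule order.strict_trans1) simp
  qed (auto simp: poisson_nonneg[OF y])
  have "ennreal (LINT u|lborel. poisson C y (x - u)) \<le> 1"
    using nn_integral_poisson_le[OF y, of x] nn_integral_eq_integral[OF I] by (simp add: poisson_nonneg[OF y])
  then show "(LINT u|lborel. poisson C y (x - u)) \<le> 1"
    by (simp add: ennreal_le_1)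
qed

end


section \<open>The Poisson representation of scalar functions\<close>

definition wave :: "real \<Rightarrow> complex \<Rightarrow> complex" where
  "wave \<eta> z = exp (- (2 * complex_of_real pi * \<i> * of_real \<eta> * z))"

lemma norm_wave: "norm (wave \<eta> z) = exp (2 * pi * (Im z * \<eta>))"
  by (simp add: wave_def mult_ac)

lemma strip_rapid_damp_exp:
  assumes c: "c \<noteq> 0"
  shows "strip_rapid (\<lambda>z. damp c z * wave \<eta> z)"
proof -
  \<comment> \<open>Half the distance from the real axis to the branch point
    \<open>- \<i> / c\<close> of the square root.\<close>
  define \<rho> where "\<rho> = 1 / (2 * \<bar>c\<bar>)"
  have \<rho>: "\<rho> > 0" using c by (simp add: \<rho>_def)
  have dom: "1 / 2 \<le> 1 + c * Im z" if "\<bar>Im z\<bar> < \<rho>" for z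
  proof -
    have "\<bar>c * Im z\<bar> \<le> \<bar>c\<bar> * \<rho>" unfolding abs_mult using that by (intro mult_left_mono) auto
    also have "\<dots> = 1 / 2" using c by (simp add: \<rho>_def)
    finally show ?thesis by linarith
  qed
  show ?thesis unfolding strip_rapid_def
  proof (rule exI[of _ \<rho>], intro conjI allI \<rho>)
    show "(\<lambda>z. damp c z * wave \<eta> z) holomorphic_on {z. \<bar>Im z\<bar> < \<rho>}"
      unfolding wave_def by (intro holomorphic_intros holomorphic_on_subset[OF damp_holomorphic]) (use dom in force)
    fix m :: nat
    obtain K where K: "\<And>z. 1 / 2 \<le> 1 + c * Im z \<Longrightarrow> (1 + \<bar>Re z\<bar>) ^ m * norm (damp c z) \<le> K"
      using damp_rapid[OF c, of m] by blast
    show "\<exists>B. \<forall>z. \<bar>Im z\<bar> < \<rho> \<longrightarrow> (1 + \<bar>Re z\<bar>) ^ m * norm (damp c z * wave \<eta> z) \<le> B"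
    proof (intro exI allI impI)
      fix z assume z: "\<bar>Im z\<bar> < \<rho>"
      have k: "(1 + \<bar>Re z\<bar>) ^ m * norm (damp c z) \<le> K" by (rule K[OF dom[OF z]])
      have k0: "0 \<le> K" by (rule order_trans[OF _ k]) simp
      have "Im z * \<eta> \<le> \<rho> * \<bar>\<eta>\<bar>"
        by (rule order_trans[OF abs_ge_self]) (use z in \<open>auto simp: abs_mult intro!: mult_right_mono\<close>)
      then have "exp (2 * pi * (Im z * \<eta>)) \<le> exp (2 * pi * (\<rho> * \<bar>\<eta>\<bar>))"
        by (subst exp_le_cancel_iff) (intro mult_left_mono, auto)
      with k have "(1 + \<bar>Re z\<bar>) ^ m * norm (damp c z) * exp (2 * pi * (Im z * \<eta>)) \<le> K * exp (2 * pi * (\<rho> * \<bar>\<eta>\<bar>))"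
        by (rule mult_mono) (use k0 in auto)
      then show "(1 + \<bar>Re z\<bar>) ^ m * norm (damp c z * wave \<eta> z) \<le> K * exp (2 * pi * (\<rho> * \<bar>\<eta>\<bar>))"
        unfolding norm_mult[of "damp c z"] norm_wave by (simp add: mult.assoc)
    qed
  qed
qed

text \<open>The scalar problem, with every hypothesis in the form it takes along single rays of
  \<open>C\<close>. The bound \<open>\<beta> + g\<close> replaces membership in a particular
  \<open>L^p\<close>.\<close>

locale tube_boundary = orthant_cone C sg
  for C :: "(real^'n) set" and sg +
  fixes F :: "complex^'n \<Rightarrow> complex" and h :: "real^'n \<Rightarrow> complex" and R :: nat and \<beta> :: real and g :: "real^'n \<Rightarrow> real"
  assumes F_hol: "\<And>x y. y \<in> C \<Longrightarrow> (\<lambda>\<zeta>. F (cvec x + \<zeta> *s cvec y)) holomorphic_on {\<zeta>. 0 < Im \<zeta>}"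
    and F_cont: "\<And>x y. y \<in> C \<Longrightarrow> isCont F (tube_pt x y)"
    and F_bound: "\<And>y r. y \<in> C \<Longrightarrow> r > 0 \<Longrightarrow>
      \<exists>M. \<forall>x s. s \<ge> r \<longrightarrow> norm (F (tube_pt x (s *\<^sub>R y))) \<le> M * (1 + norm x) ^ R"
    and h_meas[measurable]: "h \<in> borel_measurable borel"
    and h_bound: "AE t in lborel. norm (h t) \<le> \<beta> + g t"
    and g_int: "integrable lborel g" and g_nonneg: "\<And>t. 0 \<le> g t" and \<beta>: "0 \<le> \<beta>"
    and boundary: "\<And>\<phi> y. schwartz \<phi> \<Longrightarrow> y \<in> C \<Longrightarrow>
      ((\<lambda>\<epsilon>. LINT x|lborel. F (tube_pt x (\<epsilon> *\<^sub>R y)) * \<phi> x) \<longlongrightarrow> (LINT x|lborel. h x * \<phi> x)) (at_right 0)"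
begin

definition reg :: "real \<Rightarrow> complex^'n \<Rightarrow> complex" where
  "reg d z = (\<Prod>j\<in>UNIV. damp (d * sg j) (z $ j))"

text \<open>\<open>reg d\<close> times \<open>exp (-2 pi i <z, \<eta>>)\<close>, distributed over
  the coordinates so that \<open>schwartz_prod_coordinates\<close> applies at real points.\<close>

definition test :: "real \<Rightarrow> real^'n \<Rightarrow> complex^'n \<Rightarrow> complex" where
  "test d \<eta> z = (\<Prod>j\<in>UNIV. damp (d * sg j) (z $ j) * wave (\<eta> $ j) (z $ j))"

lemma sg_nz: "sg j \<noteq> 0"
  using sg[of j] by auto

lemma test_tube_pt:
  "test d \<eta> (tube_pt x y) = reg d (tube_pt x y) * (cis (- (2 * pi * (x \<bullet> \<eta>))) * of_real (exp (2 * pi * (y \<bullet> \<eta>))))"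
proof -
  have "(\<Prod>j\<in>UNIV. exp (- (2 * complex_of_real pi * \<i> * of_real (\<eta> $ j) * (tube_pt x y $ j))))
      = exp (\<Sum>j\<in>UNIV. - (2 * complex_of_real pi * \<i> * of_real (\<eta> $ j) * (tube_pt x y $ j)))"
    by (simp add: exp_sum)
  also have "(\<Sum>j\<in>UNIV. - (2 * complex_of_real pi * \<i> * of_real (\<eta> $ j) * (tube_pt x y $ j)))
      = 2 * complex_of_real pi * \<i> * (\<Sum>j\<in>UNIV. tube_pt x y $ j * complex_of_real ((- \<eta>) $ j))"
    by (simp add: sum_distrib_left sum_negf mult_ac)
  finally show ?thesis
    unfolding test_def wave_def reg_def prod.distrib exp_tube_pt by simp
qed

lemma isCont_reg:
  assumes "\<And>j. 0 < 1 + d * sg j * Im (z $ j)"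
  shows "isCont (reg d) z"
proof -
  have "isCont (\<lambda>z. damp (d * sg j) (z $ j)) z" for j
    by (rule isCont_o2[where g = "damp (d * sg j)"]) (auto intro!: isCont_damp assms continuous_intros)
  then show ?thesis unfolding reg_def isCont_def by (intro tendsto_prod) auto
qed

lemma isCont_test:
  assumes "\<And>j. 0 < 1 + d * sg j * Im (z $ j)"
  shows "isCont (test d \<eta>) z"
proof -
  have "isCont (\<lambda>z. damp (d * sg j) (z $ j)) z" for j
    by (rule isCont_o2[where g = "damp (d * sg j)"]) (auto intro!: isCont_damp assms continuous_intros)
  then have "isCont (\<lambda>z. damp (d * sg j) (z $ j) * wave (\<eta> $ j) (z $ j)) z" for j
    unfolding wave_def by (intro continuous_intros)
  then show ?thesis unfolding test_def isCont_def by (intro tendsto_prod) auto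
qed

text \<open>The same \<open>K\<close> serves all \<open>y\<close> in the closed orthant; this
  uniformity is what allows the base point to go to infinity later.\<close>

lemma reg_bound:
  assumes d: "d > 0"
  shows "\<exists>K\<ge>0. \<forall>x y. (\<forall>j. 0 \<le> sg j * y $ j) \<longrightarrow> (1 + norm x) ^ m * norm (reg d (tube_pt x y)) \<le> K * decay x"
proof -
  have "\<forall>j. \<exists>K. \<forall>z. 1 / 2 \<le> 1 + (d * sg j) * Im z \<longrightarrow> (1 + \<bar>Re z\<bar>) ^ (m + 2) * norm (damp (d * sg j) z) \<le> K"
    by (intro allI damp_rapid) (use d sg_nz in simp)
  then obtain K where K: "\<And>j z. 1 / 2 \<le> 1 + (d * sg j) * Im z \<Longrightarrow> (1 + \<bar>Re z\<bar>) ^ (m + 2) * norm (damp (d * sg j) z) \<le> K j"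
    by metis
  have K0: "0 \<le> K j" for j
    by (rule order_trans[OF _ K[of j 0]]) simp_all

  show ?thesis
  proof (intro exI[of _ "\<Prod>j\<in>UNIV. K j"] conjI allI impI)
    show "0 \<le> (\<Prod>j\<in>UNIV. K j)" using K0 by (intro prod_nonneg) auto
    fix x y :: "real^'n" assume y: "\<forall>j. 0 \<le> sg j * y $ j"
    show "(1 + norm x) ^ m * norm (reg d (tube_pt x y)) \<le> (\<Prod>j\<in>UNIV. K j) * decay x"
      unfolding reg_def
    proof (rule power_norm_prod_le_decay)
      fix j
      have "0 \<le> d * (sg j * y $ j)" using y d by (simp add: mult_nonneg_nonneg)
      then show "(1 + \<bar>x $ j\<bar>) ^ (m + 2) * norm (damp (d * sg j) (tube_pt x y $ j)) \<le> K j"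
        using K[of j "tube_pt x y $ j"] by (simp add: tube_pt_nth mult.assoc)
    qed
  qed
qed

lemma norm_reg_le_1:
  assumes d: "d > 0" and y: "\<And>j. 0 \<le> sg j * y $ j"
  shows "norm (reg d (tube_pt x y)) \<le> 1"
  unfolding reg_def prod_norm[symmetric]
proof (rule prod_le_1)
  fix j
  have "0 \<le> d * (sg j * y $ j)" using y[of j] d by (simp add: mult_nonneg_nonneg)
  then show "0 \<le> norm (damp (d * sg j) (tube_pt x y $ j)) \<and> norm (damp (d * sg j) (tube_pt x y $ j)) \<le> 1"
    by (intro conjI norm_damp_le_1) (auto simp: tube_pt_nth mult.assoc)
qed

lemma tube_pt_0: "tube_pt x 0 = cvec x"
  by (simp add: vec_eq_iff tube_pt_nth cvec_nth)

lemma schwartz_test: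
  assumes d: "d > 0"
  shows "schwartz (\<lambda>x. test d \<eta> (cvec x))"
  unfolding test_def cvec_nth
  by (rule schwartz_prod_coordinates) (use d sg_nz in \<open>auto intro!: strip_rapid_damp_exp\<close>)

text \<open>The contour shift along the ray through \<open>y\<close>, with the boundary value
  hypothesis as its starting point at height 0.\<close>

lemma integral_test_shift:
  assumes d: "d > 0" and y: "y \<in> C"
  shows "(LINT t|lborel. h t * test d \<eta> (cvec t)) = (LINT x|lborel. F (tube_pt x y) * test d \<eta> (tube_pt x y))"
proof -
  define S where "S = (\<Sum>j\<in>UNIV. d * sg j * y $ j)"
  have pos: "0 < d * sg j * y $ j" for j using C_sg[OF y, of j] d by (simp add: mult.assoc)
  have S: "d * sg j * y $ j \<le> S" for j
    unfolding S_def by (rule member_le_sum) (auto intro: less_imp_le pos)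
  have S0: "0 < S" using pos S less_le_trans by blast
  \<comment> \<open>Small enough that \<open>a * S \<le> 1 / 2\<close>, which keeps the margin
    \<open>1 / 2\<close> of \<open>damp_rapid\<close> in every coordinate at heights above
    \<open>- a\<close>; also \<open>a \<le> 1\<close>, so heights between \<open>- a\<close> and 2
    have modulus at most 2.\<close>
  define a where "a = 1 / (2 * (1 + S))"
  have a: "a > 0" "a \<le> 1" using S0 by (auto simp: a_def field_simps)
  have aS: "a * S \<le> 1 / 2" using S0 by (auto simp: a_def field_simps)
  have dom: "1 / 2 \<le> 1 + d * sg j * (s * y $ j)" if "- a < s" for s j
  proof -
    have "(- a) * (d * sg j * y $ j) \<le> s * (d * sg j * y $ j)"
      using that pos[of j] by (intro mult_right_mono) auto
    moreover have "a * (d * sg j * y $ j) \<le> a * S" using a S[of j] by (intro mult_left_mono) auto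
    ultimately show ?thesis using aS by (simp add: mult_ac)
  qed
  have "\<forall>j. \<exists>K. \<forall>z. 1 / 2 \<le> 1 + (d * sg j) * Im z \<longrightarrow> (1 + \<bar>Re z\<bar>) ^ (R + 2) * norm (damp (d * sg j) z) \<le> K"
    by (intro allI damp_rapid) (use d sg_nz in simp)
  then obtain K where K: "\<And>j z. 1 / 2 \<le> 1 + (d * sg j) * Im z \<Longrightarrow> (1 + \<bar>Re z\<bar>) ^ (R + 2) * norm (damp (d * sg j) z) \<le> K j"
    by metis
  \<comment> \<open>The exponential bounds \<open>wave\<close> at all heights of modulus at most
    2.\<close>
  define K' where "K' j = K j * exp (2 * pi * (2 * \<bar>y $ j * \<eta> $ j\<bar>))" for j
  show ?thesis
  proof (rule boundary_value_shift[where F = F and \<phi> = "test d \<eta>" and y = y and a = a and R = R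
        and B = "\<lambda>x. (\<Prod>j\<in>UNIV. K' j) * decay x"])
    show "(\<lambda>\<zeta>. F (cvec x + \<zeta> *s cvec y)) holomorphic_on {\<zeta>. 0 < Im \<zeta>}" for x by (rule F_hol[OF y])
    show "isCont F (tube_pt x (s *\<^sub>R y))" if "0 < s" for x s by (rule F_cont[OF scaleR_C[OF y that]])
    show "\<exists>M. \<forall>x s. s \<ge> r \<longrightarrow> norm (F (tube_pt x (s *\<^sub>R y))) \<le> M * (1 + norm x) ^ R" if "r > 0" for r
      by (rule F_bound[OF y that])
    show "isCont (test d \<eta>) (tube_pt x (s *\<^sub>R y))" if "- a < s" for x s
    proof (rule isCont_test)
      fix j show "0 < 1 + d * sg j * Im (tube_pt x (s *\<^sub>R y) $ j)"
        using dom[OF that, of j] by (simp add: tube_pt_nth)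
    qed
    show "(\<lambda>\<zeta>. test d \<eta> (cvec x + \<zeta> *s cvec y)) holomorphic_on {\<zeta>. - a < Im \<zeta>}" for x
    proof -
      have "(\<lambda>\<zeta>. damp (d * sg j) ((cvec x + \<zeta> *s cvec y) $ j)) holomorphic_on {\<zeta>. - a < Im \<zeta>}" for j
        by (rule holomorphic_on_compose_gen[OF _ damp_holomorphic, unfolded o_def])
          (use dom[of _ j] in \<open>force simp: cvec_nth mult_ac intro!: holomorphic_intros\<close>)+
      then show ?thesis
        unfolding test_def wave_def by (intro holomorphic_intros) (auto simp: cvec_nth intro!: holomorphic_intros)
    qed
    show "(1 + norm x) ^ R * norm (test d \<eta> (tube_pt x (s *\<^sub>R y))) \<le> (\<Prod>j\<in>UNIV. K' j) * decay x"
      if s: "- a < s" "s < 2" for x s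
      unfolding test_def
    proof (rule power_norm_prod_le_decay)
      fix j
      let ?z = "tube_pt x (s *\<^sub>R y) $ j"
      have "(1 + \<bar>Re ?z\<bar>) ^ (R + 2) * norm (damp (d * sg j) ?z) \<le> K j"
        using dom[OF s(1), of j] by (intro K) (simp add: tube_pt_nth)
      then have k: "(1 + \<bar>x $ j\<bar>) ^ (R + 2) * norm (damp (d * sg j) ?z) \<le> K j"
        by (simp add: tube_pt_nth)
      have k0: "0 \<le> K j" by (rule order_trans[OF _ k]) simp
      have "s * (y $ j * \<eta> $ j) \<le> 2 * \<bar>y $ j * \<eta> $ j\<bar>"
        by (rule order_trans[OF abs_ge_self]) (use s a in \<open>auto simp: abs_mult intro!: mult_right_mono\<close>)
      then have "exp (2 * pi * (s * (y $ j * \<eta> $ j))) \<le> exp (2 * pi * (2 * \<bar>y $ j * \<eta> $ j\<bar>))"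
        by (subst exp_le_cancel_iff) (intro mult_left_mono, auto)
      with k have "(1 + \<bar>x $ j\<bar>) ^ (R + 2) * norm (damp (d * sg j) ?z) * exp (2 * pi * (s * (y $ j * \<eta> $ j))) \<le> K' j"
        unfolding K'_def by (rule mult_mono) (use k0 in auto)
      then show "(1 + \<bar>x $ j\<bar>) ^ (R + 2) * norm (damp (d * sg j) ?z *
          wave (\<eta> $ j) ?z) \<le> K' j"
        unfolding norm_mult[of "damp _ _"] norm_wave by (simp add: tube_pt_nth mult.assoc)
    qed
    show "integrable lborel (\<lambda>x. (\<Prod>j\<in>UNIV. K' j) * decay x)"
      by (rule integrable_mult_right) (rule integrable_decay)
    show "((\<lambda>\<epsilon>. LINT x|lborel. F (tube_pt x (\<epsilon> *\<^sub>R y)) * test d \<eta> (cvec x)) \<longlongrightarrow> (LINT t|lborel. h t * test d \<eta> (cvec t))) (at_right 0)"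
      by (rule boundary[OF schwartz_test[OF d] y])
  qed (rule a)
qed

section \<open>Fourier analysis of the regularised boundary function\<close>

definition hreg :: "real \<Rightarrow> real^'n \<Rightarrow> complex" where
  "hreg d t = h t * reg d (cvec t)"

definition Freg :: "real \<Rightarrow> real^'n \<Rightarrow> real^'n \<Rightarrow> complex" where
  "Freg d y x = F (tube_pt x y) * reg d (tube_pt x y)"

lemma isCont_reg_tube_pt:
  assumes "d > 0" "\<And>j. 0 \<le> sg j * y $ j"
  shows "isCont (reg d) (tube_pt x y)"
proof (rule isCont_reg)
  fix j
  have "0 \<le> d * (sg j * y $ j)" using assms(1) assms(2)[of j] by (simp add: mult_nonneg_nonneg)
  then show "0 < 1 + d * sg j * Im (tube_pt x y $ j)" by (simp add: tube_pt_nth mult.assoc)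
qed

lemma continuous_on_tube_pt_compose:
  assumes "\<And>x. isCont G (tube_pt x y)"
  shows "continuous_on UNIV (\<lambda>x. G (tube_pt x y))"
proof (rule continuous_on_compose2[of "range (\<lambda>x. tube_pt x y)" G])
  show "continuous_on (range (\<lambda>x. tube_pt x y)) G"
    using assms by (intro continuous_at_imp_continuous_on) auto
  show "continuous_on UNIV (\<lambda>x. tube_pt x y)" by (intro continuous_intros)
qed auto

lemma borel_measurable_reg_cvec:
  assumes "d > 0"
  shows "(\<lambda>t. reg d (cvec t)) \<in> borel_measurable borel"
  unfolding tube_pt_0[symmetric]
  by (intro borel_measurable_continuous_onI continuous_on_tube_pt_compose isCont_reg_tube_pt assms) simp

lemma norm_reg_cvec_le_1: "d > 0 \<Longrightarrow> norm (reg d (cvec t)) \<le> 1"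
  unfolding tube_pt_0[symmetric] by (rule norm_reg_le_1) simp_all

lemma integrable_hreg:
  assumes d: "d > 0"
  shows "integrable lborel (hreg d)"
proof -
  note borel_measurable_reg_cvec[OF d, measurable]
  obtain K where K: "K \<ge> 0" "\<And>x y. (\<forall>j. 0 \<le> sg j * y $ j) \<Longrightarrow> (1 + norm x) ^ 0 * norm (reg d (tube_pt x y)) \<le> K * decay x"
    using reg_bound[OF d, of 0] by blast
  have Kd: "norm (reg d (cvec t)) \<le> K * decay t" for t
    using K(2)[of 0 t] by (simp add: tube_pt_0)
  \<comment> \<open>The constant \<open>\<beta>\<close> needs the decay of \<open>reg d\<close>; the
    integrable \<open>g\<close> needs only its bound 1.\<close>
  have "integrable lborel (\<lambda>t. \<beta> * (K * decay t) + g t)"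
    by (intro Bochner_Integration.integrable_add integrable_mult_right integrable_decay g_int)
  then show ?thesis
  proof (rule Bochner_Integration.integrable_bound)
    show "hreg d \<in> borel_measurable lborel" unfolding hreg_def[abs_def] by measurable
    show "AE t in lborel. norm (hreg d t) \<le> norm (\<beta> * (K * decay t) + g t)"
      using h_bound
    proof eventually_elim
      case (elim t)
      have "norm (hreg d t) \<le> (\<beta> + g t) * norm (reg d (cvec t))"
        unfolding hreg_def norm_mult using elim by (rule mult_right_mono) simp
      also have "\<dots> \<le> \<beta> * (K * decay t) + g t * 1"
        unfolding distrib_right using Kd[of t] norm_reg_cvec_le_1[OF d, of t] \<beta> g_nonneg[of t]
        by (intro add_mono mult_left_mono) auto
      finally show ?case by (simp add: abs_le_iff)
    qed
  qed
qed

text \<open>The weight in \<open>reg_bound\<close> absorbs the polynomial growth of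
  \<open>F\<close>. Both estimates are uniform in \<open>s \<ge> 1\<close>, hence so is the
  resulting majorant.\<close>

lemma Freg_bound:
  assumes d: "d > 0" and y: "y \<in> C"
  shows "\<exists>N\<ge>0. \<forall>s\<ge>1. \<forall>x. norm (Freg d (s *\<^sub>R y) x) \<le> N * decay x"
proof -
  obtain K where K: "K \<ge> 0" "\<And>x y. (\<forall>j. 0 \<le> sg j * y $ j) \<Longrightarrow> (1 + norm x) ^ R * norm (reg d (tube_pt x y)) \<le> K * decay x"
    using reg_bound[OF d, of R] by blast
  obtain M where M: "\<And>x s. s \<ge> 1 \<Longrightarrow> norm (F (tube_pt x (s *\<^sub>R y))) \<le> M * (1 + norm x) ^ R"
    using F_bound[OF y, of 1] by auto
  show ?thesis
  proof (intro exI[of _ "\<bar>M\<bar> * K"] conjI allI impI)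
    show "0 \<le> \<bar>M\<bar> * K" using K by simp
    fix s :: real and x assume s: "s \<ge> 1"
    have sy: "s *\<^sub>R y \<in> C" using scaleR_C[OF y] s by simp
    have "norm (Freg d (s *\<^sub>R y) x) \<le> M * (1 + norm x) ^ R * norm (reg d (tube_pt x (s *\<^sub>R y)))"
      unfolding Freg_def norm_mult by (intro mult_right_mono M s) simp
    also have "\<dots> \<le> \<bar>M\<bar> * ((1 + norm x) ^ R * norm (reg d (tube_pt x (s *\<^sub>R y))))"
      unfolding mult.assoc by (intro mult_right_mono) auto
    also have "\<dots> \<le> \<bar>M\<bar> * (K * decay x)"
      using C_sg[OF sy] by (intro mult_left_mono K) (auto simp: less_imp_le)
    finally show "norm (Freg d (s *\<^sub>R y) x) \<le> \<bar>M\<bar> * K * decay x" by simp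
  qed
qed

lemma continuous_Freg:
  assumes d: "d > 0" and y: "y \<in> C"
  shows "continuous_on UNIV (Freg d y)"
  unfolding Freg_def[abs_def]
  using F_cont[OF y] C_sg[OF y]
  by (intro continuous_on_mult continuous_on_tube_pt_compose isCont_reg_tube_pt d) (auto intro: less_imp_le)

lemma integrable_Freg:
  assumes d: "d > 0" and y: "y \<in> C"
  shows "integrable lborel (Freg d y)"
proof -
  obtain N where N: "\<And>s x. s \<ge> 1 \<Longrightarrow> norm (Freg d (s *\<^sub>R y) x) \<le> N * decay x"
    using Freg_bound[OF assms] by blast
  have I: "integrable lborel (\<lambda>x::real^'n. N * decay x)"
    by (rule integrable_mult_right) (rule integrable_decay)
  show ?thesis
  proof (rule Bochner_Integration.integrable_bound[OF I])
    show "Freg d y \<in> borel_measurable lborel"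
      using borel_measurable_continuous_onI[OF continuous_Freg[OF assms]] by simp
    show "AE x in lborel. norm (Freg d y x) \<le> norm (N * decay x)"
      using N[of 1] by (intro AE_I2) (auto intro: order_trans[OF _ abs_ge_self])
  qed
qed

text \<open>The shifted integral with the exponential of the height taken out. The left side does
  not involve \<open>y\<close>, so transforms at different base points are all tied to one
  function.\<close>

lemma fourier_hreg:
  assumes d: "d > 0" and y: "y \<in> C"
  shows "fourier (hreg d) \<eta> = of_real (exp (2 * pi * (y \<bullet> \<eta>))) * fourier (Freg d y) \<eta>"
proof -
  have "fourier (hreg d) \<eta> = (LINT t|lborel. h t * test d \<eta> (cvec t))"
    unfolding fourier_def hreg_def tube_pt_0[symmetric] test_tube_pt by (simp add: mult_ac)
  also have "\<dots> = (LINT x|lborel. of_real (exp (2 * pi * (y \<bullet> \<eta>))) * (cis (- (2 * pi * (x \<bullet> \<eta>))) * Freg d y x))"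
    unfolding integral_test_shift[OF assms] test_tube_pt Freg_def by (simp add: mult_ac)
  also have "\<dots> = of_real (exp (2 * pi * (y \<bullet> \<eta>))) * fourier (Freg d y) \<eta>"
    unfolding fourier_def by (rule integral_mult_right_zero)
  finally show ?thesis .
qed

text \<open>Letting the base point tend to infinity along a ray on which \<open>\<eta>\<close> is negative kills the
  Fourier transform outside the dual cone.\<close>

lemma fourier_hreg_eq_0:
  assumes d: "d > 0" and \<eta>: "\<eta> \<notin> dual_cone C"
  shows "fourier (hreg d) \<eta> = 0"
proof -
  obtain y where y: "y \<in> C" "\<eta> \<bullet> y < 0" using \<eta> by (auto simp: dual_cone_def not_le)
  define q where "q = exp (2 * pi * (y \<bullet> \<eta>))"
  have "2 * pi * (y \<bullet> \<eta>) < 0" using y by (simp add: mult_pos_neg inner_commute)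
  then have q: "0 < q" "q < 1" by (auto simp: q_def)
  obtain N where N: "\<And>s x. s \<ge> 1 \<Longrightarrow> norm (Freg d (s *\<^sub>R y) x) \<le> N * decay x"
    using Freg_bound[OF d y(1)] by blast
  have I: "integrable lborel (\<lambda>x::real^'n. N * decay x)"
    by (rule integrable_mult_right) (rule integrable_decay)
  define N' where "N' = (LINT x::real^'n|lborel. N * decay x)"
  have le: "norm (fourier (hreg d) \<eta>) \<le> q ^ Suc i * N'" for i
  proof -
    \<comment> \<open>\<open>Suc i\<close> keeps the multiple of \<open>y\<close> at 1 or above,
      where the uniform bound holds.\<close>
    have sy: "real (Suc i) *\<^sub>R y \<in> C" using scaleR_C[OF y(1)] by simp
    have "norm (fourier (hreg d) \<eta>) = q ^ Suc i * norm (fourier (Freg d (real (Suc i) *\<^sub>R y)) \<eta>)"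
    proof -
      have "exp (2 * pi * ((real (Suc i) *\<^sub>R y) \<bullet> \<eta>)) = q ^ Suc i"
        unfolding q_def exp_of_nat_mult[symmetric] by (simp add: mult_ac)
      then show ?thesis
        unfolding fourier_hreg[OF d sy] norm_mult norm_of_real using q by simp

    qed
    also have "\<dots> \<le> q ^ Suc i * N'"
    proof (rule mult_left_mono)
      have "norm (fourier (Freg d (real (Suc i) *\<^sub>R y)) \<eta>) \<le> (LINT x|lborel. norm (Freg d (real (Suc i) *\<^sub>R y) x))"
        by (rule norm_fourier_le)
      also have "\<dots> \<le> N'"
        unfolding N'_def by (rule integral_mono[OF integrable_norm[OF integrable_Freg[OF d sy]] I]) (rule N, simp)
      finally show "norm (fourier (Freg d (real (Suc i) *\<^sub>R y)) \<eta>) \<le> N'" .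
    qed (use q in simp)
    finally show ?thesis .
  qed
  have "(\<lambda>i. q ^ Suc i * N') \<longlonglongrightarrow> 0 * N'"
    using q by (intro tendsto_intros LIMSEQ_Suc[OF LIMSEQ_power_zero]) auto
  then have "norm (fourier (hreg d) \<eta>) \<le> 0"
    using le by (intro LIMSEQ_le_const[of _ "0"]) auto
  then show ?thesis by simp
qed

text \<open>On the dual cone the two exponentials cancel; off it both sides vanish by
  \<open>fourier_hreg_eq_0\<close>, which justifies the indicator inside
  \<open>cone_exp\<close>.\<close>

lemma fourier_Freg:
  assumes d: "d > 0" and v: "v \<in> C"
  shows "fourier (Freg d v) \<eta> = of_real (cone_exp C v \<eta>) * fourier (hreg d) \<eta>"
proof (cases "\<eta> \<in> dual_cone C")
  case True
  have "of_real (cone_exp C v \<eta>) * fourier (hreg d) \<eta>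
      = of_real (exp (- (2 * pi * (v \<bullet> \<eta>))) * exp (2 * pi * (v \<bullet> \<eta>))) * fourier (Freg d v) \<eta>"
    unfolding fourier_hreg[OF assms] using True by (simp add: cone_exp_def)
  also have "\<dots> = fourier (Freg d v) \<eta>" by (simp flip: exp_add)
  finally show ?thesis by simp
next
  case False
  then have "fourier (hreg d) \<eta> = 0" by (rule fourier_hreg_eq_0[OF d])
  then show ?thesis using fourier_hreg[OF assms, of \<eta>] by simp
qed

lemma Freg_inversion:
  assumes d: "d > 0" and v: "v \<in> C"
  shows "(LINT \<eta>|lborel. cis (2 * pi * (u \<bullet> \<eta>)) * (of_real (cone_exp C v \<eta>) * fourier (hreg d) \<eta>)) = Freg d v u"
proof -
  obtain N where N: "N \<ge> 0" "\<And>s x. s \<ge> 1 \<Longrightarrow> norm (Freg d (s *\<^sub>R v) x) \<le> N * decay x"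
    using Freg_bound[OF assms] by blast
  have bd: "norm (Freg d v x) \<le> N" for x
  proof -
    have "norm (Freg d v x) \<le> N * decay x" using N(2)[of 1 x] by simp
    also have "\<dots> \<le> N * 1" using N(1) decay_le_1 by (intro mult_left_mono) auto
    finally show ?thesis by simp
  qed
  \<comment> \<open>Passing through the base point \<open>v / 2\<close> spends half of the
    exponential decay: the transform at \<open>v\<close> is the transform at \<open>w\<close>, which
    is bounded, times the integrable \<open>cone_exp C w\<close>.\<close>
  define w where "w = (1/2::real) *\<^sub>R v"
  have w: "w \<in> C" unfolding w_def by (rule scaleR_C[OF v]) simp
  define N' where "N' = (LINT x|lborel. norm (Freg d w x))"
  have I: "integrable lborel (\<lambda>\<eta>. cone_exp C w \<eta> * N')"
    using integrable_cone_exp[OF open_C w] by simp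
  have "integrable lborel (fourier (Freg d v))"
  proof (rule Bochner_Integration.integrable_bound[OF I])
    show "fourier (Freg d v) \<in> borel_measurable lborel"
      using borel_measurable_fourier[OF borel_measurable_continuous_onI[OF continuous_Freg[OF assms]]] by simp
    show "AE \<eta> in lborel. norm (fourier (Freg d v) \<eta>) \<le> norm (cone_exp C w \<eta> * N')"
    proof (rule AE_I2)
      fix \<eta>
      have "norm (fourier (Freg d v) \<eta>) = cone_exp C v \<eta> * exp (2 * pi * (w \<bullet> \<eta>)) * norm (fourier (Freg d w) \<eta>)"
        unfolding fourier_Freg[OF assms] fourier_hreg[OF d w] norm_mult by (simp add: cone_exp_nonneg)
      also have "cone_exp C v \<eta> * exp (2 * pi * (w \<bullet> \<eta>)) = cone_exp C w \<eta>"
        by (simp add: cone_exp_def w_def indicator_def flip: exp_add)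
      also have "\<dots> * norm (fourier (Freg d w) \<eta>) \<le> \<dots> * N'"
        unfolding N'_def by (intro mult_left_mono norm_fourier_le cone_exp_nonneg)
      finally show "norm (fourier (Freg d v) \<eta>) \<le> norm (cone_exp C w \<eta> * N')" by (simp add: abs_le_iff)
    qed
  qed
  from fourier_inversion[OF integrable_Freg[OF assms] continuous_Freg[OF assms] bd this, of u]
  show ?thesis unfolding fourier_Freg[OF assms] .
qed

lemma cone_exp_add:
  "\<xi> \<in> dual_cone C \<Longrightarrow> \<sigma> \<in> dual_cone C \<Longrightarrow> cone_exp C v (\<xi> + \<sigma>) = cone_exp C v \<xi> * cone_exp C v \<sigma>"
  by (simp add: cone_exp_def dual_cone_add inner_add_right distrib_left flip: exp_add)

text \<open>Expanding the square of the modulus of the Cauchy kernel as a double integral over the dual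
  cone, the substitution \<open>\<eta> = \<xi> + \<sigma>\<close> separates the variables, because the Fourier transform of
  \<open>hreg d\<close> lives on the dual cone and this cone is closed under addition.\<close>

lemma hreg_poisson:
  assumes d: "d > 0" and v: "v \<in> C"
  shows "(LINT t|lborel. hreg d t * of_real (poisson C v (u - t))) = Freg d v u"
proof -
  let ?P = "\<lambda>t. complex_of_real (poisson C v (u - t))"
  let ?H = "fourier (hreg d)"
  have [measurable]: "hreg d \<in> borel_measurable borel"
    using borel_measurable_integrable[OF integrable_hreg[OF d]] by simp
  \<comment> \<open>The modulation by \<open>u\<close> makes the transform of \<open>a\<close> at
    \<open>t\<close> the Cauchy kernel at the point with real part \<open>u - t\<close> and
    imaginary part \<open>v\<close>.\<close>
  define a where "a \<eta> = cis (2 * pi * (\<eta> \<bullet> u)) * complex_of_real (cone_exp C v \<eta>)" for \<eta>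
  have [measurable]: "a \<in> borel_measurable borel" unfolding a_def by measurable
  have ai: "integrable lborel a"
    unfolding a_def by (intro integrable_cis_mult integrable_of_real integrable_cone_exp[OF open_C v]) measurable
  have aic: "integrable lborel (\<lambda>\<eta>. cnj (a \<eta>))" using ai by simp
  have bi: "integrable lborel (\<lambda>\<eta>. cnj (a (- \<eta>)))"
    using integrable_reflect[OF aic, of 0] by simp
  have fa: "fourier a t = fourier (\<lambda>\<eta>. of_real (cone_exp C v \<eta>)) (- (u - t))" for t
    unfolding a_def fourier_modulation by simp
  \<comment> \<open>The conjugate kernel times \<open>hreg d\<close>, so that
    \<open>fourier a t * m t\<close> is the squared modulus of the kernel times
    \<open>hreg d t\<close>.\<close>
  define m where "m t = fourier (\<lambda>\<eta>. cnj (a (- \<eta>))) t * hreg d t" for t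
  have cn: "cnj (fourier a t) = fourier (\<lambda>\<eta>. cnj (a (- \<eta>))) t" for t
    by (rule cnj_fourier) measurable
  have mi: "integrable lborel m"
  proof -
    have I: "integrable lborel (\<lambda>t. (LINT \<eta>|lborel. norm (a \<eta>)) * norm (hreg d t))"
      by (intro integrable_mult_right integrable_norm integrable_hreg d)
    show ?thesis
    proof (rule Bochner_Integration.integrable_bound[OF I])
      have "m = (\<lambda>t. cnj (fourier a t) * hreg d t)" by (simp add: m_def cn fun_eq_iff)
      moreover have "(\<lambda>t. cnj (fourier a t)) \<in> borel_measurable borel"
        using borel_measurable_fourier[of a]
        by (rule borel_measurable_continuous_onI[THEN measurable_compose[rotated], OF continuous_on_cnj[OF continuous_on_id]]) measurable
      ultimately show "m \<in> borel_measurable lborel" by simp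
      show "AE t in lborel. norm (m t) \<le> norm ((LINT \<eta>|lborel. norm (a \<eta>)) * norm (hreg d t))"
        by (intro AE_I2) (auto simp: m_def cn[symmetric] norm_mult abs_mult
          intro!: mult_right_mono norm_fourier_le)
    qed
  qed
  have mh: "fourier m \<eta> = (LINT \<xi>|lborel. cnj (a \<xi>) * ?H (\<eta> - \<xi>))" for \<eta>
    unfolding m_def fourier_fourier_mult[OF bi integrable_hreg[OF d]] by simp
  have Hb: "norm (?H \<eta>) \<le> (LINT t|lborel. norm (hreg d t))" for \<eta> by (rule norm_fourier_le)
  have I2: "integrable (lborel \<Otimes>\<^sub>M lborel) (\<lambda>(\<eta>, \<xi>). a \<eta> * cnj (a \<xi>) * ?H (\<eta> - \<xi>))"
  proof (rule Bochner_Integration.integrable_bound)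
    show "integrable (lborel \<Otimes>\<^sub>M lborel) (\<lambda>p. (case p of (\<eta>, \<xi>) \<Rightarrow> a \<eta> * cnj (a \<xi>)) * of_real (LINT t|lborel. norm (hreg d t)))"
      by (intro integrable_mult_left integrable_prod_mult ai aic)
    have "(\<lambda>\<eta>. cnj (a \<eta>)) \<in> borel_measurable borel"
      using borel_measurable_integrable[OF aic] by simp
    then show "(\<lambda>(\<eta>, \<xi>). a \<eta> * cnj (a \<xi>) * ?H (\<eta> - \<xi>)) \<in> borel_measurable (lborel \<Otimes>\<^sub>M lborel)"
      by measurable
    show "AE p in lborel \<Otimes>\<^sub>M lborel. norm (case p of (\<eta>, \<xi>) \<Rightarrow> a \<eta> * cnj (a \<xi>) * ?H (\<eta> - \<xi>))
        \<le> norm ((case p of (\<eta>, \<xi>) \<Rightarrow> a \<eta> * cnj (a \<xi>)) * complex_of_real (LINT t|lborel. norm (hreg d t)))"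
      by (intro AE_I2) (auto simp: norm_mult integral_nonneg abs_mult intro!: mult_left_mono norm_fourier_le)
  qed
  have shift: "cnj (a \<xi>) * (a (\<xi> + \<sigma>) * ?H \<sigma>) = of_real ((cone_exp C v \<xi>)\<^sup>2) * (a \<sigma> * ?H \<sigma>)" for \<xi> \<sigma>
  proof (cases "\<xi> \<in> dual_cone C \<and> \<sigma> \<in> dual_cone C")
    case True
    have c: "cis (2 * pi * ((\<xi> + \<sigma>) \<bullet> u)) = cis (2 * pi * (\<xi> \<bullet> u)) * cis (2 * pi * (\<sigma> \<bullet> u))"
      by (simp add: cis_mult inner_add_left distrib_left)
    have "cnj (cis \<theta>) * cis \<theta> = 1" for \<theta> by (simp add: cis_cnj cis_mult)
    then have "cnj (a \<xi>) * a (\<xi> + \<sigma>) = of_real ((cone_exp C v \<xi>)\<^sup>2) * a \<sigma>"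
      unfolding a_def c using True by (simp add: cone_exp_add power2_eq_square mult_ac)
    then show ?thesis by (metis mult.assoc)
  next
    \<comment> \<open>If \<open>\<xi>\<close> is off the dual cone, both sides vanish through
      \<open>cone_exp\<close>; if \<open>\<sigma>\<close> is, they vanish through
      \<open>?H \<sigma>\<close>.\<close>
    case False
    then show ?thesis
      using fourier_hreg_eq_0[OF d, of \<sigma>] by (auto simp: a_def cone_exp_def)
  qed
  have "of_real (cone_mass C v) * (LINT t|lborel. hreg d t * ?P t)
      = (LINT t|lborel. of_real (cone_mass C v) * (hreg d t * ?P t))"
    by (rule integral_mult_right_zero[symmetric])
  also have "\<dots> = (LINT t|lborel. fourier a t * m t)"
  proof (rule Bochner_Integration.integral_cong[OF refl])
    fix t
    have "of_real (cone_mass C v) * ?P t = fourier a t * cnj (fourier a t)"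
      using cone_mass_pos[OF v] unfolding poisson_def fa[symmetric]
      by (simp add: complex_norm_square del: of_real_power flip: of_real_mult)
    then show "of_real (cone_mass C v) * (hreg d t * ?P t) = fourier a t * m t"
      unfolding m_def cn[symmetric] by (metis mult.assoc mult.commute)
  qed
  also have "\<dots> = (LINT \<eta>|lborel. a \<eta> * fourier m \<eta>)"
    by (rule fourier_multiplication[OF ai mi])
  also have "\<dots> = (LINT \<eta>|lborel. LINT \<xi>|lborel. a \<eta> * cnj (a \<xi>) * ?H (\<eta> - \<xi>))"
    unfolding mh by (simp add: mult.assoc flip: integral_mult_right_zero)
  also have "\<dots> = (LINT \<xi>|lborel. LINT \<eta>|lborel. a \<eta> * cnj (a \<xi>) * ?H (\<eta> - \<xi>))"
    using lborel_pair.Fubini_integral[OF I2] by simp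
  also have "\<dots> = (LINT \<xi>|lborel. of_real ((cone_exp C v \<xi>)\<^sup>2) * (LINT \<sigma>|lborel. a \<sigma> * ?H \<sigma>))"
  proof (rule Bochner_Integration.integral_cong[OF refl])
    fix \<xi>
    have "(LINT \<eta>|lborel. a \<eta> * cnj (a \<xi>) * ?H (\<eta> - \<xi>))
        = (LINT \<sigma>|lborel. a (\<xi> + 1 *\<^sub>R \<sigma>) * cnj (a \<xi>) * ?H ((\<xi> + 1 *\<^sub>R \<sigma>) - \<xi>))"
      by (subst lborel_integral_affine[of 1 "\<lambda>\<eta>. a \<eta> * cnj (a \<xi>) * ?H (\<eta> - \<xi>)" \<xi>]) simp_all
    also have "\<dots> = (LINT \<sigma>|lborel. of_real ((cone_exp C v \<xi>)\<^sup>2) * (a \<sigma> * ?H \<sigma>))"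
      unfolding shift[symmetric] by (simp add: mult_ac)
    also have "\<dots> = of_real ((cone_exp C v \<xi>)\<^sup>2) * (LINT \<sigma>|lborel. a \<sigma> * ?H \<sigma>)"
      by (rule integral_mult_right_zero)
    finally show "(LINT \<eta>|lborel. a \<eta> * cnj (a \<xi>) * ?H (\<eta> - \<xi>))
      = of_real ((cone_exp C v \<xi>)\<^sup>2) * (LINT \<sigma>|lborel. a \<sigma> * ?H \<sigma>)" .
  qed
  also have "\<dots> = of_real (cone_mass C v) * (LINT \<sigma>|lborel. a \<sigma> * ?H \<sigma>)"
    unfolding cone_mass_def integral_complex_of_real[symmetric] by (rule integral_mult_left_zero)
  also have "(LINT \<sigma>|lborel. a \<sigma> * ?H \<sigma>) = Freg d v u"
    unfolding Freg_inversion[OF assms, of u, symmetric] a_def by (simp add: inner_commute mult_ac)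
  finally show ?thesis using cone_mass_pos[OF v] by simp
qed

section \<open>Removing the regularisation\<close>

lemma reg_tendsto_1: "(\<lambda>i. reg (1 / real (Suc i)) z) \<longlonglongrightarrow> 1"
proof -
  have "(\<lambda>i. 1 / real (Suc i) * sg j) \<longlonglongrightarrow> 0 * sg j" for j
    by (intro tendsto_intros LIMSEQ_Suc[OF lim_1_over_n])
  then have "(\<lambda>i. 1 / real (Suc i) * sg j) \<longlonglongrightarrow> 0" for j by simp
  then have "(\<lambda>i. damp (1 / real (Suc i) * sg j) (z $ j)) \<longlonglongrightarrow> 1" for j
    by (rule damp_tendsto_1)
  then have "(\<lambda>i. reg (1 / real (Suc i)) z) \<longlonglongrightarrow> (\<Prod>j\<in>(UNIV::'n set). 1)"
    unfolding reg_def by (intro tendsto_prod)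
  then show ?thesis by simp
qed

text \<open>The regularised identity passes to the limit because \<open>reg\<close> is at most 1 at
  real points. The majorant pairs \<open>\<beta>\<close> with the integrable kernel and
  \<open>g\<close> with the supremum \<open>B\<close> bounding the kernel.\<close>

theorem poisson_representation:
  assumes v: "v \<in> C"
  shows "(LINT t|lborel. h t * of_real (poisson C v (u - t))) = F (tube_pt u v)"
proof (rule LIMSEQ_unique)
  let ?P = "\<lambda>t. complex_of_real (poisson C v (u - t))"
  define d where "d i = 1 / real (Suc i)" for i
  have d: "d i > 0" for i by (simp add: d_def)
  define B where "B = (LINT \<eta>|lborel. cone_exp C v \<eta>)\<^sup>2 / cone_mass C v"
  have "(\<lambda>i. F (tube_pt u v) * reg (d i) (tube_pt u v)) \<longlonglongrightarrow> F (tube_pt u v) * 1"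
    unfolding d_def by (intro tendsto_intros reg_tendsto_1)
  then show "(\<lambda>i. LINT t|lborel. hreg (d i) t * ?P t) \<longlonglongrightarrow> F (tube_pt u v)"
    unfolding hreg_poisson[OF d v] Freg_def by simp
  show "(\<lambda>i. LINT t|lborel. hreg (d i) t * ?P t) \<longlonglongrightarrow> (LINT t|lborel. h t * ?P t)"
  proof (rule integral_dominated_convergence[where w = "\<lambda>t. \<beta> * poisson C v (u - t) + g t * B"])
    note borel_measurable_reg_cvec[OF d, measurable]
    show "(\<lambda>t. hreg (d i) t * ?P t) \<in> borel_measurable lborel" for i
      unfolding hreg_def by measurable
    show "integrable lborel (\<lambda>t. \<beta> * poisson C v (u - t) + g t * B)"
      by (intro Bochner_Integration.integrable_add integrable_mult_right integrable_mult_left integrable_poisson v g_int)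
    show "AE t in lborel. norm (hreg (d i) t * ?P t) \<le> \<beta> * poisson C v (u - t) + g t * B" for i
      using h_bound
    proof eventually_elim
      case (elim t)
      have "norm (hreg (d i) t) \<le> norm (h t)"
        unfolding hreg_def norm_mult using norm_reg_cvec_le_1[OF d] by (intro mult_left_le) auto
      then have "norm (hreg (d i) t * ?P t) \<le> (\<beta> + g t) * poisson C v (u - t)"
        unfolding norm_mult using elim poisson_nonneg[OF v] \<beta> g_nonneg[of t] by (intro mult_mono) auto
      also have "\<dots> \<le> \<beta> * poisson C v (u - t) + g t * B"
        unfolding distrib_right B_def using poisson_le[OF v] g_nonneg by (intro add_left_mono mult_left_mono) auto
      finally show ?case .
    qed
    show "AE t in lborel. (\<lambda>i. hreg (d i) t * ?P t) \<longlonglongrightarrow> h t * ?P t"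
    proof (rule AE_I2)
      fix t
      have "(\<lambda>i. h t * reg (d i) (cvec t) * ?P t) \<longlonglongrightarrow> h t * 1 * ?P t"
        unfolding d_def by (intro tendsto_intros reg_tendsto_1)
      then show "(\<lambda>i. hreg (d i) t * ?P t) \<longlonglongrightarrow> h t * ?P t"
        unfolding hreg_def by simp
    qed
  qed measurable
qed

end


section \<open>Vector valued functions and the Hardy space bound\<close>

text \<open>Complex linearity of the derivative turns the slice derivative into multiplication by
  \<open>cinner (D w) e\<close>; the form is complex linear in its first argument, so no conjugate
  appears.\<close>

lemma holomorphic_on_cinner_slice:
  fixes f :: "complex^'n \<Rightarrow> 'h::complex_hilbert"
  assumes f: "vanalytic_on f U" and S: "open S" and sub: "\<And>\<zeta>. \<zeta> \<in> S \<Longrightarrow> a + \<zeta> *s w \<in> U"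
  shows "(\<lambda>\<zeta>. cinner (f (a + \<zeta> *s w)) e) holomorphic_on S"
proof -
  have "\<exists>D. ((\<lambda>\<zeta>. cinner (f (a + \<zeta> *s w)) e) has_field_derivative D) (at \<zeta>)" if \<zeta>: "\<zeta> \<in> S" for \<zeta>
  proof -
    obtain D where D: "(f has_derivative D) (at (a + \<zeta> *s w))" "\<And>c u. D (c *s u) = c *\<^sub>C D u"
      using f sub[OF \<zeta>] unfolding vanalytic_on_def by blast
    have "linear (\<lambda>\<zeta>::complex. \<zeta> *s w)"
      by (rule linearI) (simp_all add: vec_eq_iff algebra_simps)
    then have "bounded_linear (\<lambda>\<zeta>::complex. \<zeta> *s w)"
      by (simp only: linear_conv_bounded_linear)
    then have "((\<lambda>\<zeta>. \<zeta> *s w) has_derivative (\<lambda>\<zeta>. \<zeta> *s w)) (at \<zeta>)"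
      by (rule bounded_linear_imp_has_derivative)
    then have "((\<lambda>\<zeta>. a + \<zeta> *s w) has_derivative (\<lambda>\<zeta>. \<zeta> *s w)) (at \<zeta>)"
      by (auto intro!: derivative_eq_intros)
    from has_derivative_compose[OF this D(1)]
    have "((\<lambda>\<zeta>. f (a + \<zeta> *s w)) has_derivative (\<lambda>\<zeta>. \<zeta> *\<^sub>C D w)) (at \<zeta>)"
      by (simp add: D(2))
    from bounded_linear.has_derivative[OF bounded_linear_cinner_left this]
    have "((\<lambda>\<zeta>. cinner (f (a + \<zeta> *s w)) e) has_derivative (\<lambda>\<zeta>. cinner (D w) e * \<zeta>)) (at \<zeta>)"
      by (simp add: cinner_scaleC_left mult.commute)
    then show ?thesis unfolding has_field_derivative_def by (intro exI)
  qed
  then show ?thesis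
    using S by (auto simp: holomorphic_on_open)
qed

lemma isCont_vanalytic: "vanalytic_on f U \<Longrightarrow> z \<in> U \<Longrightarrow> isCont f z"
  unfolding vanalytic_on_def using has_derivative_continuous by blast

lemma tube_pt_mem_tube: "y \<in> C \<Longrightarrow> tube_pt x y \<in> tube C"
  by (auto simp: tube_def)

text \<open>The closure of an open ray adds only the origin, which is not on the unit sphere.
  Hypotheses about compact subcones can therefore be applied along single rays.\<close>

lemma compact_subcone_ray:
  assumes C: "is_cone C" and y: "y \<in> C" "y \<noteq> 0"
  shows "compact_subcone {l *\<^sub>R y |l. 0 < l} C"
  unfolding compact_subcone_def
proof (intro conjI)
  show "is_cone {l *\<^sub>R y |l. 0 < l}"
    unfolding is_cone_def by (auto simp: zero_less_mult_iff)
  show "{l *\<^sub>R y |l. 0 < l} \<subseteq> C" using C y by (auto simp: is_cone_def)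
  have "closed ((\<lambda>l. l *\<^sub>R y) ` {0..})"
    by (rule closed_injective_linear_image) (use y in \<open>auto simp: inj_def linear_iff scaleR_add_left\<close>)
  then have "closure {l *\<^sub>R y |l. 0 < l} \<subseteq> (\<lambda>l. l *\<^sub>R y) ` {0..}"
    by (intro closure_minimal) auto
  moreover have "l *\<^sub>R y \<in> C" if "0 \<le> l" "l *\<^sub>R y \<in> sphere 0 1" for l
    using that C y by (cases "l = 0") (auto simp: is_cone_def)
  ultimately show "pr_cone (closure {l *\<^sub>R y |l. 0 < l}) \<subseteq> pr_cone C"
    unfolding pr_cone_def by blast
qed

lemma schwartz_decay:
  assumes "schwartz \<phi>"
  shows "\<exists>B\<ge>0. \<forall>x. (1 + norm x) ^ R * norm (\<phi> x) \<le> B * decay (x::real^'n)"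
proof -
  \<comment> \<open>Each of the \<open>CARD('n)\<close> factors \<open>1 + (x $ j)^2\<close> is at
    most \<open>(1 + norm x)^2\<close>.\<close>
  define N where "N = 2 * CARD('n)"
  have "\<exists>B. \<forall>x. (1 + norm x) ^ (R + N) * norm (iter_partial [] \<phi> x) \<le> B"
    using assms unfolding schwartz_def by blast
  then obtain B where B: "\<And>x. (1 + norm x) ^ (R + N) * norm (\<phi> x) \<le> B" by auto
  have B0: "0 \<le> B" by (rule order_trans[OF _ B[of 0]]) simp
  show ?thesis
  proof (intro exI[of _ B] conjI allI B0)
    fix x :: "real^'n"
    have "(\<Prod>j\<in>UNIV. 1 + (x $ j)\<^sup>2) \<le> (\<Prod>j\<in>(UNIV::'n set). (1 + norm x)\<^sup>2)"
    proof (intro prod_mono conjI)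
      fix j
      have "(x $ j)\<^sup>2 \<le> (norm x)\<^sup>2"
        using component_le_norm_cart[of x j] by (metis abs_ge_zero power2_abs power_mono)
      then show "1 + (x $ j)\<^sup>2 \<le> (1 + norm x)\<^sup>2" by (simp add: power2_sum add_increasing2)
    qed auto
    also have "\<dots> = (1 + norm x) ^ N" by (simp add: N_def power_mult)
    finally have P: "(\<Prod>j\<in>UNIV. 1 + (x $ j)\<^sup>2) \<le> (1 + norm x) ^ N" .
    have d: "decay x * (\<Prod>j\<in>UNIV. 1 + (x $ j)\<^sup>2) = 1"
    proof -
      have "inverse (1 + (x $ j)\<^sup>2) * (1 + (x $ j)\<^sup>2) = 1" for j
        using zero_le_power2[of "x $ j"] by (intro left_inverse) linarith
      then show ?thesis unfolding decay_def prod.distrib[symmetric] by simp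
    qed
    have "(1 + norm x) ^ R * norm (\<phi> x) = decay x * ((1 + norm x) ^ R * norm (\<phi> x) * (\<Prod>j\<in>UNIV. 1 + (x $ j)\<^sup>2))"
      using d by (simp add: mult_ac)
    also have "\<dots> \<le> decay x * ((1 + norm x) ^ R * norm (\<phi> x) * (1 + norm x) ^ N)"
      using P by (intro mult_left_mono) (auto intro: less_imp_le decay_pos)
    also have "\<dots> = decay x * ((1 + norm x) ^ (R + N) * norm (\<phi> x))"
      by (simp add: power_add mult_ac)
    also have "\<dots> \<le> decay x * B"
      by (intro mult_left_mono B less_imp_le decay_pos)
    finally show "(1 + norm x) ^ R * norm (\<phi> x) \<le> B * decay x" by (simp add: mult.commute)
  qed
qed

lemma isCont_schwartz: "schwartz \<phi> \<Longrightarrow> isCont \<phi> x"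
  unfolding schwartz_def by (metis differentiable_imp_continuous_within iter_partial.simps(1))

lemma nn_integral_lebesgue_less_top:
  fixes f :: "real^'n \<Rightarrow> real"
  assumes G: "integrable lborel G" and le: "AE x in lborel. f x \<le> G x"
  shows "(\<integral>\<^sup>+ x. ennreal (f x) \<partial>lebesgue) < \<infinity>"
proof -
  have "(\<integral>\<^sup>+ x. ennreal (f x) \<partial>lebesgue) \<le> (\<integral>\<^sup>+ x. ennreal (norm (G x)) \<partial>lborel)"
    unfolding nn_integral_completion using le
    by (intro nn_integral_mono_AE) (auto elim!: eventually_mono intro!: ennreal_leI)
  also have "\<dots> < \<infinity>" using G by (simp add: integrable_iff_bounded)
  finally show ?thesis .
qed

text \<open>Used to pass from \<open>h\<close> on \<open>lebesgue\<close> to Borel versions, since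
  the Fourier analysis is carried out over \<open>lborel\<close>.\<close>

lemma completion_ex_borel_measurable_complex:
  fixes g :: "'a \<Rightarrow> complex"
  assumes "g \<in> borel_measurable (completion M)"
  shows "\<exists>g'\<in>borel_measurable M. AE x in M. g x = g' x"
proof -
  have "(\<lambda>x. Re (g x)) \<in> borel_measurable (completion M)" "(\<lambda>x. Im (g x)) \<in> borel_measurable (completion M)"
    using assms by measurable
  then obtain r i where r: "r \<in> borel_measurable M" "AE x in M. Re (g x) = r x"
    and i: "i \<in> borel_measurable M" "AE x in M. Im (g x) = i x"
    using completion_ex_borel_measurable_real by metis
  show ?thesis
  proof (intro bexI)
    show "AE x in M. g x = of_real (r x) + \<i> * of_real (i x)"
      using r(2) i(2) by eventually_elim (simp add: complex_eq_iff)
    show "(\<lambda>x. of_real (r x) + \<i> * of_real (i x)) \<in> borel_measurable M"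
      using r(1) i(1) by measurable
  qed
qed

text \<open>Integrating Young's inequality \<open>N t * b \<le> N t powr q / q + b powr q' / q'\<close> against \<open>P\<close>, with \<open>b\<close> the
  \<open>(q - 1)\<close>-th power of the mean, gives Jensen's inequality also for mass below 1.\<close>

lemma powr_integral_le:
  fixes N P :: "'a \<Rightarrow> real"
  assumes q: "1 < q" and Pn: "\<And>t. 0 \<le> P t" and Nn: "\<And>t. 0 \<le> N t"
    and NP: "integrable M (\<lambda>t. N t * P t)" and P: "integrable M P" and P1: "(LINT t|M. P t) \<le> 1"
    and NqP: "integrable M (\<lambda>t. N t powr q * P t)"
  shows "(LINT t|M. N t * P t) powr q \<le> (LINT t|M. N t powr q * P t)"
proof -
  define A where "A = (LINT t|M. N t * P t)"
  have A0: "0 \<le> A" unfolding A_def by (rule Bochner_Integration.integral_nonneg) (simp add: Pn Nn)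
  have I0: "0 \<le> (LINT t|M. N t powr q * P t)" by (rule Bochner_Integration.integral_nonneg) (simp add: Pn)
  show ?thesis
  proof (cases "A = 0")
    case True
    then show ?thesis using I0 unfolding A_def by simp
  next
    case False
    then have A: "A > 0" using A0 by simp
    define b where "b = A powr (q - 1)"
    \<comment> \<open>The conjugate exponent: both \<open>b powr q'\<close> and \<open>A * b\<close>
      equal \<open>A powr q\<close>, so the second Young term can be moved to the left, leaving the
      factor \<open>1 / q\<close> on both sides.\<close>
    define q' where "q' = q / (q - 1)"
    have q': "q' > 1" "1 / q + 1 / q' = 1" using q by (auto simp: q'_def field_simps)
    have bq: "b powr q' = A powr q"
      using q A by (simp add: b_def q'_def powr_powr)
    have tangent: "N t * b \<le> N t powr q / q + A powr q * (1 / q')" for t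
      using Youngs_inequality[of q q' "N t" b] q q' Nn[of t] bq by (simp add: b_def)
    have "A * b = (LINT t|M. N t * P t * b)" unfolding A_def by simp
    also have "\<dots> \<le> (LINT t|M. (1 / q) * (N t powr q * P t) + (A powr q * (1 / q')) * P t)"
    proof (rule integral_mono)
      show "integrable M (\<lambda>t. N t * P t * b)" using NP by simp
      show "integrable M (\<lambda>t. (1 / q) * (N t powr q * P t) + (A powr q * (1 / q')) * P t)"
        by (intro Bochner_Integration.integrable_add integrable_mult_right NqP P)
      fix t
      have "N t * b * P t \<le> (N t powr q / q + A powr q * (1 / q')) * P t"
        by (rule mult_right_mono[OF tangent Pn])
      then show "N t * P t * b \<le> (1 / q) * (N t powr q * P t) + (A powr q * (1 / q')) * P t"
        by (simp add: algebra_simps)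
    qed
    also have "\<dots> = (1 / q) * (LINT t|M. N t powr q * P t) + (A powr q * (1 / q')) * (LINT t|M. P t)"
      by (subst Bochner_Integration.integral_add) (use NqP P in simp_all)
    also have "\<dots> \<le> (1 / q) * (LINT t|M. N t powr q * P t) + (A powr q * (1 / q')) * 1"
      using P1 q' by (intro add_left_mono mult_left_mono) auto
    finally have "A * b \<le> (1 / q) * (LINT t|M. N t powr q * P t) + A powr q * (1 / q')" by simp
    moreover have "A * b = A powr q" using A by (simp add: b_def powr_mult_base)
    moreover have "1 / q' = 1 - 1 / q" using q'(2) by simp
    ultimately have "A powr q * (1 / q) \<le> (1 / q) * (LINT t|M. N t powr q * P t)"
      by (simp add: algebra_simps)
    then show ?thesis using q unfolding A_def[symmetric] by (simp add: divide_right_mono field_simps)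
  qed
qed

context orthant_cone
begin

lemma nn_integral_poisson_le':
  assumes y: "y \<in> C"
  shows "(\<integral>\<^sup>+ x. ennreal (poisson C y (x - u)) \<partial>lborel) \<le> 1"
proof -
  have "(\<integral>\<^sup>+ x. ennreal (poisson C y (x - u)) \<partial>lborel) = (\<integral>\<^sup>+ x. ennreal (poisson C y (0 - x)) \<partial>lborel)"
    using nn_integral_lborel_affine[of "-1" "\<lambda>x. ennreal (poisson C y (x - u))" u] by simp
  also have "\<dots> \<le> 1" by (rule nn_integral_poisson_le[OF y])
  finally show ?thesis .
qed

lemma integrable_mult_poisson:
  assumes y: "y \<in> C" and N[measurable]: "N \<in> borel_measurable borel"
    and le: "AE t in lborel. \<bar>N t\<bar> \<le> \<beta> + g t" and g: "integrable lborel g" "\<And>t. 0 \<le> g t" and \<beta>: "0 \<le> \<beta>"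
  shows "integrable lborel (\<lambda>t. N t * poisson C y (x - t))"
proof -
  define B where "B = (LINT \<eta>|lborel. cone_exp C y \<eta>)\<^sup>2 / cone_mass C y"
  have "integrable lborel (\<lambda>t. \<beta> * poisson C y (x - t) + g t * B)"
    by (intro Bochner_Integration.integrable_add integrable_mult_right integrable_mult_left integrable_poisson y g)
  then show ?thesis
  proof (rule Bochner_Integration.integrable_bound)
    show "AE t in lborel. norm (N t * poisson C y (x - t)) \<le> norm (\<beta> * poisson C y (x - t) + g t * B)"
      using le
    proof eventually_elim
      case (elim t)
      have "norm (N t * poisson C y (x - t)) \<le> (\<beta> + g t) * poisson C y (x - t)"
        unfolding norm_mult using elim poisson_nonneg[OF y] by (simp add: mult_right_mono)
      also have "\<dots> \<le> \<beta> * poisson C y (x - t) + g t * B"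
        unfolding distrib_right B_def using poisson_le[OF y] g by (intro add_left_mono mult_left_mono) auto
      finally show ?case by simp
    qed
  qed measurable
qed

end

text \<open>The vector problem along rays. \<open>N\<close> is a Borel version of the norm of
  \<open>h\<close>, nonnegative everywhere.\<close>

locale Lp_boundary = orthant_cone C sg
  for C :: "(real^'n) set" and sg +
  fixes f :: "complex^'n \<Rightarrow> 'h::complex_hilbert" and h :: "real^'n \<Rightarrow> 'h" and R :: nat
    and \<beta> :: real and g N :: "real^'n \<Rightarrow> real"
  assumes analytic: "vanalytic_on f (tube C)"
    and ray_growth: "\<And>y r. y \<in> C \<Longrightarrow> r > 0 \<Longrightarrow>
      \<exists>M. \<forall>x s. s \<ge> r \<longrightarrow> norm (f (tube_pt x (s *\<^sub>R y))) \<le> M * (1 + norm x) ^ R"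
    and h_sm: "strongly_measurable lebesgue h"
    and boundary_value: "has_boundary_value C f h"
    and N_meas[measurable]: "N \<in> borel_measurable borel" and N_nonneg: "\<And>t. 0 \<le> N t"
    and N_eq: "AE t in lborel. norm (h t) = N t"
    and N_le: "AE t in lborel. N t \<le> \<beta> + g t"
    and g_int: "integrable lborel g" and g_nonneg: "\<And>t. 0 \<le> g t" and \<beta>: "0 \<le> \<beta>"
begin

section \<open>From vector values to scalar ones and back\<close>

lemma isCont_f: "y \<in> C \<Longrightarrow> isCont f (tube_pt x y)"
  by (rule isCont_vanalytic[OF analytic tube_pt_mem_tube])

lemma isCont_f_tube_pt: "y \<in> C \<Longrightarrow> isCont (\<lambda>x. f (tube_pt x y)) x"
  by (rule isCont_o2[where g = f], use continuous_on_tube_pt[of UNIV "\<lambda>x. x" "\<lambda>_. y"] in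
      \<open>simp add: continuous_on_eq_continuous_at\<close>) (rule isCont_f)

lemma nonzero_C: "y \<in> C \<Longrightarrow> y \<noteq> 0"
  using C_sg[of y] by auto

text \<open>Because \<open>vbochner_integral\<close> has a default value, both integrands have to be
  shown norm integrable before \<open>cinner\<close> may enter the integrals: \<open>\<phi>\<close>
  outweighs the polynomial growth of \<open>f\<close>, and the bound \<open>\<beta> + g\<close>
  controls \<open>h\<close>.\<close>

lemma ray_boundary_value:
  assumes \<phi>: "schwartz \<phi>" and y: "y \<in> C"
  shows "((\<lambda>\<epsilon>. LINT x|lborel. cinner (f (tube_pt x (\<epsilon> *\<^sub>R y))) e * \<phi> x)
    \<longlongrightarrow> (LINT x|lebesgue. \<phi> x * cinner (h x) e)) (at_right 0)"
proof -
  let ?V = "\<lambda>\<epsilon>. vbochner_integral lebesgue (\<lambda>x. \<phi> x *\<^sub>C f (tube_pt x (\<epsilon> *\<^sub>R y)))"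
  let ?L = "vbochner_integral lebesgue (\<lambda>x. \<phi> x *\<^sub>C h x)"
  let ?C' = "{l *\<^sub>R y |l. 0 < l}"
  have \<phi>sm: "strongly_measurable lebesgue \<phi>"
    by (rule strongly_measurable_continuous) (rule isCont_schwartz[OF \<phi>])
  have \<phi>m[measurable]: "\<phi> \<in> borel_measurable borel"
    by (intro borel_measurable_continuous_onI) (simp add: continuous_on_eq_continuous_at isCont_schwartz[OF \<phi>])
  have "filterlim (\<lambda>\<epsilon>. \<epsilon> *\<^sub>R y) (at 0 within ?C') (at_right 0)"
    unfolding filterlim_at
  proof
    have "((\<lambda>\<epsilon>. \<epsilon> *\<^sub>R y) \<longlongrightarrow> 0 *\<^sub>R y) (at_right 0)"
      by (intro tendsto_intros)
    then show "((\<lambda>\<epsilon>. \<epsilon> *\<^sub>R y) \<longlongrightarrow> 0) (at_right 0)" by simp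
    show "\<forall>\<^sub>F \<epsilon> in at_right 0. \<epsilon> *\<^sub>R y \<in> ?C' \<and> \<epsilon> *\<^sub>R y \<noteq> 0"
      using nonzero_C[OF y] by (auto simp: eventually_at_filter)
  qed
  moreover have "((\<lambda>w. norm (vbochner_integral lebesgue (\<lambda>x. \<phi> x *\<^sub>C f (tube_pt x w)) - ?L)) \<longlongrightarrow> 0) (at 0 within ?C')"
    using boundary_value \<phi> compact_subcone_ray[OF cone_C y nonzero_C[OF y]] unfolding has_boundary_value_def by blast
  ultimately have "((\<lambda>\<epsilon>. norm (?V \<epsilon> - ?L)) \<longlongrightarrow> 0) (at_right 0)"
    by (rule filterlim_compose[rotated])
  then have "(?V \<longlongrightarrow> ?L) (at_right 0)"
    by (rule Lim_null[THEN iffD2, OF tendsto_norm_zero_cancel])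



  then have lim: "((\<lambda>\<epsilon>. cinner (?V \<epsilon>) e) \<longlongrightarrow> cinner ?L e) (at_right 0)"
    by (rule bounded_linear.tendsto[OF bounded_linear_cinner_left])
  have V0: "cinner ?L e = (LINT x|lebesgue. \<phi> x * cinner (h x) e)"
  proof -
    obtain B where B: "B \<ge> 0" "\<And>x. norm (\<phi> x) \<le> B * decay x"
      using schwartz_decay[OF \<phi>, of 0] by auto
    have "(\<integral>\<^sup>+ x. ennreal (norm (\<phi> x *\<^sub>C h x)) \<partial>lebesgue) < \<infinity>"
    proof (rule nn_integral_lebesgue_less_top)
      show "integrable lborel (\<lambda>x. \<beta> * (B * decay x) + g x * B)"
        by (intro Bochner_Integration.integrable_add integrable_mult_right integrable_mult_left integrable_decay g_int)
      show "AE x in lborel. norm (\<phi> x *\<^sub>C h x) \<le> \<beta> * (B * decay x) + g x * B"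
        using N_eq N_le
      proof eventually_elim
        case (elim x)
        have "B * decay x \<le> B * 1" using B(1) decay_le_1 by (intro mult_left_mono) auto
        then have Bx: "norm (\<phi> x) \<le> B" using B(2)[of x] by linarith
        have "norm (\<phi> x *\<^sub>C h x) \<le> (\<beta> + g x) * norm (\<phi> x)"
          unfolding norm_scaleC mult.commute[of "cmod (\<phi> x)"] using elim by (intro mult_right_mono) auto
        also have "\<dots> \<le> \<beta> * (B * decay x) + g x * B"
          unfolding distrib_right using B(2)[of x] Bx \<beta> g_nonneg[of x] by (intro add_mono mult_left_mono) auto
        finally show ?case .
      qed
    qed
    from cinner_vbochner_integral[OF strongly_measurable_scaleC[OF \<phi>sm h_sm] this]
    show ?thesis by (simp add: cinner_scaleC_left)
  qed
  have V: "cinner (?V \<epsilon>) e = (LINT x|lborel. cinner (f (tube_pt x (\<epsilon> *\<^sub>R y))) e * \<phi> x)" if \<epsilon>: "\<epsilon> > 0" for \<epsilon>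
  proof -
    have \<epsilon>y: "\<epsilon> *\<^sub>R y \<in> C" using scaleR_C[OF y \<epsilon>] .

    obtain M where M: "\<And>x s. s \<ge> \<epsilon> \<Longrightarrow> norm (f (tube_pt x (s *\<^sub>R y))) \<le> M * (1 + norm x) ^ R"
      using ray_growth[OF y \<epsilon>] by blast
    obtain B where B: "B \<ge> 0" "\<And>x. (1 + norm x) ^ R * norm (\<phi> x) \<le> B * decay x"
      using schwartz_decay[OF \<phi>, of R] by auto
    have "(\<integral>\<^sup>+ x. ennreal (norm (\<phi> x *\<^sub>C f (tube_pt x (\<epsilon> *\<^sub>R y)))) \<partial>lebesgue) < \<infinity>"
    proof (rule nn_integral_lebesgue_less_top)
      show "integrable lborel (\<lambda>x::real^'n. \<bar>M\<bar> * (B * decay x))"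
        by (intro integrable_mult_right integrable_decay)
      show "AE x in lborel. norm (\<phi> x *\<^sub>C f (tube_pt x (\<epsilon> *\<^sub>R y))) \<le> \<bar>M\<bar> * (B * decay x)"
      proof (rule AE_I2)
        fix x
        have "norm (\<phi> x *\<^sub>C f (tube_pt x (\<epsilon> *\<^sub>R y))) \<le> norm (\<phi> x) * (M * (1 + norm x) ^ R)"
          unfolding norm_scaleC by (intro mult_left_mono M) auto
        also have "\<dots> = M * ((1 + norm x) ^ R * norm (\<phi> x))" by simp
        also have "\<dots> \<le> \<bar>M\<bar> * ((1 + norm x) ^ R * norm (\<phi> x))" by (intro mult_right_mono) auto
        also have "\<dots> \<le> \<bar>M\<bar> * (B * decay x)" by (intro mult_left_mono B) auto
        finally show "norm (\<phi> x *\<^sub>C f (tube_pt x (\<epsilon> *\<^sub>R y))) \<le> \<bar>M\<bar> * (B * decay x)" .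
      qed
    qed
    from cinner_vbochner_integral[OF strongly_measurable_scaleC[OF \<phi>sm strongly_measurable_continuous[OF isCont_f_tube_pt[OF \<epsilon>y]]] this, of e]
    have "cinner (?V \<epsilon>) e = (LINT x|lebesgue. cinner (f (tube_pt x (\<epsilon> *\<^sub>R y))) e * \<phi> x)"
      by (simp add: cinner_scaleC_left mult.commute)
    also have "\<dots> = (LINT x|lborel. cinner (f (tube_pt x (\<epsilon> *\<^sub>R y))) e * \<phi> x)"
    proof (rule integral_completion)
      have "(\<lambda>x. cinner (f (tube_pt x (\<epsilon> *\<^sub>R y))) e) \<in> borel_measurable borel"
        by (intro borel_measurable_continuous_onI)
          (simp add: continuous_on_eq_continuous_at bounded_linear.isCont[OF bounded_linear_cinner_left isCont_f_tube_pt[OF \<epsilon>y]])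
      then show "(\<lambda>x. cinner (f (tube_pt x (\<epsilon> *\<^sub>R y))) e * \<phi> x) \<in> borel_measurable lborel"
        by measurable
    qed
    finally show ?thesis .
  qed
  have "\<forall>\<^sub>F \<epsilon> in at_right 0. cinner (?V \<epsilon>) e = (LINT x|lborel. cinner (f (tube_pt x (\<epsilon> *\<^sub>R y))) e * \<phi> x)"
    using V by (auto simp: eventually_at_filter)
  from Lim_transform_eventually[OF lim this] show ?thesis unfolding V0 .
qed

lemma borel_measurable_cinner_h: "(\<lambda>t. cinner (h t) e) \<in> borel_measurable lebesgue"
  by (rule strongly_measurable_imp_borel_measurable, rule strongly_measurable_compose[OF h_sm])
    (rule bounded_linear.isCont[OF bounded_linear_cinner_left continuous_ident])

text \<open>The scalar theorem for the pairing of \<open>f\<close> with \<open>e\<close>; by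
  Cauchy-Schwarz all bounds merely gain the factor \<open>norm e\<close>. The function
  \<open>he\<close> is a Borel version of the pairing of \<open>h\<close> with
  \<open>e\<close>.\<close>

lemma cinner_representation:
  assumes v: "v \<in> C"
  shows "\<exists>he\<in>borel_measurable borel. (AE t in lborel. cinner (h t) e = he t) \<and>
    (LINT t|lborel. he t * of_real (poisson C v (u - t))) = cinner (f (tube_pt u v)) e"
proof -
  obtain he where he: "he \<in> borel_measurable lborel" "AE t in lborel. cinner (h t) e = he t"
    using completion_ex_borel_measurable_complex[OF borel_measurable_cinner_h] by blast
  interpret tube_boundary C sg "\<lambda>z. cinner (f z) e" he R "norm e * \<beta>" "\<lambda>t. norm e * g t"
  proof
    fix x y assume y: "y \<in> C"
    show "(\<lambda>\<zeta>. cinner (f (cvec x + \<zeta> *s cvec y)) e) holomorphic_on {\<zeta>. 0 < Im \<zeta>}"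
      by (rule holomorphic_on_cinner_slice[OF analytic open_halfspace_Im_gt])
        (auto simp: slice_eq_tube_pt intro!: tube_pt_mem_tube scaleR_C[OF y])
    show "isCont (\<lambda>z. cinner (f z) e) (tube_pt x y)"
      by (rule bounded_linear.isCont[OF bounded_linear_cinner_left isCont_f[OF y]])
  next
    fix y and r :: real assume "y \<in> C" "r > 0"
    then obtain M where M: "\<And>x s. s \<ge> r \<Longrightarrow> norm (f (tube_pt x (s *\<^sub>R y))) \<le> M * (1 + norm x) ^ R"
      using ray_growth by blast
    show "\<exists>M. \<forall>x s. r \<le> s \<longrightarrow> cmod (cinner (f (tube_pt x (s *\<^sub>R y))) e) \<le> M * (1 + norm x) ^ R"
    proof (intro exI allI impI)
      fix x s assume "r \<le> s"
      then have "norm (f (tube_pt x (s *\<^sub>R y))) * norm e \<le> M * (1 + norm x) ^ R * norm e"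
        by (intro mult_right_mono M) auto
      then show "cmod (cinner (f (tube_pt x (s *\<^sub>R y))) e) \<le> (M * norm e) * (1 + norm x) ^ R"
        by (intro order_trans[OF cinner_Cauchy_Schwarz]) (simp add: mult_ac)
    qed
  next
    show "he \<in> borel_measurable borel" using he(1) by simp
    show "AE t in lborel. cmod (he t) \<le> norm e * \<beta> + norm e * g t"
      using he(2) N_eq N_le
    proof eventually_elim
      case (elim t)
      have "cmod (he t) \<le> N t * norm e" using cinner_Cauchy_Schwarz[of "h t" e] elim by simp
      also have "\<dots> \<le> (\<beta> + g t) * norm e" using elim by (intro mult_right_mono) auto
      finally show ?case by (simp add: algebra_simps)
    qed
    show "integrable lborel (\<lambda>t. norm e * g t)" using g_int by simp
    show "0 \<le> norm e * g t" for t using g_nonneg by simp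
    show "0 \<le> norm e * \<beta>" using \<beta> by simp
  next
    fix \<phi> :: "real^'n \<Rightarrow> complex" and y assume \<phi>: "schwartz \<phi>" and y: "y \<in> C"

    have \<phi>m[measurable]: "\<phi> \<in> borel_measurable borel"
      by (intro borel_measurable_continuous_onI) (simp add: continuous_on_eq_continuous_at isCont_schwartz[OF \<phi>])
    note he(1)[measurable]
    have "(LINT x|lebesgue. \<phi> x * cinner (h x) e) = (LINT x|lebesgue. he x * \<phi> x)"
    proof (rule integral_cong_AE)
      show "(\<lambda>x. \<phi> x * cinner (h x) e) \<in> borel_measurable lebesgue"
        by (intro borel_measurable_times measurable_completion[of \<phi>]) (auto intro: borel_measurable_cinner_h)
      show "(\<lambda>x. he x * \<phi> x) \<in> borel_measurable lebesgue"
        by (rule measurable_completion) measurable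
      show "AE x in lebesgue. \<phi> x * cinner (h x) e = he x * \<phi> x"
        by (rule AE_completion) (use he(2) in \<open>auto elim!: eventually_mono\<close>)
    qed
    also have "\<dots> = (LINT x|lborel. he x * \<phi> x)"
      by (rule integral_completion) measurable
    finally show "((\<lambda>\<epsilon>. LINT x|lborel. cinner (f (tube_pt x (\<epsilon> *\<^sub>R y))) e * \<phi> x) \<longlongrightarrow> (LINT x|lborel. he x * \<phi> x)) (at_right 0)"
      using ray_boundary_value[OF \<phi> y, of e] by simp
  qed
  show ?thesis
    using he poisson_representation[OF v, of u] by (intro bexI[of _ he]) auto
qed

lemma integrable_N_poisson:
  assumes v: "v \<in> C"
  shows "integrable lborel (\<lambda>t. N t * poisson C v (u - t))"
  using N_le by (intro integrable_mult_poisson[OF v N_meas _ g_int g_nonneg \<beta>]) (simp add: N_nonneg)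

lemma vector_representation:
  assumes v: "v \<in> C"
  shows "has_vbochner_integral lebesgue (\<lambda>t. poisson_kernel C (tube_pt u v) t *\<^sub>C h t) (f (tube_pt u v))"
  unfolding poisson_kernel_tube_pt
proof (rule has_vbochner_integralI_cinner)
  let ?P = "\<lambda>t. complex_of_real (poisson C v (u - t))"
  have P[measurable]: "(\<lambda>t. ?P t) \<in> borel_measurable lborel" by measurable
  show "strongly_measurable lebesgue (\<lambda>t. ?P t *\<^sub>C h t)"
    by (intro strongly_measurable_scaleC h_sm borel_measurable_imp_strongly_measurable measurable_completion P)
  show "(\<integral>\<^sup>+ t. ennreal (norm (?P t *\<^sub>C h t)) \<partial>lebesgue) < \<infinity>"
    by (rule nn_integral_lebesgue_less_top[OF integrable_N_poisson[OF v, of u]])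
      (use N_eq in \<open>auto simp: norm_scaleC poisson_nonneg[OF v] elim!: eventually_mono\<close>)
  fix e
  obtain he where he[measurable]: "he \<in> borel_measurable borel" and ae: "AE t in lborel. cinner (h t) e = he t"
    and rep: "(LINT t|lborel. he t * ?P t) = cinner (f (tube_pt u v)) e"
    using cinner_representation[OF v] by blast
  have "(LINT t|lebesgue. cinner (?P t *\<^sub>C h t) e)
      = (LINT t|lebesgue. he t * ?P t)"
    unfolding cinner_scaleC_left
  proof (rule integral_cong_AE)
    show "(\<lambda>t. ?P t * cinner (h t) e) \<in> borel_measurable lebesgue"
      by (intro borel_measurable_times borel_measurable_cinner_h measurable_completion[OF P])
    show "(\<lambda>t. he t * ?P t) \<in> borel_measurable lebesgue"
      by (rule measurable_completion) measurable
    show "AE t in lebesgue. ?P t * cinner (h t) e = he t * ?P t"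
      by (rule AE_completion) (use ae in \<open>auto elim!: eventually_mono\<close>)
  qed
  also have "\<dots> = (LINT t|lborel. he t * ?P t)"
    by (rule integral_completion) measurable
  finally show "(LINT t|lebesgue. cinner (?P t *\<^sub>C h t) e) = cinner (f (tube_pt u v)) e"
    unfolding rep .
qed

text \<open>The representation is tested against \<open>e = f (tube_pt u v)\<close> itself;
  Cauchy-Schwarz inside the integral then allows one factor of the norm to be cancelled.\<close>

lemma norm_f_le:
  assumes v: "v \<in> C"
  shows "norm (f (tube_pt u v)) \<le> (LINT t|lborel. N t * poisson C v (u - t))"
proof -
  let ?e = "f (tube_pt u v)" and ?I = "LINT t|lborel. N t * poisson C v (u - t)"
  obtain he where he[measurable]: "he \<in> borel_measurable borel" and ae: "AE t in lborel. cinner (h t) ?e = he t"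
    and rep: "(LINT t|lborel. he t * of_real (poisson C v (u - t))) = cinner ?e ?e"
    using cinner_representation[OF v] by blast
  have "(norm ?e)\<^sup>2 = norm (LINT t|lborel. he t * of_real (poisson C v (u - t)))"
    unfolding rep cinner_self by (simp del: of_real_power)
  also have "\<dots> \<le> (LINT t|lborel. norm (he t * of_real (poisson C v (u - t))))"
    by (rule integral_norm_bound)
  also have "\<dots> \<le> (LINT t|lborel. norm ?e * (N t * poisson C v (u - t)))"
  proof (rule integral_mono_AE')
    show "integrable lborel (\<lambda>t. norm ?e * (N t * poisson C v (u - t)))"
      using integrable_N_poisson[OF v, of u] by simp
    show "AE t in lborel. norm (he t * of_real (poisson C v (u - t))) \<le> norm ?e * (N t * poisson C v (u - t))"
      using ae N_eq
    proof eventually_elim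
      case (elim t)
      have "norm (he t) \<le> norm ?e * N t" using cinner_Cauchy_Schwarz[of "h t" ?e] elim by (simp add: mult.commute)
      then have "norm (he t) * poisson C v (u - t) \<le> norm ?e * N t * poisson C v (u - t)"
        by (rule mult_right_mono) (rule poisson_nonneg[OF v])
      then show ?case by (simp add: norm_mult poisson_nonneg[OF v])
    qed
  qed (simp add: N_nonneg poisson_nonneg[OF v])
  also have "\<dots> = norm ?e * ?I" by simp
  finally have "norm ?e * norm ?e \<le> norm ?e * ?I" by (simp add: power2_eq_square)
  moreover have "0 \<le> ?I" by (rule Bochner_Integration.integral_nonneg) (simp add: N_nonneg poisson_nonneg[OF v])
  ultimately show ?thesis by (cases "norm ?e = 0") auto
qed

section \<open>Hardy space bounds\<close>

lemma norm_f_le_essential_bound: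
  assumes v: "v \<in> C" and B: "AE t in lborel. N t \<le> B" "0 \<le> B"
  shows "norm (f (tube_pt u v)) \<le> B"
proof -
  have "norm (f (tube_pt u v)) \<le> (LINT t|lborel. N t * poisson C v (u - t))" by (rule norm_f_le[OF v])
  also have "\<dots> \<le> (LINT t|lborel. B * poisson C v (u - t))"
  proof (rule integral_mono_AE[OF integrable_N_poisson[OF v]])
    show "AE t in lborel. N t * poisson C v (u - t) \<le> B * poisson C v (u - t)"
      using B(1) by eventually_elim (rule mult_right_mono[OF _ poisson_nonneg[OF v]])
  qed (use integrable_poisson[OF v] in simp)
  also have "\<dots> \<le> B * 1"
    unfolding integral_mult_right_zero using integral_poisson_le_1[OF v] B(2) by (rule mult_left_mono)
  finally show ?thesis by simp
qed

text \<open>Jensen's inequality in \<open>t\<close> for a kernel of mass at most 1, then Tonelli,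
  then the same mass bound for the kernel as a function of \<open>x\<close>.\<close>

lemma nn_integral_norm_f_powr_le:
  assumes v: "v \<in> C" and q: "1 < q" and Nq: "integrable lborel (\<lambda>t. N t powr q)"
  shows "(\<integral>\<^sup>+ x. ennreal (norm (f (tube_pt x v)) powr q) \<partial>lebesgue) \<le> ennreal (LINT t|lborel. N t powr q)"
proof -
  have NqP: "integrable lborel (\<lambda>t. N t powr q * poisson C v (u - t))" for u
    \<comment> \<open>Here \<open>N t powr q\<close> is its own integrable majorant, with constant
      part 0.\<close>
    by (rule integrable_mult_poisson[OF v _ _ Nq, where \<beta> = 0]) auto
  have "(\<integral>\<^sup>+ x. ennreal (norm (f (tube_pt x v)) powr q) \<partial>lebesgue)
      \<le> (\<integral>\<^sup>+ x. \<integral>\<^sup>+ t. ennreal (N t powr q) * ennreal (poisson C v (x - t)) \<partial>lborel \<partial>lborel)"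
    unfolding nn_integral_completion
  proof (rule nn_integral_mono)
    fix x
    have "norm (f (tube_pt x v)) powr q \<le> (LINT t|lborel. N t * poisson C v (x - t)) powr q"
      using norm_f_le[OF v] q by (intro powr_mono2) auto
    also have "\<dots> \<le> (LINT t|lborel. N t powr q * poisson C v (x - t))"
      by (rule powr_integral_le[OF q poisson_nonneg[OF v] N_nonneg integrable_N_poisson[OF v]
            integrable_poisson[OF v] integral_poisson_le_1[OF v] NqP])
    finally have "ennreal (norm (f (tube_pt x v)) powr q) \<le> ennreal (LINT t|lborel. N t powr q * poisson C v (x - t))"
      by (rule ennreal_leI)
    also have "\<dots> = (\<integral>\<^sup>+ t. ennreal (N t powr q * poisson C v (x - t)) \<partial>lborel)"
      by (rule nn_integral_eq_integral[symmetric, OF NqP]) (simp add: poisson_nonneg[OF v])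
    also have "\<dots> = (\<integral>\<^sup>+ t. ennreal (N t powr q) * ennreal (poisson C v (x - t)) \<partial>lborel)"
      by (simp add: ennreal_mult poisson_nonneg[OF v])
    finally show "ennreal (norm (f (tube_pt x v)) powr q) \<le> (\<integral>\<^sup>+ t. ennreal (N t powr q) * ennreal (poisson C v (x - t)) \<partial>lborel)" .
  qed
  also have "\<dots> = (\<integral>\<^sup>+ t. \<integral>\<^sup>+ x. ennreal (N t powr q) * ennreal (poisson C v (x - t)) \<partial>lborel \<partial>lborel)"
    by (rule lborel_pair.Fubini') measurable
  also have "\<dots> \<le> (\<integral>\<^sup>+ t. ennreal (N t powr q) * 1 \<partial>lborel)"
  proof (rule nn_integral_mono)
    fix t
    have "(\<integral>\<^sup>+ x. ennreal (N t powr q) * ennreal (poisson C v (x - t)) \<partial>lborel)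
        = ennreal (N t powr q) * (\<integral>\<^sup>+ x. ennreal (poisson C v (x - t)) \<partial>lborel)"
      by (rule nn_integral_cmult) measurable
    also have "\<dots> \<le> ennreal (N t powr q) * 1"
      by (intro mult_left_mono nn_integral_poisson_le' v) simp
    finally show "(\<integral>\<^sup>+ x. ennreal (N t powr q) * ennreal (poisson C v (x - t)) \<partial>lborel) \<le> ennreal (N t powr q) * 1" .
  qed
  also have "\<dots> = ennreal (LINT t|lborel. N t powr q)"
    using nn_integral_eq_integral[OF Nq] by simp
  finally show ?thesis .
qed

end

theorem theorem4p3:
  fixes p :: ennreal
    and C :: "(real^'n) set"
    and f :: "complex^'n \<Rightarrow> 'h::complex_hilbert"
    and h :: "real^'n \<Rightarrow> 'h"
    and R :: nat and k :: int
  assumes p: "2 < p"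
    and C: "open C" "convex C" "is_cone C"
    and rant: "\<exists>v. (\<forall>j. v j \<in> {0, 1}) \<and> C \<subseteq> n_rant v"
    and analytic: "vanalytic_on f (tube C)"
    and k: "k > 1"
    and growth: "\<And>C' r. compact_subcone C' C \<Longrightarrow> r > 0 \<Longrightarrow>
      \<exists>M::real. \<forall>x. \<forall>y \<in> C' - (C' \<inter> cball 0 r).
        norm (f (tube_pt x y)) \<le> M * (1 + norm x) ^ R * norm y powi (- k)"
    and h: "in_Lp p h"
    and boundary: "has_boundary_value C f h"
  shows "in_Hardy p C f \<and>
    (\<forall>z \<in> tube C.
       has_vbochner_integral lebesgue (\<lambda>t. poisson_kernel C z t *\<^sub>C h t) (f z))"
proof -
  obtain v :: "'n \<Rightarrow> nat" where v: "C \<subseteq> n_rant v" using rant by blast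
  define sg :: "'n \<Rightarrow> real" where "sg j = (-1) ^ v j" for j
  interpret orthant_cone C sg
    by standard (use C v in \<open>auto simp: sg_def n_rant_def power_abs\<close>)
  have ray: "\<exists>M. \<forall>x s. s \<ge> r \<longrightarrow> norm (f (tube_pt x (s *\<^sub>R y))) \<le> M * (1 + norm x) ^ R"
    if y: "y \<in> C" and r: "r > 0" for y r
  proof -
    have y0: "y \<noteq> 0" using C_sg[OF y] by auto
    define \<rho> where "\<rho> = r * norm y"
    have \<rho>: "\<rho> > 0" using r y0 by (simp add: \<rho>_def)
    \<comment> \<open>The excluded ball is closed; radius \<open>\<rho> / 2\<close> puts the points
      \<open>s *\<^sub>R y\<close> with \<open>s \<ge> r\<close>, whose norm is at least
      \<open>\<rho>\<close>, strictly outside it.\<close>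
    have "\<rho> / 2 > 0" using \<rho> by simp
    from growth[OF compact_subcone_ray[OF C(3) y y0] this]
    obtain M where M: "\<And>x w. w \<in> {l *\<^sub>R y |l. 0 < l} - ({l *\<^sub>R y |l. 0 < l} \<inter> cball 0 (\<rho> / 2)) \<Longrightarrow>
        norm (f (tube_pt x w)) \<le> M * (1 + norm x) ^ R * norm w powi (- k)"
      by blast

    show ?thesis
    proof (intro exI allI impI)
      fix x s assume s: "r \<le> s"
      have n: "\<rho> \<le> norm (s *\<^sub>R y)" using s r by (simp add: \<rho>_def mult_right_mono)
      have "norm (f (tube_pt x (s *\<^sub>R y))) \<le> M * (1 + norm x) ^ R * norm (s *\<^sub>R y) powi (- k)"
        by (rule M) (use n \<rho> s r in auto)
      also have "\<dots> \<le> \<bar>M\<bar> * (1 + norm x) ^ R * norm (s *\<^sub>R y) powi (- k)"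
        by (intro mult_right_mono) auto
      \<comment> \<open>The exponent is negative, so the power is largest at the smallest norm
        \<open>\<rho>\<close>; this gives a bound independent of \<open>s\<close>.\<close>
      also have "norm (s *\<^sub>R y) powi (- k) \<le> \<rho> powi (- k)"
        unfolding power_int_minus using \<rho> n k by (intro le_imp_inverse_le power_int_mono) auto
      then have "\<bar>M\<bar> * (1 + norm x) ^ R * norm (s *\<^sub>R y) powi (- k) \<le> \<bar>M\<bar> * (1 + norm x) ^ R * \<rho> powi (- k)"
        by (rule mult_left_mono) auto
      finally show "norm (f (tube_pt x (s *\<^sub>R y))) \<le> (\<bar>M\<bar> * \<rho> powi (- k)) * (1 + norm x) ^ R"
        by (simp add: mult_ac)
    qed
  qed
  have hsm: "strongly_measurable lebesgue h" using h by (simp add: in_Lp_def)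
  obtain N0 where N0: "N0 \<in> borel_measurable lborel" "AE t in lborel. norm (h t) = N0 t"
    using completion_ex_borel_measurable_real[OF borel_measurable_norm_strongly[OF hsm]] by blast
  \<comment> \<open>The Borel version is nonnegative only almost everywhere; the absolute value
    makes it so at every point.\<close>
  define N where "N t = \<bar>N0 t\<bar>" for t
  have Nm[measurable]: "N \<in> borel_measurable borel" using N0(1) unfolding N_def[abs_def] by simp
  have Neq: "AE t in lborel. norm (h t) = N t"
    using N0(2) by eventually_elim (simp add: N_def, metis abs_norm_cancel)
  show ?thesis
  proof (cases "p = \<infinity>")
    case True
    then obtain B where "AE t in lebesgue. norm (h t) \<le> B" using h by (auto simp: in_Lp_def)
    then have "AE t in lborel. norm (h t) \<le> B" by (simp add: AE_completion_iff)
    then have NB: "AE t in lborel. N t \<le> \<bar>B\<bar>" using Neq by eventually_elim simp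
    \<comment> \<open>An essential bound is the case in which the integrable part of the majorant is
      0.\<close>
    interpret Lp_boundary C sg f h R "\<bar>B\<bar>" "\<lambda>_. 0" N
      by standard (use analytic ray hsm boundary Neq NB in \<open>auto simp: N_def[symmetric]\<close>, simp add: N_def)
    have "\<forall>z\<in>tube C. norm (f z) \<le> \<bar>B\<bar>"
      using norm_f_le_essential_bound[OF _ NB] by (auto simp: tube_def)
    then show ?thesis
      using True analytic vector_representation by (auto simp: in_Hardy_def tube_def)
  next
    case False
    define q where "q = enn2real p"
    have pq: "p = ennreal q" using False by (simp add: q_def less_top)
    have q: "2 < q"
    proof -
      have "ennreal 2 < ennreal q" using p pq by simp
      then show ?thesis by (simp add: ennreal_less_iff)
    qed
    have "(\<integral>\<^sup>+ t. ennreal (norm (h t) powr q) \<partial>lborel) < \<infinity>"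
      using h False by (simp add: in_Lp_def q_def nn_integral_completion)
    also have "(\<integral>\<^sup>+ t. ennreal (norm (h t) powr q) \<partial>lborel) = (\<integral>\<^sup>+ t. ennreal (N t powr q) \<partial>lborel)"
      using Neq by (intro nn_integral_cong_AE) (auto elim!: eventually_mono)
    finally have Nq: "integrable lborel (\<lambda>t. N t powr q)"
      by (intro integrableI_nonneg) auto
    \<comment> \<open>The splitting for finite exponents: where \<open>N\<close> is at most 1 the
      constant suffices, and elsewhere \<open>N\<close> is dominated by its \<open>q\<close>-th
      power.\<close>
    have Nle: "N t \<le> 1 + N t powr q" for t
    proof (cases "N t \<le> 1")
      case False
      then have "N t powr 1 \<le> N t powr q" using q by (intro powr_mono) auto
      then show ?thesis using False by simp
    qed (simp add: add_increasing2)
    interpret Lp_boundary C sg f h R 1 "\<lambda>t. N t powr q" N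
      by standard (use analytic ray hsm boundary Neq Nle Nq in \<open>auto simp: N_def[symmetric]\<close>, simp add: N_def)
    have "\<forall>y\<in>C. (\<integral>\<^sup>+ x. ennreal (norm (f (tube_pt x y)) powr q) \<partial>lebesgue) \<le> ennreal (LINT t|lborel. N t powr q)"
      using nn_integral_norm_f_powr_le[OF _ _ Nq] q by simp
    then show ?thesis
      using False analytic vector_representation by (auto simp: in_Hardy_def tube_def q_def)
  qed
qed

end
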